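(* Let $(H,A,C)$ and $(H,A,C')$ be monoidal Doi Hom-Hopf data (with the same $(H,\alpha)$ and $(A,\beta)$, and with $(C,\gamma)$, $(C',\gamma')$), and let $\xi=(\mathrm{id}_H,\mathrm{id}_A,\phi):(H,A,C)\to(H,A,C')$ be a monoidal morphism, i.e. $\phi:C\to C'$ is a monoidal Hom-bialgebra map with $\phi(h\cdot c)=h\cdot\phi(c)$. Let $F:{}_A\widetilde{\mathscr H}(\mathscr M_k)(H)^C\to{}_A\widetilde{\mathscr H}(\mathscr M_k)(H)^{C'}$ and $G:{}_A\widetilde{\mathscr H}(\mathscr M_k)(H)^{C'}\to{}_A\widetilde{\mathscr H}(\mathscr M_k)(H)^{C}$ be the induced functors. Then $$G(C')=C$$ (canonical isomorphism in ${}_A\widetilde{\mathscr H}(\mathscr M_k)(H)^{C}$). Let $(M,\mu)\in{}_A\widetilde{\mathscr H}(\mathscr M_k)(H)^C$ be flat as a $k$-module and let $(N,\nu)\in{}_A\widetilde{\mathscr H}(\mathscr M_k)(H)^{C'}$. If $(C,\gamma)$ is a monoidal Hom-Hopf algebra, then $$M\otimes G(N)\cong G(F(M)\otimes N)\quad\text{in }{}_A\widetilde{\mathscr H}(\mathscr M_k)(H)^C.$$ If $(C,\gamma)$ has a twisted antipode $\overline S$, then $$G(N)\otimes M\cong G(N\otimes F(M))\quad\text{in }{}_A\widetilde{\mathscr H}(\mathscr M_k)(H)^C.$$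
   Context: $k$ is a commutative ring and $\otimes=\otimes_k$. $\widetilde{\mathscr H}(\mathscr M_k)$ has objects pairs $(M,\mu)$, $M$ a $k$-module and $\mu$ a $k$-linear automorphism; morphisms are $k$-linear maps commuting with the automorphisms. It is symmetric monoidal (with the flip) via $(M,\mu)\otimes(N,\nu)=(M\otimes N,\mu\otimes\nu)$, with associator $(m\otimes n)\otimes p\mapsto\mu(m)\otimes(n\otimes\pi^{-1}(p))$. All structure maps below, and all maps of Hom-structures, are morphisms in this category. Monoidal Hom-algebra $(A,\beta)$: multiplication and $1_A$ with $\beta(ab)=\beta(a)\beta(b)$, $\beta(1_A)=1_A$, $\beta(a)(bc)=(ab)\beta(c)$, $a1_A=1_Aa=\beta(a)$. Monoidal Hom-coalgebra $(C,\gamma)$: $\Delta(c)=c_{(1)}\otimes c_{(2)}$ and $\varepsilon$, commuting with $\gamma$ ($\varepsilon\gamma=\varepsilon$), with $\gamma^{-1}(c_{(1)})\otimes c_{(2)(1)}\otimes c_{(2)(2)}=c_{(1)(1)}\otimes c_{(1)(2)}\otimes\gamma^{-1}(c_{(2)})$ and $\varepsilon(c_{(1)})c_{(2)}=\varepsilon(c_{(2)})c_{(1)}=\gamma^{-1}(c)$. Monoidal Hom-bialgebra: both structures with the same automorphism, $\Delta,\varepsilon$ multiplicative and unital. Monoidal Hom-Hopf algebra: a monoidal Hom-bialgebra with $k$-linear antipode $S$ commuting with the automorphism and $S(c_{(1)})c_{(2)}=c_{(1)}S(c_{(2)})=\varepsilon(c)1$. A twisted antipode $\overline S$ is a $k$-linear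 map commuting with the automorphism with $\overline S(c_{(2)})c_{(1)}=c_{(2)}\overline S(c_{(1)})=\varepsilon(c)1$. Left $(A,\beta)$-Hom-module $(M,\mu)$: $\beta(a)\cdot(b\cdot m)=(ab)\cdot\mu(m)$, $1_A\cdot m=\mu(m)$, $\mu(a\cdot m)=\beta(a)\cdot\mu(m)$. Right $(C,\gamma)$-Hom-comodule $(M,\mu)$: $\rho_M(m)=m_{[0]}\otimes m_{[1]}\in M\otimes C$ with $m_{[0][0]}\otimes m_{[0][1]}\otimes\gamma^{-1}(m_{[1]})=\mu^{-1}(m_{[0]})\otimes\Delta(m_{[1]})$, $m_{[0]}\varepsilon(m_{[1]})=\mu^{-1}(m)$, $\rho_M(\mu(m))=\mu(m_{[0]})\otimes\gamma(m_{[1]})$. A Doi Hom-Hopf datum $(H,A,C)$: a monoidal Hom-Hopf algebra $(H,\alpha)$; a right $(H,\alpha)$-Hom-comodule algebra $(A,\beta)$ (monoidal Hom-algebra and right $(H,\alpha)$-Hom-comodule with $\rho_A(ab)=a_{[0]}b_{[0]}\otimes a_{[1]}b_{[1]}$, $\rho_A(1_A)=1_A\otimes1_H$); a left $(H,\alpha)$-Hom-module coalgebra $(C,\gamma)$ (monoidal Hom-coalgebra and left $(H,\alpha)$-Hom-module with $\Delta_C(h\cdot c)=h_{(1)}\cdot c_{(1)}\otimes h_{(2)}\cdot c_{(2)}$, $\varepsilon_C(h\cdot c)=\varepsilon_H(h)\varepsilon_C(c)$). ${}_A\widetilde{\mathscr H}(\mathscr M_k)(H)^C$ is the category of Doi Hom-Hopf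 modules: $(M,\mu)$ a left $(A,\beta)$-Hom-module and right $(C,\gamma)$-Hom-comodule with $\rho_M(a\cdot m)=a_{[0]}\cdot m_{[0]}\otimes a_{[1]}\cdot m_{[1]}$; morphisms are $A$-linear $C$-colinear morphisms of $\widetilde{\mathscr H}(\mathscr M_k)$. The datum is monoidal if $A$ and $C$ are monoidal Hom-bialgebras (with the given algebra, resp. coalgebra, structures) such that for all $a\in A$, $c,d\in C$: $a_{(1)[0]}\otimes a_{(2)[0]}\otimes(a_{(1)[1]}\cdot c)(a_{(2)[1]}\cdot d)=a_{[0](1)}\otimes a_{[0](2)}\otimes a_{[1]}\cdot(cd)$ and $\varepsilon_A(a)1_C=\varepsilon_A(a_{[0]})(a_{[1]}\cdot1_C)$. Then the category is monoidal with $a\cdot(m\otimes n)=a_{(1)}\cdot m\otimes a_{(2)}\cdot n$, $\rho(m\otimes n)=m_{[0]}\otimes n_{[0]}\otimes m_{[1]}n_{[1]}$. $F(M)=A\otimes_AM\cong M$ is $M$ with the same $A$-action and $C'$-coaction $m\mapsto m_{[0]}\otimes\phi(m_{[1]})$. $G(N)=N\Box_{C'}C=\{\sum_in_i\otimes c_i\in N\otimes C:\sum_in_{i[0]}\otimes n_{i[1]}\otimes c_i=\sum_i\nu^{-1}(n_i)\otimes\phi(c_{i(1)})\otimes\gamma(c_{i(2)})\}$, with automorphism $\nu\otimes\gamma$, action $a\cdot(n\otimes c)=a_{[0]}\cdot n\otimes a_{[1]}\cdot c$ and coaction $n\otimes c\mapsto\nu^{-1}(n)\otimes c_{(1)}\otimes\gamma(c_{(2)})$.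 $C$ (and likewise $C'$) is regarded as a Doi Hom-Hopf module with coaction $\Delta_C$ and action $a\cdot c=\varepsilon_A(a_{[0]})\,\alpha(a_{[1]})\cdot c$.
   Formalization: For the two isomorphisms it is assumed that G(N) is well defined: the stated coaction formula determines exactly one element of G(N)⊗C for each element of G(N), and makes G(N) a Doi Hom-Hopf module. This can fail when C is not k-flat; for k-flat C it is automatic. *)

theory Defs
  imports "HOL-Algebra.Module" "HOL-Algebra.AbelCoset"
begin

section \<open>Modules over a commutative ring\<close>

definition linear_map ::
  "('k, 'r) ring_scheme \<Rightarrow> ('k, 'm, 'y) module_scheme \<Rightarrow> ('k, 'n, 'z) module_scheme \<Rightarrow> ('m \<Rightarrow> 'n) \<Rightarrow> bool"
  where "linear_map R M N f \<longleftrightarrow>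
    f \<in> carrier M \<rightarrow> carrier N \<and>
    (\<forall>x\<in>carrier M. \<forall>y\<in>carrier M. f (x \<oplus>\<^bsub>M\<^esub> y) = f x \<oplus>\<^bsub>N\<^esub> f y) \<and>
    (\<forall>r\<in>carrier R. \<forall>x\<in>carrier M. f (r \<odot>\<^bsub>M\<^esub> x) = r \<odot>\<^bsub>N\<^esub> f x)"

definition bilinear_map ::
  "('k, 'r) ring_scheme \<Rightarrow> ('k, 'm, 'x) module_scheme \<Rightarrow> ('k, 'n, 'y) module_scheme \<Rightarrow>
   ('k, 'p, 'z) module_scheme \<Rightarrow> ('m \<Rightarrow> 'n \<Rightarrow> 'p) \<Rightarrow> bool"
  where "bilinear_map R M N P f \<longleftrightarrow>
    (\<forall>x\<in>carrier M. linear_map R N P (f x)) \<and>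
    (\<forall>y\<in>carrier N. linear_map R M P (\<lambda>x. f x y))"

text \<open>Linear maps into the ring \<open>R\<close> itself, whose record type carries no \<open>smult\<close>.\<close>

definition linear_form ::
  "('k, 'r) ring_scheme \<Rightarrow> ('k, 'm, 'z) module_scheme \<Rightarrow> ('m \<Rightarrow> 'k) \<Rightarrow> bool"
  where "linear_form R M f \<longleftrightarrow>
    f \<in> carrier M \<rightarrow> carrier R \<and>
    (\<forall>x\<in>carrier M. \<forall>y\<in>carrier M. f (x \<oplus>\<^bsub>M\<^esub> y) = f x \<oplus>\<^bsub>R\<^esub> f y) \<and>
    (\<forall>r\<in>carrier R. \<forall>x\<in>carrier M. f (r \<odot>\<^bsub>M\<^esub> x) = r \<otimes>\<^bsub>R\<^esub> f x)"


subsection \<open>Tensor products\<close>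

text \<open>
  \<open>M \<otimes> N\<close> is the free \<open>R\<close>-module on \<open>carrier M \<times> carrier N\<close> modulo the submodule of bilinear
  relations.  Library module records extend ring records; the fields \<open>mult\<close> and \<open>one\<close> are
  irrelevant for a bare module.
\<close>

definition free_module :: "('k, 'r) ring_scheme \<Rightarrow> 's set \<Rightarrow> ('k, 's \<Rightarrow> 'k) module"
  where "free_module R S = \<lparr>
    carrier = {u. (\<forall>s. u s \<in> carrier R) \<and> (\<forall>s. s \<notin> S \<longrightarrow> u s = \<zero>\<^bsub>R\<^esub>) \<and> finite {s. u s \<noteq> \<zero>\<^bsub>R\<^esub>}},
    mult = undefined, one = undefined,
    zero = (\<lambda>_. \<zero>\<^bsub>R\<^esub>),
    add = (\<lambda>u v s. u s \<oplus>\<^bsub>R\<^esub> v s),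
    smult = (\<lambda>r u s. r \<otimes>\<^bsub>R\<^esub> u s)\<rparr>"

definition free_gen :: "('k, 'r) ring_scheme \<Rightarrow> 's \<Rightarrow> ('s \<Rightarrow> 'k)"
  where "free_gen R s = (\<lambda>t. if t = s then \<one>\<^bsub>R\<^esub> else \<zero>\<^bsub>R\<^esub>)"

definition submodule_generated ::
  "('k, 'r) ring_scheme \<Rightarrow> ('k, 'm) module \<Rightarrow> 'm set \<Rightarrow> 'm set"
  where "submodule_generated R M X = \<Inter> {N. submodule N R M \<and> X \<subseteq> N}"

definition quotient_module ::
  "('k, 'r) ring_scheme \<Rightarrow> ('k, 'm) module \<Rightarrow> 'm set \<Rightarrow> ('k, 'm set) module"
  where "quotient_module R M N = \<lparr>
    carrier = a_rcosets\<^bsub>M\<^esub> N,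
    mult = undefined, one = undefined,
    zero = N,
    add = set_add M,
    smult = (\<lambda>r X. \<Union>x\<in>X. N +>\<^bsub>M\<^esub> (r \<odot>\<^bsub>M\<^esub> x))\<rparr>"

type_synonym ('k, 'm, 'n) tensor = "('m \<times> 'n \<Rightarrow> 'k) set"

definition tensor_relations ::
  "('k, 'r) ring_scheme \<Rightarrow> ('k, 'm, 'y) module_scheme \<Rightarrow> ('k, 'n, 'z) module_scheme \<Rightarrow>
   ('m \<times> 'n \<Rightarrow> 'k) set"
  where "tensor_relations R M N =
    (let F = free_module R (carrier M \<times> carrier N); d = free_gen R in
     submodule_generated R F
      ({d (x \<oplus>\<^bsub>M\<^esub> x', y) \<ominus>\<^bsub>F\<^esub> (d (x, y) \<oplus>\<^bsub>F\<^esub> d (x', y)) | x x' y.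
          x \<in> carrier M \<and> x' \<in> carrier M \<and> y \<in> carrier N} \<union>
       {d (x, y \<oplus>\<^bsub>N\<^esub> y') \<ominus>\<^bsub>F\<^esub> (d (x, y) \<oplus>\<^bsub>F\<^esub> d (x, y')) | x y y'.
          x \<in> carrier M \<and> y \<in> carrier N \<and> y' \<in> carrier N} \<union>
       {d (r \<odot>\<^bsub>M\<^esub> x, y) \<ominus>\<^bsub>F\<^esub> (r \<odot>\<^bsub>F\<^esub> d (x, y)) | r x y.
          r \<in> carrier R \<and> x \<in> carrier M \<and> y \<in> carrier N} \<union>
       {d (x, r \<odot>\<^bsub>N\<^esub> y) \<ominus>\<^bsub>F\<^esub> (r \<odot>\<^bsub>F\<^esub> d (x, y)) | r x y.
          r \<in> carrier R \<and> x \<in> carrier M \<and> y \<in> carrier N}))"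

definition tensor ::
  "('k, 'r) ring_scheme \<Rightarrow> ('k, 'm, 'y) module_scheme \<Rightarrow> ('k, 'n, 'z) module_scheme \<Rightarrow>
   ('k, ('k, 'm, 'n) tensor) module"
  where "tensor R M N =
    quotient_module R (free_module R (carrier M \<times> carrier N)) (tensor_relations R M N)"

definition tens ::
  "('k, 'r) ring_scheme \<Rightarrow> ('k, 'm, 'y) module_scheme \<Rightarrow> ('k, 'n, 'z) module_scheme \<Rightarrow>
   'm \<Rightarrow> 'n \<Rightarrow> ('k, 'm, 'n) tensor"
  where "tens R M N x y =
    tensor_relations R M N +>\<^bsub>free_module R (carrier M \<times> carrier N)\<^esub> free_gen R (x, y)"

text \<open>
  Sweedler notation: for a representation \<open>t = \<Sum>\<^sub>i r\<^sub>i (x\<^sub>i \<otimes> y\<^sub>i)\<close>, the term \<open>sweedler R P t f\<close>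
  is \<open>\<Sum>\<^sub>i r\<^sub>i f x\<^sub>i y\<^sub>i\<close>, computed in \<open>P\<close>.  The choice of the representation is immaterial when \<open>f\<close>
  is bilinear into \<open>P\<close>; this is the only way it is used, so that \<open>sweedler R P _ f\<close> is the
  linear map on the tensor product induced by \<open>f\<close>.
\<close>

definition sweedler ::
  "('k, 'r) ring_scheme \<Rightarrow> ('k, 'p, 'z) module_scheme \<Rightarrow> ('k, 'm, 'n) tensor \<Rightarrow>
   ('m \<Rightarrow> 'n \<Rightarrow> 'p) \<Rightarrow> 'p"
  where "sweedler R P t f =
    (let u = (SOME u. u \<in> t) in
     finsum P (\<lambda>z. u z \<odot>\<^bsub>P\<^esub> f (fst z) (snd z)) {z. u z \<noteq> \<zero>\<^bsub>R\<^esub>})"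

abbreviation tensor3 where
  "tensor3 R M N P \<equiv> tensor R (tensor R M N) P"

abbreviation tens3 where
  "tens3 R M N P x y z \<equiv> tens R (tensor R M N) P (tens R M N x y) z"

text \<open>
  Flatness: \<open>M \<otimes> _\<close> preserves injectivity of linear maps.  HOL cannot quantify over types inside
  a formula, so the modules tested are those carried by subsets of a given type \<open>'x\<close>; a flat
  module is flat in this sense for every \<open>'x\<close>.  (Conversely, once \<open>'k\<close> embeds into \<open>'x\<close>, the
  inclusions of the ideals of \<open>R\<close> into \<open>R\<close> are among the maps tested.)
\<close>

definition flat_module ::
  "'x itself \<Rightarrow> ('k, 'r) ring_scheme \<Rightarrow> ('k, 'm, 'z) module_scheme \<Rightarrow> bool"
  where "flat_module T R M \<longleftrightarrow>
    module R M \<and>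
    (\<forall>(X :: ('k, 'x) module) (Y :: ('k, 'x) module) f.
       module R X \<and> module R Y \<and> linear_map R X Y f \<and> inj_on f (carrier X) \<longrightarrow>
       inj_on (\<lambda>t. sweedler R (tensor R M Y) t (\<lambda>m x. tens R M Y m (f x)))
         (carrier (tensor R M X)))"


section \<open>Hom-structures\<close>

text \<open>
  A Hom-algebra uses the fields \<open>mult\<close> and \<open>one\<close> that a module record inherits from ring records.
\<close>

record ('k, 'm) hom_mod = "('k, 'm) module" +
  aut :: "'m \<Rightarrow> 'm"

record ('k, 'm) hom_coalg = "('k, 'm) hom_mod" +
  comul :: "'m \<Rightarrow> ('k, 'm, 'm) tensor"
  counit :: "'m \<Rightarrow> 'k"

definition aut_inv :: "('k, 'm, 'z) hom_mod_scheme \<Rightarrow> 'm \<Rightarrow> 'm"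
  where "aut_inv M = inv_into (carrier M) (aut M)"

definition hom_object :: "('k, 'r) ring_scheme \<Rightarrow> ('k, 'm, 'z) hom_mod_scheme \<Rightarrow> bool"
  where "hom_object R M \<longleftrightarrow>
    module R M \<and> linear_map R M M (aut M) \<and> bij_betw (aut M) (carrier M) (carrier M)"

definition hom_algebra :: "('k, 'r) ring_scheme \<Rightarrow> ('k, 'a, 'z) hom_mod_scheme \<Rightarrow> bool"
  where "hom_algebra R A \<longleftrightarrow>
    hom_object R A \<and>
    bilinear_map R A A A (mult A) \<and>
    \<one>\<^bsub>A\<^esub> \<in> carrier A \<and>
    (\<forall>a\<in>carrier A. \<forall>b\<in>carrier A. aut A (a \<otimes>\<^bsub>A\<^esub> b) = aut A a \<otimes>\<^bsub>A\<^esub> aut A b) \<and>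
    aut A \<one>\<^bsub>A\<^esub> = \<one>\<^bsub>A\<^esub> \<and>
    (\<forall>a\<in>carrier A. \<forall>b\<in>carrier A. \<forall>c\<in>carrier A.
       aut A a \<otimes>\<^bsub>A\<^esub> (b \<otimes>\<^bsub>A\<^esub> c) = (a \<otimes>\<^bsub>A\<^esub> b) \<otimes>\<^bsub>A\<^esub> aut A c) \<and>
    (\<forall>a\<in>carrier A. a \<otimes>\<^bsub>A\<^esub> \<one>\<^bsub>A\<^esub> = aut A a \<and> \<one>\<^bsub>A\<^esub> \<otimes>\<^bsub>A\<^esub> a = aut A a)"

definition hom_coalgebra :: "('k, 'r) ring_scheme \<Rightarrow> ('k, 'c, 'z) hom_coalg_scheme \<Rightarrow> bool"
  where "hom_coalgebra R C \<longleftrightarrow>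
    hom_object R C \<and>
    linear_map R C (tensor R C C) (comul C) \<and>
    linear_form R C (counit C) \<and>
    (\<forall>c\<in>carrier C.
       comul C (aut C c) =
         sweedler R (tensor R C C) (comul C c) (\<lambda>c1 c2. tens R C C (aut C c1) (aut C c2))) \<and>
    (\<forall>c\<in>carrier C. counit C (aut C c) = counit C c) \<and>
    (\<forall>c\<in>carrier C.
       sweedler R (tensor3 R C C C) (comul C c) (\<lambda>c1 c2.
         sweedler R (tensor3 R C C C) (comul C c2) (\<lambda>c21 c22.
           tens3 R C C C (aut_inv C c1) c21 c22)) =
       sweedler R (tensor3 R C C C) (comul C c) (\<lambda>c1 c2.
         sweedler R (tensor3 R C C C) (comul C c1) (\<lambda>c11 c12.
           tens3 R C C C c11 c12 (aut_inv C c2)))) \<and>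
    (\<forall>c\<in>carrier C.
       sweedler R C (comul C c) (\<lambda>c1 c2. counit C c1 \<odot>\<^bsub>C\<^esub> c2) = aut_inv C c \<and>
       sweedler R C (comul C c) (\<lambda>c1 c2. counit C c2 \<odot>\<^bsub>C\<^esub> c1) = aut_inv C c)"

definition hom_bialgebra :: "('k, 'r) ring_scheme \<Rightarrow> ('k, 'c, 'z) hom_coalg_scheme \<Rightarrow> bool"
  where "hom_bialgebra R B \<longleftrightarrow>
    hom_algebra R B \<and> hom_coalgebra R B \<and>
    (\<forall>a\<in>carrier B. \<forall>b\<in>carrier B.
       comul B (a \<otimes>\<^bsub>B\<^esub> b) =
         sweedler R (tensor R B B) (comul B a) (\<lambda>a1 a2.
           sweedler R (tensor R B B) (comul B b) (\<lambda>b1 b2.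
             tens R B B (a1 \<otimes>\<^bsub>B\<^esub> b1) (a2 \<otimes>\<^bsub>B\<^esub> b2)))) \<and>
    comul B \<one>\<^bsub>B\<^esub> = tens R B B \<one>\<^bsub>B\<^esub> \<one>\<^bsub>B\<^esub> \<and>
    (\<forall>a\<in>carrier B. \<forall>b\<in>carrier B. counit B (a \<otimes>\<^bsub>B\<^esub> b) = counit B a \<otimes>\<^bsub>R\<^esub> counit B b) \<and>
    counit B \<one>\<^bsub>B\<^esub> = \<one>\<^bsub>R\<^esub>"

definition is_antipode ::
  "('k, 'r) ring_scheme \<Rightarrow> ('k, 'c, 'z) hom_coalg_scheme \<Rightarrow> ('c \<Rightarrow> 'c) \<Rightarrow> bool"
  where "is_antipode R B S \<longleftrightarrow>
    linear_map R B B S \<and>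
    (\<forall>c\<in>carrier B. S (aut B c) = aut B (S c)) \<and>
    (\<forall>c\<in>carrier B.
       sweedler R B (comul B c) (\<lambda>c1 c2. S c1 \<otimes>\<^bsub>B\<^esub> c2) = counit B c \<odot>\<^bsub>B\<^esub> \<one>\<^bsub>B\<^esub> \<and>
       sweedler R B (comul B c) (\<lambda>c1 c2. c1 \<otimes>\<^bsub>B\<^esub> S c2) = counit B c \<odot>\<^bsub>B\<^esub> \<one>\<^bsub>B\<^esub>)"

definition is_twisted_antipode ::
  "('k, 'r) ring_scheme \<Rightarrow> ('k, 'c, 'z) hom_coalg_scheme \<Rightarrow> ('c \<Rightarrow> 'c) \<Rightarrow> bool"
  where "is_twisted_antipode R B S \<longleftrightarrow>
    linear_map R B B S \<and>
    (\<forall>c\<in>carrier B. S (aut B c) = aut B (S c)) \<and>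
    (\<forall>c\<in>carrier B.
       sweedler R B (comul B c) (\<lambda>c1 c2. S c2 \<otimes>\<^bsub>B\<^esub> c1) = counit B c \<odot>\<^bsub>B\<^esub> \<one>\<^bsub>B\<^esub> \<and>
       sweedler R B (comul B c) (\<lambda>c1 c2. c2 \<otimes>\<^bsub>B\<^esub> S c1) = counit B c \<odot>\<^bsub>B\<^esub> \<one>\<^bsub>B\<^esub>)"

definition hom_hopf_algebra :: "('k, 'r) ring_scheme \<Rightarrow> ('k, 'c, 'z) hom_coalg_scheme \<Rightarrow> bool"
  where "hom_hopf_algebra R B \<longleftrightarrow> hom_bialgebra R B \<and> (\<exists>S. is_antipode R B S)"

definition hom_left_module ::
  "('k, 'r) ring_scheme \<Rightarrow> ('k, 'a, 'y) hom_mod_scheme \<Rightarrow> ('k, 'm, 'z) hom_mod_scheme \<Rightarrow>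
   ('a \<Rightarrow> 'm \<Rightarrow> 'm) \<Rightarrow> bool"
  where "hom_left_module R A M l \<longleftrightarrow>
    hom_object R M \<and>
    bilinear_map R A M M l \<and>
    (\<forall>a\<in>carrier A. \<forall>b\<in>carrier A. \<forall>m\<in>carrier M. l (aut A a) (l b m) = l (a \<otimes>\<^bsub>A\<^esub> b) (aut M m)) \<and>
    (\<forall>m\<in>carrier M. l \<one>\<^bsub>A\<^esub> m = aut M m) \<and>
    (\<forall>a\<in>carrier A. \<forall>m\<in>carrier M. aut M (l a m) = l (aut A a) (aut M m))"

definition hom_right_comodule ::
  "('k, 'r) ring_scheme \<Rightarrow> ('k, 'c, 'y) hom_coalg_scheme \<Rightarrow> ('k, 'm, 'z) hom_mod_scheme \<Rightarrow>
   ('m \<Rightarrow> ('k, 'm, 'c) tensor) \<Rightarrow> bool"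
  where "hom_right_comodule R C M \<rho> \<longleftrightarrow>
    hom_object R M \<and>
    linear_map R M (tensor R M C) \<rho> \<and>
    (\<forall>m\<in>carrier M.
       sweedler R (tensor3 R M C C) (\<rho> m) (\<lambda>m0 m1.
         sweedler R (tensor3 R M C C) (\<rho> m0) (\<lambda>m00 m01.
           tens3 R M C C m00 m01 (aut_inv C m1))) =
       sweedler R (tensor3 R M C C) (\<rho> m) (\<lambda>m0 m1.
         sweedler R (tensor3 R M C C) (comul C m1) (\<lambda>m11 m12.
           tens3 R M C C (aut_inv M m0) m11 m12))) \<and>
    (\<forall>m\<in>carrier M. sweedler R M (\<rho> m) (\<lambda>m0 m1. counit C m1 \<odot>\<^bsub>M\<^esub> m0) = aut_inv M m) \<and>
    (\<forall>m\<in>carrier M.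
       \<rho> (aut M m) = sweedler R (tensor R M C) (\<rho> m) (\<lambda>m0 m1. tens R M C (aut M m0) (aut C m1)))"


section \<open>Doi Hom-Hopf data\<close>

record ('k, 'h, 'a) comod_alg = "('k, 'a) hom_coalg" +
  hcoact :: "'a \<Rightarrow> ('k, 'a, 'h) tensor"

record ('k, 'h, 'c) mod_coalg = "('k, 'c) hom_coalg" +
  hact :: "'h \<Rightarrow> 'c \<Rightarrow> 'c"

text \<open>
  The records allow for both structures on \<open>A\<close> and \<open>C\<close>, as in a monoidal datum; a
  Hom-comodule algebra makes no use of \<open>comul\<close> and \<open>counit\<close>, a Hom-module coalgebra none of
  \<open>mult\<close> and \<open>one\<close>.
\<close>

definition hom_comodule_algebra ::
  "('k, 'r) ring_scheme \<Rightarrow> ('k, 'h, 'y) hom_coalg_scheme \<Rightarrow> ('k, 'h, 'a) comod_alg \<Rightarrow> bool"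
  where "hom_comodule_algebra R H A \<longleftrightarrow>
    hom_algebra R A \<and> hom_right_comodule R H A (hcoact A) \<and>
    (\<forall>a\<in>carrier A. \<forall>b\<in>carrier A.
       hcoact A (a \<otimes>\<^bsub>A\<^esub> b) =
         sweedler R (tensor R A H) (hcoact A a) (\<lambda>a0 a1.
           sweedler R (tensor R A H) (hcoact A b) (\<lambda>b0 b1.
             tens R A H (a0 \<otimes>\<^bsub>A\<^esub> b0) (a1 \<otimes>\<^bsub>H\<^esub> b1)))) \<and>
    hcoact A \<one>\<^bsub>A\<^esub> = tens R A H \<one>\<^bsub>A\<^esub> \<one>\<^bsub>H\<^esub>"

definition hom_module_coalgebra ::
  "('k, 'r) ring_scheme \<Rightarrow> ('k, 'h, 'y) hom_coalg_scheme \<Rightarrow> ('k, 'h, 'c) mod_coalg \<Rightarrow> bool"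
  where "hom_module_coalgebra R H C \<longleftrightarrow>
    hom_coalgebra R C \<and> hom_left_module R H C (hact C) \<and>
    (\<forall>h\<in>carrier H. \<forall>c\<in>carrier C.
       comul C (hact C h c) =
         sweedler R (tensor R C C) (comul H h) (\<lambda>h1 h2.
           sweedler R (tensor R C C) (comul C c) (\<lambda>c1 c2.
             tens R C C (hact C h1 c1) (hact C h2 c2)))) \<and>
    (\<forall>h\<in>carrier H. \<forall>c\<in>carrier C. counit C (hact C h c) = counit H h \<otimes>\<^bsub>R\<^esub> counit C c)"

definition doi_datum ::
  "('k, 'r) ring_scheme \<Rightarrow> ('k, 'h) hom_coalg \<Rightarrow> ('k, 'h, 'a) comod_alg \<Rightarrow>
   ('k, 'h, 'c) mod_coalg \<Rightarrow> bool"
  where "doi_datum R H A C \<longleftrightarrow>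
    hom_hopf_algebra R H \<and> hom_comodule_algebra R H A \<and> hom_module_coalgebra R H C"

definition monoidal_doi_datum ::
  "('k, 'r) ring_scheme \<Rightarrow> ('k, 'h) hom_coalg \<Rightarrow> ('k, 'h, 'a) comod_alg \<Rightarrow>
   ('k, 'h, 'c) mod_coalg \<Rightarrow> bool"
  where "monoidal_doi_datum R H A C \<longleftrightarrow>
    doi_datum R H A C \<and> hom_bialgebra R A \<and> hom_bialgebra R C \<and>
    (\<forall>a\<in>carrier A. \<forall>c\<in>carrier C. \<forall>d\<in>carrier C.
       sweedler R (tensor3 R A A C) (comul A a) (\<lambda>a1 a2.
         sweedler R (tensor3 R A A C) (hcoact A a1) (\<lambda>a10 a11.
           sweedler R (tensor3 R A A C) (hcoact A a2) (\<lambda>a20 a21.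
             tens3 R A A C a10 a20 (hact C a11 c \<otimes>\<^bsub>C\<^esub> hact C a21 d)))) =
       sweedler R (tensor3 R A A C) (hcoact A a) (\<lambda>a0 a1.
         sweedler R (tensor3 R A A C) (comul A a0) (\<lambda>a01 a02.
           tens3 R A A C a01 a02 (hact C a1 (c \<otimes>\<^bsub>C\<^esub> d))))) \<and>
    (\<forall>a\<in>carrier A.
       counit A a \<odot>\<^bsub>C\<^esub> \<one>\<^bsub>C\<^esub> =
         sweedler R C (hcoact A a) (\<lambda>a0 a1. counit A a0 \<odot>\<^bsub>C\<^esub> hact C a1 \<one>\<^bsub>C\<^esub>))"

text \<open>The monoidal morphisms \<open>(id\<^sub>H, id\<^sub>A, \<phi>)\<close>.\<close>

definition monoidal_doi_morphism ::
  "('k, 'r) ring_scheme \<Rightarrow> ('k, 'h) hom_coalg \<Rightarrow> ('k, 'h, 'c) mod_coalg \<Rightarrow>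
   ('k, 'h, 'd) mod_coalg \<Rightarrow> ('c \<Rightarrow> 'd) \<Rightarrow> bool"
  where "monoidal_doi_morphism R H C D \<phi> \<longleftrightarrow>
    linear_map R C D \<phi> \<and>
    (\<forall>c\<in>carrier C. \<phi> (aut C c) = aut D (\<phi> c)) \<and>
    (\<forall>c\<in>carrier C. \<forall>d\<in>carrier C. \<phi> (c \<otimes>\<^bsub>C\<^esub> d) = \<phi> c \<otimes>\<^bsub>D\<^esub> \<phi> d) \<and>
    \<phi> \<one>\<^bsub>C\<^esub> = \<one>\<^bsub>D\<^esub> \<and>
    (\<forall>c\<in>carrier C.
       comul D (\<phi> c) =
         sweedler R (tensor R D D) (comul C c) (\<lambda>c1 c2. tens R D D (\<phi> c1) (\<phi> c2))) \<and>
    (\<forall>c\<in>carrier C. counit D (\<phi> c) = counit C c) \<and>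
    (\<forall>h\<in>carrier H. \<forall>c\<in>carrier C. \<phi> (hact C h c) = hact D h (\<phi> c))"


section \<open>Doi Hom-Hopf modules\<close>

record ('k, 'a, 'c, 'm) dhh = "('k, 'm) hom_mod" +
  act :: "'a \<Rightarrow> 'm \<Rightarrow> 'm"
  coact :: "'m \<Rightarrow> ('k, 'm, 'c) tensor"

definition dhh_make ::
  "('k, 'm, 'z) module_scheme \<Rightarrow> ('m \<Rightarrow> 'm) \<Rightarrow> ('a \<Rightarrow> 'm \<Rightarrow> 'm) \<Rightarrow>
   ('m \<Rightarrow> ('k, 'm, 'c) tensor) \<Rightarrow> ('k, 'a, 'c, 'm) dhh"
  where "dhh_make M \<mu> l \<rho> = \<lparr>
    carrier = carrier M, mult = mult M, one = one M, zero = zero M, add = add M, smult = smult M,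
    aut = \<mu>, act = l, coact = \<rho>\<rparr>"

definition dhh_module ::
  "('k, 'r) ring_scheme \<Rightarrow> ('k, 'h, 'a) comod_alg \<Rightarrow> ('k, 'h, 'c) mod_coalg \<Rightarrow>
   ('k, 'a, 'c, 'm) dhh \<Rightarrow> bool"
  where "dhh_module R A C M \<longleftrightarrow>
    hom_left_module R A M (act M) \<and> hom_right_comodule R C M (coact M) \<and>
    (\<forall>a\<in>carrier A. \<forall>m\<in>carrier M.
       coact M (act M a m) =
         sweedler R (tensor R M C) (hcoact A a) (\<lambda>a0 a1.
           sweedler R (tensor R M C) (coact M m) (\<lambda>m0 m1.
             tens R M C (act M a0 m0) (hact C a1 m1))))"

definition dhh_morphism ::
  "('k, 'r) ring_scheme \<Rightarrow> ('k, 'h, 'a) comod_alg \<Rightarrow> ('k, 'h, 'c) mod_coalg \<Rightarrow>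
   ('k, 'a, 'c, 'm) dhh \<Rightarrow> ('k, 'a, 'c, 'n) dhh \<Rightarrow> ('m \<Rightarrow> 'n) \<Rightarrow> bool"
  where "dhh_morphism R A C M N f \<longleftrightarrow>
    linear_map R M N f \<and>
    (\<forall>m\<in>carrier M. f (aut M m) = aut N (f m)) \<and>
    (\<forall>a\<in>carrier A. \<forall>m\<in>carrier M. f (act M a m) = act N a (f m)) \<and>
    (\<forall>m\<in>carrier M.
       coact N (f m) = sweedler R (tensor R N C) (coact M m) (\<lambda>m0 m1. tens R N C (f m0) m1))"

definition dhh_iso_map ::
  "('k, 'r) ring_scheme \<Rightarrow> ('k, 'h, 'a) comod_alg \<Rightarrow> ('k, 'h, 'c) mod_coalg \<Rightarrow>
   ('k, 'a, 'c, 'm) dhh \<Rightarrow> ('k, 'a, 'c, 'n) dhh \<Rightarrow> ('m \<Rightarrow> 'n) \<Rightarrow> bool"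
  where "dhh_iso_map R A C M N f \<longleftrightarrow>
    dhh_module R A C M \<and> dhh_module R A C N \<and> dhh_morphism R A C M N f \<and>
    (\<exists>g. dhh_morphism R A C N M g \<and>
       (\<forall>m\<in>carrier M. g (f m) = m) \<and> (\<forall>n\<in>carrier N. f (g n) = n))"

definition dhh_isomorphic ::
  "('k, 'r) ring_scheme \<Rightarrow> ('k, 'h, 'a) comod_alg \<Rightarrow> ('k, 'h, 'c) mod_coalg \<Rightarrow>
   ('k, 'a, 'c, 'm) dhh \<Rightarrow> ('k, 'a, 'c, 'n) dhh \<Rightarrow> bool"
  where "dhh_isomorphic R A C M N \<longleftrightarrow> (\<exists>f. dhh_iso_map R A C M N f)"

definition dhh_tensor ::
  "('k, 'r) ring_scheme \<Rightarrow> ('k, 'h, 'a) comod_alg \<Rightarrow> ('k, 'h, 'c) mod_coalg \<Rightarrow>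
   ('k, 'a, 'c, 'm) dhh \<Rightarrow> ('k, 'a, 'c, 'n) dhh \<Rightarrow> ('k, 'a, 'c, ('k, 'm, 'n) tensor) dhh"
  where "dhh_tensor R A C M N =
    dhh_make (tensor R M N)
      (\<lambda>t. sweedler R (tensor R M N) t (\<lambda>m n. tens R M N (aut M m) (aut N n)))
      (\<lambda>a t. sweedler R (tensor R M N) (comul A a) (\<lambda>a1 a2.
         sweedler R (tensor R M N) t (\<lambda>m n. tens R M N (act M a1 m) (act N a2 n))))
      (\<lambda>t. sweedler R (tensor3 R M N C) t (\<lambda>m n.
         sweedler R (tensor3 R M N C) (coact M m) (\<lambda>m0 m1.
           sweedler R (tensor3 R M N C) (coact N n) (\<lambda>n0 n1.
             tens3 R M N C m0 n0 (m1 \<otimes>\<^bsub>C\<^esub> n1)))))"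

definition self_dhh ::
  "('k, 'r) ring_scheme \<Rightarrow> ('k, 'h) hom_coalg \<Rightarrow> ('k, 'h, 'a) comod_alg \<Rightarrow>
   ('k, 'h, 'c) mod_coalg \<Rightarrow> ('k, 'a, 'c, 'c) dhh"
  where "self_dhh R H A C =
    dhh_make C (aut C)
      (\<lambda>a c. sweedler R C (hcoact A a) (\<lambda>a0 a1. counit A a0 \<odot>\<^bsub>C\<^esub> hact C (aut H a1) c))
      (comul C)"


section \<open>The functors induced by \<open>\<phi>\<close>\<close>

text \<open>\<open>A \<otimes>\<^sub>A M\<close> is identified with \<open>M\<close>.\<close>

definition induced_F ::
  "('k, 'r) ring_scheme \<Rightarrow> ('k, 'h, 'd) mod_coalg \<Rightarrow> ('c \<Rightarrow> 'd) \<Rightarrow>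
   ('k, 'a, 'c, 'm) dhh \<Rightarrow> ('k, 'a, 'd, 'm) dhh"
  where "induced_F R D \<phi> M =
    dhh_make M (aut M) (act M)
      (\<lambda>m. sweedler R (tensor R M D) (coact M m) (\<lambda>m0 m1. tens R M D m0 (\<phi> m1)))"

definition cotensor ::
  "('k, 'r) ring_scheme \<Rightarrow> ('k, 'h, 'c) mod_coalg \<Rightarrow> ('k, 'h, 'd) mod_coalg \<Rightarrow> ('c \<Rightarrow> 'd) \<Rightarrow>
   ('k, 'a, 'd, 'n) dhh \<Rightarrow> ('k, 'n, 'c) tensor set"
  where "cotensor R C D \<phi> N = {t \<in> carrier (tensor R N C).
    sweedler R (tensor3 R N D C) t (\<lambda>n c.
      sweedler R (tensor3 R N D C) (coact N n) (\<lambda>n0 n1. tens3 R N D C n0 n1 c)) =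
    sweedler R (tensor3 R N D C) t (\<lambda>n c.
      sweedler R (tensor3 R N D C) (comul C c) (\<lambda>c1 c2.
        tens3 R N D C (aut_inv N n) (\<phi> c1) (aut C c2)))}"

definition cotensor_module ::
  "('k, 'r) ring_scheme \<Rightarrow> ('k, 'h, 'c) mod_coalg \<Rightarrow> ('k, 'h, 'd) mod_coalg \<Rightarrow> ('c \<Rightarrow> 'd) \<Rightarrow>
   ('k, 'a, 'd, 'n) dhh \<Rightarrow> ('k, ('k, 'n, 'c) tensor) module"
  where "cotensor_module R C D \<phi> N = (tensor R N C)\<lparr>carrier := cotensor R C D \<phi> N\<rparr>"

text \<open>
  The coaction \<open>n \<otimes> c \<mapsto> (\<nu>\<^sup>-\<^sup>1(n) \<otimes> c\<^sub>1) \<otimes> \<gamma>(c\<^sub>2)\<close> of the cotensor product is a priori an element of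
  \<open>(N \<otimes> C) \<otimes> C\<close>.  It denotes an element of \<open>(N \<box> C) \<otimes> C\<close> when it has exactly one preimage
  under the map \<open>(N \<box> C) \<otimes> C \<rightarrow> (N \<otimes> C) \<otimes> C\<close> induced by the inclusion; over a general base
  ring that map need not be injective.
\<close>

definition is_induced_coaction ::
  "('k, 'r) ring_scheme \<Rightarrow> ('k, 'h, 'c) mod_coalg \<Rightarrow> ('k, 'h, 'd) mod_coalg \<Rightarrow> ('c \<Rightarrow> 'd) \<Rightarrow>
   ('k, 'a, 'd, 'n) dhh \<Rightarrow> ('k, 'n, 'c) tensor \<Rightarrow> ('k, ('k, 'n, 'c) tensor, 'c) tensor \<Rightarrow> bool"
  where "is_induced_coaction R C D \<phi> N x t \<longleftrightarrow>
    t \<in> carrier (tensor R (cotensor_module R C D \<phi> N) C) \<and>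
    sweedler R (tensor3 R N C C) t (\<lambda>y c. tens R (tensor R N C) C y c) =
    sweedler R (tensor3 R N C C) x (\<lambda>n c.
      sweedler R (tensor3 R N C C) (comul C c) (\<lambda>c1 c2.
        tens3 R N C C (aut_inv N n) c1 (aut C c2)))"

definition induced_G ::
  "('k, 'r) ring_scheme \<Rightarrow> ('k, 'h, 'a) comod_alg \<Rightarrow> ('k, 'h, 'c) mod_coalg \<Rightarrow>
   ('k, 'h, 'd) mod_coalg \<Rightarrow> ('c \<Rightarrow> 'd) \<Rightarrow>
   ('k, 'a, 'd, 'n) dhh \<Rightarrow> ('k, 'a, 'c, ('k, 'n, 'c) tensor) dhh"
  where "induced_G R A C D \<phi> N =
    dhh_make (cotensor_module R C D \<phi> N)
      (\<lambda>t. sweedler R (tensor R N C) t (\<lambda>n c. tens R N C (aut N n) (aut C c)))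
      (\<lambda>a t. sweedler R (tensor R N C) (hcoact A a) (\<lambda>a0 a1.
         sweedler R (tensor R N C) t (\<lambda>n c. tens R N C (act N a0 n) (hact C a1 c))))
      (\<lambda>x. THE t. is_induced_coaction R C D \<phi> N x t)"

text \<open>
  \<open>G(N)\<close> is defined: its coaction is well defined on the cotensor product and makes it an object
  of the category.  This is automatic when \<open>C\<close> is flat over \<open>R\<close>.
\<close>

definition G_defined_at ::
  "('k, 'r) ring_scheme \<Rightarrow> ('k, 'h, 'a) comod_alg \<Rightarrow> ('k, 'h, 'c) mod_coalg \<Rightarrow>
   ('k, 'h, 'd) mod_coalg \<Rightarrow> ('c \<Rightarrow> 'd) \<Rightarrow> ('k, 'a, 'd, 'n) dhh \<Rightarrow> bool"
  where "G_defined_at R A C D \<phi> N \<longleftrightarrow>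
    (\<forall>x \<in> cotensor R C D \<phi> N. \<exists>!t. is_induced_coaction R C D \<phi> N x t) \<and>
    dhh_module R A C (induced_G R A C D \<phi> N)"

end

theory Submission
  imports Defs
begin

text \<open>
  All maps in sight are determined by their values on pure tensors, so an identity between them is
  proved by rewriting both sides to a normal form of nested Sweedler sums.

  If \<open>E\<close> is a Doi Hom-Hopf module over \<open>C\<close> and \<open>J : E \<rightarrow> P \<otimes> C\<close> is an injective map onto the cotensor
  product \<open>P \<box> C\<close> that respects the actions and coactions, and \<open>J \<otimes> C\<close> is injective too, then \<open>G(P)\<close>
  is defined and \<open>J : E \<cong> G(P)\<close>.  For \<open>P = C'\<close> and \<open>E = C\<close> one takes \<open>J(c) = \<phi>(c\<^sub>1) \<otimes> c\<^sub>2\<close>, which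
  \<open>\<epsilon> \<otimes> \<gamma>\<close> splits.  For \<open>P = F(M) \<otimes> N\<close> and \<open>E = M \<otimes> G(N)\<close> one takes the restriction of
  \<open>\<Theta>(m \<otimes> (n \<otimes> c)) = (m\<^sub>0 \<otimes> n) \<otimes> m\<^sub>1 c\<close>, whose inverse on \<open>(M \<otimes> N) \<otimes> C\<close> sends \<open>(m \<otimes> n) \<otimes> c\<close> to
  \<open>\<mu>\<^sup>2(m\<^sub>0) \<otimes> (n \<otimes> S(m\<^sub>1) \<gamma>\<^sup>-\<^sup>2(c))\<close>; flatness of \<open>M\<close> makes \<open>M \<otimes> G(N)\<close> the equalizer of the two
  maps defining \<open>M \<otimes> (N \<box> C)\<close>.  The twisted case is the previous one for the datum with the opposite
  multiplication on \<open>C\<close> and the opposite comultiplication on \<open>A\<close>: a twisted antipode of \<open>C\<close> is an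
  antipode of \<open>C\<^sup>o\<^sup>p\<close>, and the flip exchanges the tensor factors.
\<close>

section \<open>Linear maps, submodules and quotients\<close>

text \<open>The base ring is arbitrary, so tensoring need not preserve injectivity, and this shapes
  the argument. The coaction of \<open>G(N)\<close> is known only through its image in
  \<open>(N \<otimes> C) \<otimes> C\<close>; hence a sum over it is evaluated only after its
  summand has been extended from the cotensor product to all of \<open>N \<otimes> C\<close>. And
  \<open>G(P)\<close> is defined only if each coaction has exactly one preimage. Existence is
  supplied by the coaction of \<open>E\<close>; uniqueness is the delicate half. For
  \<open>M \<otimes> G(N)\<close> it comes from the hypothesis that \<open>G(N)\<close> itself is
  defined, which makes \<open>(N \<box> C) \<otimes> C \<rightarrow> (N \<otimes> C) \<otimes>
  C\<close> injective, a property that flatness of \<open>M\<close> preserves. So flatness is tested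
  on three maps: this one, the inclusion of \<open>N \<box> C\<close> in
  \<open>N \<otimes> C\<close>, and the inclusion of the image of the difference of the two maps
  defining \<open>N \<box> C\<close>. Since \<open>G\<close> is partial, the twisted case must carry
  along the flip not only the isomorphism but also the fact that \<open>G\<close> is
  defined.\<close>

lemma linear_mapI:
  assumes "\<And>x. x \<in> carrier M \<Longrightarrow> f x \<in> carrier N"
    and "\<And>x y. x \<in> carrier M \<Longrightarrow> y \<in> carrier M \<Longrightarrow> f (x \<oplus>\<^bsub>M\<^esub> y) = f x \<oplus>\<^bsub>N\<^esub> f y"
    and "\<And>r x. r \<in> carrier R \<Longrightarrow> x \<in> carrier M \<Longrightarrow> f (r \<odot>\<^bsub>M\<^esub> x) = r \<odot>\<^bsub>N\<^esub> f x"
  shows "linear_map R M N f"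
  using assms by (auto simp: linear_map_def)

lemma linear_mapD:
  assumes "linear_map R M N f"
  shows "x \<in> carrier M \<Longrightarrow> f x \<in> carrier N"
    and "x \<in> carrier M \<Longrightarrow> y \<in> carrier M \<Longrightarrow> f (x \<oplus>\<^bsub>M\<^esub> y) = f x \<oplus>\<^bsub>N\<^esub> f y"
    and "r \<in> carrier R \<Longrightarrow> x \<in> carrier M \<Longrightarrow> f (r \<odot>\<^bsub>M\<^esub> x) = r \<odot>\<^bsub>N\<^esub> f x"
  using assms by (auto simp: linear_map_def)

lemma bilinear_mapI:
  assumes "\<And>x. x \<in> carrier M \<Longrightarrow> linear_map R N P (\<lambda>y. f x y)"
    and "\<And>y. y \<in> carrier N \<Longrightarrow> linear_map R M P (\<lambda>x. f x y)"
  shows "bilinear_map R M N P f"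
  using assms by (auto simp: bilinear_map_def)

lemma bilinear_mapD:
  assumes "bilinear_map R M N P f"
  shows "x \<in> carrier M \<Longrightarrow> linear_map R N P (\<lambda>y. f x y)"
    and "y \<in> carrier N \<Longrightarrow> linear_map R M P (\<lambda>x. f x y)"
    and "x \<in> carrier M \<Longrightarrow> y \<in> carrier N \<Longrightarrow> f x y \<in> carrier P"
  using assms by (auto simp: bilinear_map_def intro: linear_mapD(1))

lemma linear_map_cong:
  assumes "\<And>x. x \<in> carrier M \<Longrightarrow> f x = g x" "linear_map R M N f" "abelian_monoid M"
    "\<And>r x. r \<in> carrier R \<Longrightarrow> x \<in> carrier M \<Longrightarrow> r \<odot>\<^bsub>M\<^esub> x \<in> carrier M"
  shows "linear_map R M N g"
  using assms(1,2,4) abelian_monoid.a_closed[OF assms(3)]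
  by (intro linear_mapI) (auto simp flip: assms(1) simp: linear_mapD[OF assms(2)])

lemma linear_map_zero:
  assumes "module R M" "module R N" "linear_map R M N f"
  shows "f \<zero>\<^bsub>M\<^esub> = \<zero>\<^bsub>N\<^esub>"
proof -
  interpret M: module R M by fact
  interpret N: module R N by fact
  have "f \<zero>\<^bsub>M\<^esub> = f (\<zero>\<^bsub>R\<^esub> \<odot>\<^bsub>M\<^esub> \<zero>\<^bsub>M\<^esub>)" by simp
  also have "\<dots> = \<zero>\<^bsub>R\<^esub> \<odot>\<^bsub>N\<^esub> f \<zero>\<^bsub>M\<^esub>"
    by (rule linear_mapD(3)[OF assms(3)]) auto
  also have "\<dots> = \<zero>\<^bsub>N\<^esub>" using linear_mapD(1)[OF assms(3)] by auto
  finally show ?thesis .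
qed

lemma linear_map_minus:
  assumes "module R M" "module R N" "linear_map R M N f" "x \<in> carrier M"
  shows "f (\<ominus>\<^bsub>M\<^esub> x) = \<ominus>\<^bsub>N\<^esub> f x"
proof -
  interpret M: module R M by fact
  interpret N: module R N by fact
  have [simp]: "f x \<in> carrier N" "f (\<ominus>\<^bsub>M\<^esub> x) \<in> carrier N"
    using linear_mapD(1)[OF assms(3)] assms(4) by auto
  have "f (\<ominus>\<^bsub>M\<^esub> x) \<oplus>\<^bsub>N\<^esub> f x = f (\<ominus>\<^bsub>M\<^esub> x \<oplus>\<^bsub>M\<^esub> x)"
    using assms(4) by (intro linear_mapD(2)[OF assms(3), symmetric]) auto
  also have "\<dots> = \<zero>\<^bsub>N\<^esub>"
    using assms(4) by (simp add: M.l_neg linear_map_zero[OF assms(1-3)])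
  finally show ?thesis by (metis N.minus_equality \<open>f x \<in> carrier N\<close> \<open>f (\<ominus>\<^bsub>M\<^esub> x) \<in> carrier N\<close>)
qed

lemma linear_map_diff:
  assumes "module R M" "module R N" "linear_map R M N f" "x \<in> carrier M" "y \<in> carrier M"
  shows "f (x \<ominus>\<^bsub>M\<^esub> y) = f x \<ominus>\<^bsub>N\<^esub> f y"
proof -
  interpret M: module R M by fact
  show ?thesis using assms
    by (simp add: a_minus_def linear_map_minus linear_mapD(2)[OF assms(3)])
qed

lemma linear_map_finsum:
  assumes "module R M" "module R N" "linear_map R M N f" "g \<in> I \<rightarrow> carrier M"
  shows "f (finsum M g I) = finsum N (\<lambda>i. f (g i)) I"
proof -
  interpret M: module R M by fact
  interpret N: module R N by fact
  show ?thesis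
  proof (cases "finite I")
    case True
    then show ?thesis using assms(4)
    proof (induction I)
      case empty then show ?case by (simp add: linear_map_zero[OF assms(1-3)])
    next
      case (insert i I)
      then have g: "g \<in> I \<rightarrow> carrier M" "g i \<in> carrier M" by auto
      with insert linear_mapD(1,2)[OF assms(3)] show ?case
        by (subst M.finsum_insert N.finsum_insert; auto simp: M.finsum_closed)+
    qed
  next
    case False
    then show ?thesis by (simp add: M.finsum_infinite N.finsum_infinite linear_map_zero[OF assms(1-3)])
  qed
qed

lemma linear_map_id: "linear_map R M M (\<lambda>x. x)"
  by (auto simp: linear_map_def)

lemma linear_map_comp:
  assumes "linear_map R M N f" "linear_map R N P g"
  shows "linear_map R M P (\<lambda>x. g (f x))"
  using assms by (auto simp: linear_map_def Pi_iff)

lemma linear_map_add: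
  assumes "module R P" "linear_map R M P f" "linear_map R M P g"
  shows "linear_map R M P (\<lambda>x. f x \<oplus>\<^bsub>P\<^esub> g x)"
proof -
  interpret P: module R P by fact
  show ?thesis
    using assms(2,3) by (auto simp: linear_map_def Pi_iff P.smult_r_distr P.a_ac)
qed

lemma linear_map_smult:
  assumes "module R P" "r \<in> carrier R" "linear_map R M P f"
  shows "linear_map R M P (\<lambda>x. r \<odot>\<^bsub>P\<^esub> f x)"
proof -
  interpret P: module R P by fact
  have "r \<odot>\<^bsub>P\<^esub> (s \<odot>\<^bsub>P\<^esub> y) = s \<odot>\<^bsub>P\<^esub> (r \<odot>\<^bsub>P\<^esub> y)" if "s \<in> carrier R" "y \<in> carrier P" for s y
    using that assms(2) by (simp flip: P.smult_assoc1 add: P.m_comm)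
  then show ?thesis
    using assms(2,3) by (auto simp: linear_map_def Pi_iff P.smult_r_distr)
qed

lemma linear_map_uminus:
  assumes "module R P" "linear_map R M P f"
  shows "linear_map R M P (\<lambda>x. \<ominus>\<^bsub>P\<^esub> f x)"
proof -
  interpret P: module R P by fact
  show ?thesis
    using assms(2) by (auto simp: linear_map_def Pi_iff P.smult_r_minus P.minus_add P.a_comm)
qed

lemma linear_map_const_zero:
  assumes "module R P"
  shows "linear_map R M P (\<lambda>x. \<zero>\<^bsub>P\<^esub>)"
proof -
  interpret P: module R P by fact
  show ?thesis by (auto simp: linear_map_def)
qed

lemma linear_map_sub:
  assumes "module R P" "linear_map R M P f" "linear_map R M P g"
  shows "linear_map R M P (\<lambda>x. f x \<ominus>\<^bsub>P\<^esub> g x)"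
  unfolding a_minus_def by (intro linear_map_add linear_map_uminus assms)

lemma kernel_submodule:
  assumes "module R M" "module R N" "linear_map R M N f"
  shows "submodule {x \<in> carrier M. f x = \<zero>\<^bsub>N\<^esub>} R M"
proof -
  interpret M: module R M by fact
  interpret N: module R N by fact
  show ?thesis
    by (rule M.submoduleI)
      (auto simp: linear_mapD[OF assms(3)] linear_map_minus[OF assms] linear_map_zero[OF assms])
qed

lemma equalizer_submodule:
  assumes "module R M" "module R N" "linear_map R M N f" "linear_map R M N g"
  shows "submodule {x \<in> carrier M. f x = g x} R M"
proof -
  interpret M: module R M by fact
  interpret N: module R N by fact
  show ?thesis
    by (rule M.submoduleI)
      (auto simp: linear_mapD[OF assms(3)] linear_mapD[OF assms(4)]
        linear_map_minus[OF assms(1-3)] linear_map_zero[OF assms(1-3)]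
        linear_map_minus[OF assms(1,2,4)] linear_map_zero[OF assms(1,2,4)])
qed

lemma image_submodule:
  assumes "module R M" "module R N" "linear_map R M N f"
  shows "submodule (f ` carrier M) R N"
proof -
  interpret M: module R M by fact
  interpret N: module R N by fact
  show ?thesis
    using linear_map_zero[OF assms]
    by (intro N.submoduleI)
      (auto simp: image_iff linear_map_minus[OF assms, symmetric] linear_mapD(1)[OF assms(3)]
        linear_mapD(2,3)[OF assms(3), symmetric] intro: M.zero_closed M.a_inv_closed sym)
qed

lemma injective_iff_kernel:
  assumes "module R M" "module R N" "linear_map R M N f"
    and "\<And>x. x \<in> carrier M \<Longrightarrow> f x = \<zero>\<^bsub>N\<^esub> \<Longrightarrow> x = \<zero>\<^bsub>M\<^esub>"
  shows "inj_on f (carrier M)"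
proof (rule inj_onI)
  interpret M: module R M by fact
  interpret N: module R N by fact
  fix x y assume xy: "x \<in> carrier M" "y \<in> carrier M" "f x = f y"
  then have "f (x \<ominus>\<^bsub>M\<^esub> y) = \<zero>\<^bsub>N\<^esub>"
    using linear_mapD(1)[OF assms(3) xy(2)]
    by (simp only: linear_map_diff[OF assms(1-3)]) (simp add: a_minus_def N.r_neg)
  then have "x \<oplus>\<^bsub>M\<^esub> \<ominus>\<^bsub>M\<^esub> y = \<zero>\<^bsub>M\<^esub>"
    using xy assms(4)[of "x \<ominus>\<^bsub>M\<^esub> y"] by (simp add: a_minus_def)
  then show "x = y" using xy by (metis M.a_inv_closed M.minus_equality M.minus_minus)
qed

lemma inv_into_linear:
  assumes "module R M" "linear_map R M N f" "bij_betw f (carrier M) (carrier N)"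
  shows "linear_map R N M (inv_into (carrier M) f)"
proof -
  interpret M: module R M by fact
  let ?g = "inv_into (carrier M) f"
  have g: "?g y \<in> carrier M" "f (?g y) = y" if "y \<in> carrier N" for y
    using assms(3) that by (auto simp: bij_betw_def inv_into_into f_inv_into_f)
  have inj: "inj_on f (carrier M)" using assms(3) by (auto simp: bij_betw_def)
  show ?thesis
  proof (rule linear_mapI)
    fix x y assume xy: "x \<in> carrier N" "y \<in> carrier N"
    show "?g (x \<oplus>\<^bsub>N\<^esub> y) = ?g x \<oplus>\<^bsub>M\<^esub> ?g y"
      using g xy by (intro inv_into_f_eq[OF inj]) (auto simp: linear_mapD[OF assms(2)])
  next
    fix r x assume rx: "r \<in> carrier R" "x \<in> carrier N"
    show "?g (r \<odot>\<^bsub>N\<^esub> x) = r \<odot>\<^bsub>M\<^esub> ?g x"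
      using g rx by (intro inv_into_f_eq[OF inj]) (auto simp: linear_mapD[OF assms(2)])
  qed (use g in auto)
qed

section \<open>Free modules, quotients and generated submodules\<close>

lemma free_module_module:
  fixes R :: "('k, 'r) ring_scheme" and S :: "'s set"
  assumes "cring R"
  shows "module R (free_module R S)"
proof -
  interpret cring R by fact
  let ?F = "free_module R S"
  have fin: "finite {s. u s \<oplus>\<^bsub>R\<^esub> v s \<noteq> \<zero>\<^bsub>R\<^esub>}"
    if "finite {s. u s \<noteq> \<zero>\<^bsub>R\<^esub>}" "finite {s. v s \<noteq> \<zero>\<^bsub>R\<^esub>}" for u v :: "'s \<Rightarrow> 'k"
    by (rule finite_subset[OF _ finite_UnI[OF that]]) auto
  have fin': "finite {s. r \<otimes>\<^bsub>R\<^esub> u s \<noteq> \<zero>\<^bsub>R\<^esub>}"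
    if "finite {s. u s \<noteq> \<zero>\<^bsub>R\<^esub>}" "r \<in> carrier R" for r and u :: "'s \<Rightarrow> 'k"
    by (rule finite_subset[OF _ that(1)]) (use that in auto)
  have neg: "\<exists>y\<in>carrier ?F. y \<oplus>\<^bsub>?F\<^esub> u = \<zero>\<^bsub>?F\<^esub>" if "u \<in> carrier ?F" for u
  proof (rule bexI)
    have *: "{s. \<ominus>\<^bsub>R\<^esub> u s \<noteq> \<zero>\<^bsub>R\<^esub>} \<subseteq> {s. u s \<noteq> \<zero>\<^bsub>R\<^esub>}" by auto
    show "(\<lambda>s. \<ominus>\<^bsub>R\<^esub> u s) \<in> carrier ?F"
      using that finite_subset[OF *] by (auto simp: free_module_def)
    show "(\<lambda>s. \<ominus>\<^bsub>R\<^esub> u s) \<oplus>\<^bsub>?F\<^esub> u = \<zero>\<^bsub>?F\<^esub>"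
      using that by (auto simp: free_module_def l_neg)
  qed
  have "abelian_group ?F"
    by (rule abelian_groupI; (rule neg, assumption)?)
      (auto simp: free_module_def fin a_ac intro!: ext)
  then show ?thesis
    by (intro moduleI assms)
      (auto simp: free_module_def fin' l_distr r_distr m_assoc intro!: ext)
qed

text \<open>Besides the module structure this records that the coset map is linear and onto with
  kernel \<open>N\<close>. The last two clauses describe the elements of a coset; they are needed
  because \<open>sweedler\<close> works with a chosen element of it.\<close>

lemma quotient_module_module:
  assumes "module R M" "submodule N R M"
  shows "module R (quotient_module R M N)"
    and "linear_map R M (quotient_module R M N) (\<lambda>x. N +>\<^bsub>M\<^esub> x)"
    and "carrier (quotient_module R M N) = (\<lambda>x. N +>\<^bsub>M\<^esub> x) ` carrier M"
    and "\<And>x y. x \<in> carrier M \<Longrightarrow> y \<in> carrier M \<Longrightarrow>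
      N +>\<^bsub>M\<^esub> x = N +>\<^bsub>M\<^esub> y \<longleftrightarrow> x \<ominus>\<^bsub>M\<^esub> y \<in> N"
    and "\<And>x. x \<in> carrier M \<Longrightarrow> N +>\<^bsub>M\<^esub> x = \<zero>\<^bsub>quotient_module R M N\<^esub> \<longleftrightarrow> x \<in> N"
    and "\<And>x. x \<in> carrier M \<Longrightarrow> x \<in> N +>\<^bsub>M\<^esub> x"
    and "\<And>x y. x \<in> carrier M \<Longrightarrow> y \<in> N +>\<^bsub>M\<^esub> x \<Longrightarrow> y \<in> carrier M \<and> y \<ominus>\<^bsub>M\<^esub> x \<in> N"
proof -
  interpret M: module R M by fact
  interpret N: submodule N R M by fact
  interpret abelian_subgroup N M
    by (intro abelian_subgroupI3 additive_subgroupI) (unfold_locales)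
  let ?Q = "quotient_module R M N" and ?p = "\<lambda>x. N +>\<^bsub>M\<^esub> x"
  show carr: "carrier ?Q = ?p ` carrier M"
    by (auto simp: quotient_module_def A_RCOSETS_def')
  have add: "?p x \<oplus>\<^bsub>?Q\<^esub> ?p y = ?p (x \<oplus>\<^bsub>M\<^esub> y)" if "x \<in> carrier M" "y \<in> carrier M" for x y
    using a_rcos_sum[OF that] by (simp add: quotient_module_def)
  show eq: "?p x = ?p y \<longleftrightarrow> x \<ominus>\<^bsub>M\<^esub> y \<in> N" if "x \<in> carrier M" "y \<in> carrier M" for x y
    using a_rcos_module[OF that(2,1)] a_rcos_self[OF that(1)]
      M.a_repr_independence[OF _ that(2) a_subgroup, of x]
    by (auto simp: a_minus_def)
  have zero: "\<zero>\<^bsub>?Q\<^esub> = ?p \<zero>\<^bsub>M\<^esub>"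
    using a_subset by (simp add: quotient_module_def)
  show "?p x = \<zero>\<^bsub>?Q\<^esub> \<longleftrightarrow> x \<in> N" if "x \<in> carrier M" for x
    using eq[OF that M.zero_closed] that M.minus_equality[of "\<zero>\<^bsub>M\<^esub>" "\<zero>\<^bsub>M\<^esub>"]
    by (simp add: zero a_minus_def)
  show self: "x \<in> ?p x" if "x \<in> carrier M" for x using a_rcos_self[OF that] .
  show elem: "y \<in> carrier M \<and> y \<ominus>\<^bsub>M\<^esub> x \<in> N" if "x \<in> carrier M" "y \<in> ?p x" for x y
    using a_elemrcos_carrier[OF that] a_rcos_module_imp[OF that] by (simp add: a_minus_def)
  have smult: "r \<odot>\<^bsub>?Q\<^esub> ?p x = ?p (r \<odot>\<^bsub>M\<^esub> x)" if "r \<in> carrier R" "x \<in> carrier M" for r x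
  proof -
    \<comment> \<open>Scalar multiplication on the quotient is a union over the whole coset. The
      cosets in that union coincide, because \<open>r\<close> times an element of \<open>N\<close>
      stays in \<open>N\<close>, so the union is a single coset.\<close>
    have "?p (r \<odot>\<^bsub>M\<^esub> y) = ?p (r \<odot>\<^bsub>M\<^esub> x)" if y: "y \<in> ?p x" for y
    proof -
      have "y \<in> carrier M" and yx: "y \<ominus>\<^bsub>M\<^esub> x \<in> N" using elem[OF \<open>x \<in> carrier M\<close> y] by auto
      moreover have "r \<odot>\<^bsub>M\<^esub> (y \<ominus>\<^bsub>M\<^esub> x) = r \<odot>\<^bsub>M\<^esub> y \<ominus>\<^bsub>M\<^esub> r \<odot>\<^bsub>M\<^esub> x"
        using \<open>r \<in> carrier R\<close> \<open>x \<in> carrier M\<close> \<open>y \<in> carrier M\<close>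
        by (simp add: a_minus_def M.smult_r_distr M.smult_r_minus)
      ultimately show ?thesis
        using \<open>r \<in> carrier R\<close> \<open>x \<in> carrier M\<close> N.smult_closed[OF \<open>r \<in> carrier R\<close> yx] by (simp add: eq)
    qed
    then have "(\<Union>y\<in>?p x. ?p (r \<odot>\<^bsub>M\<^esub> y)) = ?p (r \<odot>\<^bsub>M\<^esub> x)"
      using self[OF \<open>x \<in> carrier M\<close>] by blast
    then show ?thesis by (simp add: quotient_module_def)
  qed
  show "linear_map R M ?Q ?p"
    by (rule linear_mapI) (auto simp: carr add smult)
  have "abelian_group ?Q"
  proof (rule abelian_groupI)
    show "\<exists>y\<in>carrier ?Q. y \<oplus>\<^bsub>?Q\<^esub> x = \<zero>\<^bsub>?Q\<^esub>" if "x \<in> carrier ?Q" for x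
    proof -
      from that obtain z where "z \<in> carrier M" "x = ?p z" by (auto simp: carr)
      then have "?p (\<ominus>\<^bsub>M\<^esub> z) \<oplus>\<^bsub>?Q\<^esub> x = \<zero>\<^bsub>?Q\<^esub>" by (simp add: add zero M.l_neg)
      then show ?thesis using \<open>z \<in> carrier M\<close> by (auto simp: carr)
    qed
  qed (auto simp: carr add zero M.a_ac)
  then show "module R ?Q"
    by (intro moduleI M.R.is_cring)
      (auto simp: carr add smult M.smult_l_distr M.smult_r_distr M.smult_assoc1)
qed

lemma submodule_generated_submodule:
  assumes "module R M" "X \<subseteq> carrier M"
  shows "submodule (submodule_generated R M X) R M" "X \<subseteq> submodule_generated R M X"
    "\<And>K. submodule K R M \<Longrightarrow> X \<subseteq> K \<Longrightarrow> submodule_generated R M X \<subseteq> K"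
proof -
  interpret M: module R M by fact
  show "submodule (submodule_generated R M X) R M"
  proof (rule M.submoduleI)
    show "submodule_generated R M X \<subseteq> carrier M"
      using M.carrier_is_submodule assms(2) by (auto simp: submodule_generated_def)
    have z: "\<zero>\<^bsub>M\<^esub> \<in> H" if "submodule H R M" for H
      using M.submoduleE(2,3,5)[OF that] M.submoduleE(1)[OF that] M.r_neg by (metis ex_in_conv subsetD)
    then show "\<zero>\<^bsub>M\<^esub> \<in> submodule_generated R M X"
      by (auto simp: submodule_generated_def)
  qed (auto simp: submodule_generated_def dest: M.submoduleE)
qed (auto simp: submodule_generated_def)

section \<open>The universal property of the tensor product\<close>

lemma (in abelian_monoid) finsum_swap:
  assumes "finite I" "finite J" "\<And>i j. i \<in> I \<Longrightarrow> j \<in> J \<Longrightarrow> f i j \<in> carrier G"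
  shows "(\<Oplus>i\<in>I. \<Oplus>j\<in>J. f i j) = (\<Oplus>j\<in>J. \<Oplus>i\<in>I. f i j)"
  using assms(1,3)
proof (induction I)
  case empty
  then show ?case by (simp add: finsum_zero)
next
  case (insert i I)
  have "(\<Oplus>i\<in>insert i I. \<Oplus>j\<in>J. f i j) = (\<Oplus>j\<in>J. f i j) \<oplus> (\<Oplus>j\<in>J. \<Oplus>i\<in>I. f i j)"
    using insert by (subst finsum_insert) (auto simp: Pi_iff)
  also have "\<dots> = (\<Oplus>j\<in>J. f i j \<oplus> (\<Oplus>i\<in>I. f i j))"
    using insert by (subst finsum_addf) (auto simp: Pi_iff)
  also have "\<dots> = (\<Oplus>j\<in>J. \<Oplus>i\<in>insert i I. f i j)"
    using insert by (intro finsum_cong') (auto simp: Pi_iff)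
  finally show ?case .
qed

lemma foldSetD_cong:
  assumes "(I, y) \<in> foldSetD D (h \<circ> f) e" "\<And>i. i \<in> I \<Longrightarrow> f i = g i"
  shows "(I, y) \<in> foldSetD D (h \<circ> g) e"
  using assms
proof (induction rule: foldSetD.induct)
  case (insertI x A y)
  then show ?case using foldSetD.insertI[of x A "h \<circ> g" y D e] by (simp add: o_def)
qed (auto intro: foldSetD.intros)

text \<open>A derivation in \<open>foldSetD\<close> applies the summand only to elements of the
  index set, so agreement there suffices without knowing that the values lie in \<open>P\<close>.
  This is what allows \<open>sw_cong\<close> to serve as an unconditional congruence for the
  summand.\<close>

lemma finsum_cong_strong:
  assumes "\<And>i. i \<in> I \<Longrightarrow> f i = g i"
  shows "finsum P f I = finsum P g I"
proof -
  have "(I, y) \<in> foldSetD (carrier P) ((\<oplus>\<^bsub>P\<^esub>) \<circ> f) \<zero>\<^bsub>P\<^esub> \<longleftrightarrow>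
    (I, y) \<in> foldSetD (carrier P) ((\<oplus>\<^bsub>P\<^esub>) \<circ> g) \<zero>\<^bsub>P\<^esub>" for y
    by (rule iffI; erule foldSetD_cong) (simp_all add: assms)
  then show ?thesis by (simp add: finsum_def finprod_def foldD_def)
qed

section \<open>The universal property of free modules\<close>

context
  fixes R :: "('k, 'r) ring_scheme" and S :: "'s set"
  assumes cring: "cring R"
begin

interpretation cring R by (fact cring)
interpretation F: module R "free_module R S" by (rule free_module_module[OF cring])

lemma free_gen_closed: "s \<in> S \<Longrightarrow> free_gen R s \<in> carrier (free_module R S)"
  by (auto simp: free_module_def free_gen_def)

text \<open>Induction on a finite set containing the support of \<open>u\<close>: setting the
  coefficient at \<open>i\<close> to zero shrinks the support, and what is removed is the scalar
  \<open>u i\<close> times a generator.\<close>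

lemma free_module_generated:
  assumes "submodule H R (free_module R S)" "\<And>s. s \<in> S \<Longrightarrow> free_gen R s \<in> H"
    and "u \<in> carrier (free_module R S)"
  shows "u \<in> H"
proof -
  have "\<forall>u\<in>carrier (free_module R S). {s. u s \<noteq> \<zero>\<^bsub>R\<^esub>} \<subseteq> I \<longrightarrow> u \<in> H" if "finite I" for I
    using that
  proof (induction I)
    case empty
    have "\<zero>\<^bsub>free_module R S\<^esub> \<in> H"
      using subgroup.one_closed[OF submodule.axioms(1)[OF assms(1)]] by simp
    then show ?case by (auto simp: free_module_def fun_eq_iff simp flip: fun_eq_iff)
  next
    case (insert i I)
    show ?case
    proof (intro ballI impI)
      fix u assume u: "u \<in> carrier (free_module R S)" "{s. u s \<noteq> \<zero>\<^bsub>R\<^esub>} \<subseteq> insert i I"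
      show "u \<in> H"
      proof (cases "i \<in> S")
        case False
        then have "{s. u s \<noteq> \<zero>\<^bsub>R\<^esub>} \<subseteq> I" using u by (auto simp: free_module_def)
        then show ?thesis using insert u by blast
      next
        case True
        let ?v = "u(i := \<zero>\<^bsub>R\<^esub>)"
        have "finite {s. u s \<noteq> \<zero>\<^bsub>R\<^esub>}" using u(1) by (auto simp: free_module_def)
        then have "finite {s. ?v s \<noteq> \<zero>\<^bsub>R\<^esub>}"
          by (rule rev_finite_subset) auto
        then have v: "?v \<in> carrier (free_module R S)"
          using u(1) unfolding free_module_def by auto
        moreover have "{s. ?v s \<noteq> \<zero>\<^bsub>R\<^esub>} \<subseteq> I" using u(2) by auto
        ultimately have vH: "?v \<in> H" using insert by blast
        have ui: "u i \<in> carrier R" "\<And>s. u s \<in> carrier R" using u by (auto simp: free_module_def)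
        have "u = u i \<odot>\<^bsub>free_module R S\<^esub> free_gen R i \<oplus>\<^bsub>free_module R S\<^esub> ?v"
          using ui by (auto simp: free_module_def free_gen_def fun_eq_iff)
        moreover have "u i \<odot>\<^bsub>free_module R S\<^esub> free_gen R i \<in> H"
          using F.submoduleE(4)[OF assms(1) ui(1) assms(2)[OF True]] .
        ultimately show ?thesis using F.submoduleE(5)[OF assms(1) _ vH] by metis
      qed
    qed
  qed
  moreover have "finite {s. u s \<noteq> \<zero>\<^bsub>R\<^esub>}" using assms(3) by (auto simp: free_module_def)
  ultimately show ?thesis using assms(3) by blast
qed

lemma free_lift:
  fixes P :: "('k, 'p, 'z) module_scheme"
  assumes P: "module R P" and f: "\<And>s. s \<in> S \<Longrightarrow> f s \<in> carrier P"
  defines "L \<equiv> \<lambda>u. finsum P (\<lambda>s. u s \<odot>\<^bsub>P\<^esub> f s) {s. u s \<noteq> \<zero>\<^bsub>R\<^esub>}"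
  shows "linear_map R (free_module R S) P L"
    and "\<And>s. s \<in> S \<Longrightarrow> L (free_gen R s) = f s"
proof -
  interpret P: module R P by fact
  \<comment> \<open>The support of a sum can be smaller than the union of the supports, and scaling
    can shrink it as well. Any finite index set between the support and \<open>S\<close> gives the
    same value, so sums can be compared over a common one.\<close>
  have ext: "L u = finsum P (\<lambda>s. u s \<odot>\<^bsub>P\<^esub> f s) I"
    if "u \<in> carrier (free_module R S)" "finite I" "{s. u s \<noteq> \<zero>\<^bsub>R\<^esub>} \<subseteq> I" "I \<subseteq> S" for u I
    unfolding L_def using that f
    by (intro P.add.finprod_mono_neutral_cong_left) (auto simp: free_module_def)
  show "linear_map R (free_module R S) P L"
  proof (rule linear_mapI)
    fix u assume "u \<in> carrier (free_module R S)"
    then show "L u \<in> carrier P"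
      unfolding L_def using f by (intro P.finsum_closed) (auto simp: free_module_def)
  next
    fix u v assume uv: "u \<in> carrier (free_module R S)" "v \<in> carrier (free_module R S)"
    let ?I = "{s. u s \<noteq> \<zero>\<^bsub>R\<^esub>} \<union> {s. v s \<noteq> \<zero>\<^bsub>R\<^esub>}"
    let ?w = "u \<oplus>\<^bsub>free_module R S\<^esub> v"
    have I: "finite ?I" "?I \<subseteq> S" "{s. ?w s \<noteq> \<zero>\<^bsub>R\<^esub>} \<subseteq> ?I"
      using uv by (auto simp: free_module_def)
    have [simp]: "u s \<in> carrier R" "v s \<in> carrier R" for s
      using uv by (auto simp: free_module_def)
    have "L ?w = finsum P (\<lambda>s. ?w s \<odot>\<^bsub>P\<^esub> f s) ?I"
      using I uv by (intro ext) auto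
    also have "\<dots> = finsum P (\<lambda>s. u s \<odot>\<^bsub>P\<^esub> f s \<oplus>\<^bsub>P\<^esub> v s \<odot>\<^bsub>P\<^esub> f s) ?I"
      using I f by (intro P.finsum_cong') (auto simp: free_module_def P.smult_l_distr subset_iff)
    also have "\<dots> = finsum P (\<lambda>s. u s \<odot>\<^bsub>P\<^esub> f s) ?I \<oplus>\<^bsub>P\<^esub> finsum P (\<lambda>s. v s \<odot>\<^bsub>P\<^esub> f s) ?I"
      using I f by (intro P.finsum_addf) (auto simp: subset_iff)
    also have "\<dots> = L u \<oplus>\<^bsub>P\<^esub> L v"
      using I(1,2) uv by (intro arg_cong2[where f = "add P"] ext[symmetric]) auto
    finally show "L ?w = L u \<oplus>\<^bsub>P\<^esub> L v" .
  next
    fix r u assume ru: "r \<in> carrier R" "u \<in> carrier (free_module R S)"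
    let ?I = "{s. u s \<noteq> \<zero>\<^bsub>R\<^esub>}" and ?w = "r \<odot>\<^bsub>free_module R S\<^esub> u"
    have I: "finite ?I" "?I \<subseteq> S"
      using ru(2) by (auto simp: free_module_def)
    have I': "{s. ?w s \<noteq> \<zero>\<^bsub>R\<^esub>} \<subseteq> ?I"
      using ru(1) by (auto simp: free_module_def)
    have [simp]: "u s \<in> carrier R" for s
      using ru by (auto simp: free_module_def)
    have fI: "f s \<in> carrier P" if "s \<in> ?I" for s using that I(2) f by blast
    have "L ?w = finsum P (\<lambda>s. ?w s \<odot>\<^bsub>P\<^esub> f s) ?I"
      using I I' ru by (intro ext F.smult_closed)
    also have "\<dots> = finsum P (\<lambda>s. r \<odot>\<^bsub>P\<^esub> (u s \<odot>\<^bsub>P\<^esub> f s)) ?I"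
      using fI ru(1) by (intro P.finsum_cong') (auto simp: free_module_def P.smult_assoc1)
    also have "\<dots> = r \<odot>\<^bsub>P\<^esub> L u"
      unfolding L_def using fI ru(1) I(1) by (intro P.finsum_smult_ldistr[symmetric]) auto
    finally show "L ?w = r \<odot>\<^bsub>P\<^esub> L u" .
  qed
  fix s assume s: "s \<in> S"
  have "L (free_gen R s) = finsum P (\<lambda>t. free_gen R s t \<odot>\<^bsub>P\<^esub> f t) {s}"
    using s by (intro ext free_gen_closed) (auto simp: free_gen_def)
  also have "\<dots> = f s" using s f by (simp add: free_gen_def)
  finally show "L (free_gen R s) = f s" .
qed

end

text \<open>
  The extra module arguments record the type of the tensor \<open>t\<close>; without them they would be free
  variables in the premises of the rewrite rules below.
\<close>

definition sw ::
  "('k, 'r) ring_scheme \<Rightarrow> ('k, 'm, 'x) module_scheme \<Rightarrow> ('k, 'n, 'y) module_scheme \<Rightarrow>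
   ('k, 'p, 'z) module_scheme \<Rightarrow> ('k, 'm, 'n) tensor \<Rightarrow> ('m \<Rightarrow> 'n \<Rightarrow> 'p) \<Rightarrow> 'p"
  where "sw R M N P t f = sweedler R P t f"

context
  fixes R :: "('k, 'r) ring_scheme" and M :: "('k, 'm, 'x) module_scheme"
    and N :: "('k, 'n, 'y) module_scheme"
  assumes M: "module R M" and N: "module R N"
begin

interpretation M: module R M by (fact M)
interpretation N: module R N by (fact N)

private abbreviation "F \<equiv> free_module R (carrier M \<times> carrier N)"
private abbreviation "K \<equiv> tensor_relations R M N"

interpretation F: module R F by (rule free_module_module) (fact M.R.is_cring)

definition bilinear_relations where "bilinear_relations =
  {free_gen R (x \<oplus>\<^bsub>M\<^esub> x', y) \<ominus>\<^bsub>F\<^esub> (free_gen R (x, y) \<oplus>\<^bsub>F\<^esub> free_gen R (x', y)) | x x' y.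
      x \<in> carrier M \<and> x' \<in> carrier M \<and> y \<in> carrier N} \<union>
  {free_gen R (x, y \<oplus>\<^bsub>N\<^esub> y') \<ominus>\<^bsub>F\<^esub> (free_gen R (x, y) \<oplus>\<^bsub>F\<^esub> free_gen R (x, y')) | x y y'.
      x \<in> carrier M \<and> y \<in> carrier N \<and> y' \<in> carrier N} \<union>
  {free_gen R (r \<odot>\<^bsub>M\<^esub> x, y) \<ominus>\<^bsub>F\<^esub> (r \<odot>\<^bsub>F\<^esub> free_gen R (x, y)) | r x y.
      r \<in> carrier R \<and> x \<in> carrier M \<and> y \<in> carrier N} \<union>
  {free_gen R (x, r \<odot>\<^bsub>N\<^esub> y) \<ominus>\<^bsub>F\<^esub> (r \<odot>\<^bsub>F\<^esub> free_gen R (x, y)) | r x y.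
      r \<in> carrier R \<and> x \<in> carrier M \<and> y \<in> carrier N}"

lemma tensor_relations:
  "submodule K R F" "bilinear_relations \<subseteq> K"
  "\<And>H. submodule H R F \<Longrightarrow> bilinear_relations \<subseteq> H \<Longrightarrow> K \<subseteq> H"
proof -
  have K: "K = submodule_generated R F bilinear_relations"
    by (simp add: tensor_relations_def bilinear_relations_def Let_def)
  have "bilinear_relations \<subseteq> carrier F"
    by (auto simp: bilinear_relations_def
      intro!: F.minus_closed F.a_closed F.smult_closed free_gen_closed[OF M.R.is_cring])
  note gen = submodule_generated_submodule[OF F.module_axioms this, folded K]
  show "submodule K R F" "bilinear_relations \<subseteq> K"
    "\<And>H. submodule H R F \<Longrightarrow> bilinear_relations \<subseteq> H \<Longrightarrow> K \<subseteq> H"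
    by (fact gen)+
qed

private lemmas Q = quotient_module_module[OF F.module_axioms tensor_relations(1),
    folded tensor_def]

lemma tensor_module: "module R (tensor R M N)"
  by (rule Q)

private lemma g: "x \<in> carrier M \<Longrightarrow> y \<in> carrier N \<Longrightarrow> free_gen R (x, y) \<in> carrier F"
  by (rule free_gen_closed[OF M.R.is_cring]) auto

lemma tens_closed: "x \<in> carrier M \<Longrightarrow> y \<in> carrier N \<Longrightarrow> tens R M N x y \<in> carrier (tensor R M N)"
  unfolding tens_def by (rule linear_mapD(1)[OF Q(2) g])

lemma tens_linear_right:
  assumes x: "x \<in> carrier M"
  shows "linear_map R N (tensor R M N) (\<lambda>y. tens R M N x y)"
proof (rule linear_mapI)
  show "tens R M N x y \<in> carrier (tensor R M N)" if "y \<in> carrier N" for y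
    using x that by (rule tens_closed)
  show "tens R M N x (y \<oplus>\<^bsub>N\<^esub> y') = tens R M N x y \<oplus>\<^bsub>tensor R M N\<^esub> tens R M N x y'"
    if y: "y \<in> carrier N" "y' \<in> carrier N" for y y'
    unfolding tens_def linear_mapD(2)[OF Q(2), symmetric, OF g[OF x y(1)] g[OF x y(2)]]
    by (rule iffD2[OF Q(4)]; (intro g F.a_closed N.a_closed x y)?;
        rule subsetD[OF tensor_relations(2)])
      (use x y in \<open>auto simp: bilinear_relations_def\<close>)
  show "tens R M N x (r \<odot>\<^bsub>N\<^esub> y) = r \<odot>\<^bsub>tensor R M N\<^esub> tens R M N x y"
    if y: "r \<in> carrier R" "y \<in> carrier N" for r y
    unfolding tens_def linear_mapD(3)[OF Q(2), symmetric, OF y(1) g[OF x y(2)]]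
    by (rule iffD2[OF Q(4)]; (intro g F.smult_closed N.smult_closed x y)?;
        rule subsetD[OF tensor_relations(2)])
      (use x y in \<open>auto simp: bilinear_relations_def\<close>)
qed

lemma tens_linear_left:
  assumes y: "y \<in> carrier N"
  shows "linear_map R M (tensor R M N) (\<lambda>x. tens R M N x y)"
proof (rule linear_mapI)
  show "tens R M N x y \<in> carrier (tensor R M N)" if "x \<in> carrier M" for x
    using that y by (rule tens_closed)
  show "tens R M N (x \<oplus>\<^bsub>M\<^esub> x') y = tens R M N x y \<oplus>\<^bsub>tensor R M N\<^esub> tens R M N x' y"
    if x: "x \<in> carrier M" "x' \<in> carrier M" for x x'
    unfolding tens_def linear_mapD(2)[OF Q(2), symmetric, OF g[OF x(1) y] g[OF x(2) y]]
    by (rule iffD2[OF Q(4)]; (intro g F.a_closed M.a_closed x y)?;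
        rule subsetD[OF tensor_relations(2)])
      (use x y in \<open>auto simp: bilinear_relations_def\<close>)
  show "tens R M N (r \<odot>\<^bsub>M\<^esub> x) y = r \<odot>\<^bsub>tensor R M N\<^esub> tens R M N x y"
    if x: "r \<in> carrier R" "x \<in> carrier M" for r x
    unfolding tens_def linear_mapD(3)[OF Q(2), symmetric, OF x(1) g[OF x(2) y]]
    by (rule iffD2[OF Q(4)]; (intro g F.smult_closed M.smult_closed x y)?;
        rule subsetD[OF tensor_relations(2)])
      (use x y in \<open>auto simp: bilinear_relations_def\<close>)
qed

text \<open>The preimage of \<open>H\<close> under the coset map is a submodule of the free module
  that contains every generator, hence is everything.\<close>

lemma tensor_generated:
  assumes "submodule H R (tensor R M N)"
    "\<And>x y. x \<in> carrier M \<Longrightarrow> y \<in> carrier N \<Longrightarrow> tens R M N x y \<in> H"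
    "t \<in> carrier (tensor R M N)"
  shows "t \<in> H"
proof -
  let ?p = "\<lambda>u. K +>\<^bsub>F\<^esub> u"
  note H = module.submoduleE[OF tensor_module assms(1)]
  interpret T: module R "tensor R M N" by (rule tensor_module)
  have z: "\<zero>\<^bsub>tensor R M N\<^esub> \<in> H"
    using subgroup.one_closed[OF submodule.axioms(1)[OF assms(1)]] by simp
  have "submodule {u \<in> carrier F. ?p u \<in> H} R F"
    by (rule F.submoduleI)
      (auto simp: H linear_mapD[OF Q(2)] linear_map_zero[OF F.module_axioms Q(1,2)]
        linear_map_minus[OF F.module_axioms Q(1,2)] z)
  moreover obtain u where "u \<in> carrier F" "t = ?p u" using assms(3) by (auto simp: Q(3))
  ultimately have "u \<in> {u \<in> carrier F. ?p u \<in> H}"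
    using assms(2) by - (rule free_module_generated[OF M.R.is_cring], auto simp: g tens_def)
  then show ?thesis using \<open>t = ?p u\<close> by auto
qed

text \<open>The equalizer of \<open>f\<close> and \<open>h\<close> is a submodule containing the
  pure tensors. The bounded quantifier makes both sides functions of a bound tensor, so that
  resolution determines \<open>f\<close> and \<open>h\<close>.\<close>

lemma tensor_ext:
  assumes "module R P" "linear_map R (tensor R M N) P f" "linear_map R (tensor R M N) P h"
    "\<And>x y. x \<in> carrier M \<Longrightarrow> y \<in> carrier N \<Longrightarrow> f (tens R M N x y) = h (tens R M N x y)"
  shows "\<forall>t\<in>carrier (tensor R M N). f t = h t"
  using tensor_generated[OF equalizer_submodule[OF tensor_module assms(1-3)]] assms(4)
  by (auto simp: tens_closed)

text \<open>\<open>sweedler\<close> evaluates at an arbitrary element of the coset \<open>t\<close>;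
  any such element represents \<open>t\<close> again.\<close>

lemma tensor_rep:
  assumes "t \<in> carrier (tensor R M N)"
  shows "(SOME u. u \<in> t) \<in> carrier F" "K +>\<^bsub>F\<^esub> (SOME u. u \<in> t) = t"
proof -
  obtain u where u: "u \<in> carrier F" "t = K +>\<^bsub>F\<^esub> u" using assms by (auto simp: Q(3))
  then have "u \<in> t" using Q(6) by simp
  then have "(SOME u. u \<in> t) \<in> t" by (rule someI[where P = "\<lambda>u. u \<in> t"])
  with u show "(SOME u. u \<in> t) \<in> carrier F" "K +>\<^bsub>F\<^esub> (SOME u. u \<in> t) = t"
    using Q(7)[OF u(1)] by (auto simp: Q(4))
qed

lemma tensor_rep_support:
  assumes "t \<in> carrier (tensor R M N)"
  shows "(SOME u. u \<in> t) z \<noteq> \<zero>\<^bsub>R\<^esub> \<Longrightarrow> fst z \<in> carrier M"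
    "(SOME u. u \<in> t) z \<noteq> \<zero>\<^bsub>R\<^esub> \<Longrightarrow> snd z \<in> carrier N"
    "(SOME u. u \<in> t) z \<in> carrier R" "finite {z. (SOME u. u \<in> t) z \<noteq> \<zero>\<^bsub>R\<^esub>}"
  using tensor_rep(1)[OF assms] by (cases z; auto simp: free_module_def)+

end

section \<open>Sweedler sums and the linear maps induced by bilinear ones\<close>

context
  fixes R :: "('k, 'r) ring_scheme" and M :: "('k, 'm, 'x) module_scheme"
    and N :: "('k, 'n, 'y) module_scheme"
  assumes M: "module R M" and N: "module R N"
begin

interpretation M: module R M by (fact M)
interpretation N: module R N by (fact N)

private abbreviation "F' \<equiv> free_module R (carrier M \<times> carrier N)"
private abbreviation "K' \<equiv> tensor_relations R M N"

interpretation F: module R F' by (rule free_module_module) (fact M.R.is_cring)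

private lemmas rep = tensor_rep[OF M N]
private lemmas supp = tensor_rep_support[OF M N]
private lemmas tens_relations = tensor_relations[OF M N]
private lemmas quot = quotient_module_module[OF F.module_axioms tens_relations(1),
    folded tensor_def]

private lemma gen_closed: "x \<in> carrier M \<Longrightarrow> y \<in> carrier N \<Longrightarrow> free_gen R (x, y) \<in> carrier F'"
  by (rule free_gen_closed[OF M.R.is_cring]) auto

text \<open>The chosen representative is supported on \<open>carrier M \<times> carrier N\<close>.
  As a congruence rule this puts membership of the bound variables at the disposal of the
  simplifier, which is what discharges the side conditions of the rules for nested sums.\<close>

lemma sw_cong:
  assumes "t = t'" "t' \<in> carrier (tensor R M N)"
    "\<And>x y. x \<in> carrier M \<Longrightarrow> y \<in> carrier N \<Longrightarrow> f x y = h x y"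
  shows "sw R M N P t f = sw R M N P t' h"
  unfolding assms(1) sw_def sweedler_def Let_def
  by (intro finsum_cong_strong) (simp add: assms(3) supp[OF assms(2)])

context
  fixes P :: "('k, 'p, 'z) module_scheme"
  assumes P: "module R P"
begin

interpretation P: module R P by (fact P)

lemma sw_closed:
  assumes "t \<in> carrier (tensor R M N)"
    "\<And>x y. x \<in> carrier M \<Longrightarrow> y \<in> carrier N \<Longrightarrow> f x y \<in> carrier P"
  shows "sw R M N P t f \<in> carrier P"
  unfolding sw_def sweedler_def Let_def
  by (intro P.finsum_closed) (auto simp: supp[OF assms(1)] assms(2))

lemma linear_sw:
  assumes "module R P'" "linear_map R P P' L" "t \<in> carrier (tensor R M N)"
    "\<And>x y. x \<in> carrier M \<Longrightarrow> y \<in> carrier N \<Longrightarrow> f x y \<in> carrier P"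
  shows "L (sw R M N P t f) = sw R M N P' t (\<lambda>x y. L (f x y))"
proof -
  let ?u = "SOME u. u \<in> t"
  interpret P': module R P' by fact
  note u = supp[OF assms(3)]
  have "L (sw R M N P t f) = finsum P' (\<lambda>z. L (?u z \<odot>\<^bsub>P\<^esub> f (fst z) (snd z))) {z. ?u z \<noteq> \<zero>\<^bsub>R\<^esub>}"
    unfolding sw_def sweedler_def Let_def
    by (intro linear_map_finsum[OF P assms(1,2)]) (auto simp: u assms(4))
  also have "\<dots> = finsum P' (\<lambda>z. ?u z \<odot>\<^bsub>P'\<^esub> L (f (fst z) (snd z))) {z. ?u z \<noteq> \<zero>\<^bsub>R\<^esub>}"
    by (intro finsum_cong_strong linear_mapD(3)[OF assms(2)]) (auto simp: u assms(4))
  finally show ?thesis by (simp add: sw_def sweedler_def Let_def)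
qed

text \<open>For fixed \<open>t\<close> the representative is fixed too, so the sum is one finite
  linear combination of the linear maps \<open>\<lambda>z. f z x y\<close>; induction on its index
  set.\<close>

lemma sw_linear_right:
  assumes "module R Z" "t \<in> carrier (tensor R M N)"
    "\<And>x y. x \<in> carrier M \<Longrightarrow> y \<in> carrier N \<Longrightarrow> linear_map R Z P (\<lambda>z. f z x y)"
  shows "linear_map R Z P (\<lambda>z. sw R M N P t (\<lambda>x y. f z x y))"
proof -
  let ?u = "SOME u. u \<in> t"
  note u = supp[OF assms(2)]
  have "linear_map R Z P (\<lambda>z. finsum P (\<lambda>w. ?u w \<odot>\<^bsub>P\<^esub> f z (fst w) (snd w)) I)"
    if "I \<subseteq> {z. ?u z \<noteq> \<zero>\<^bsub>R\<^esub>}" for I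
    using finite_subset[OF that u(4)] that
  proof (induction I rule: infinite_finite_induct)
    case (insert i I)
    interpret Z: module R Z by fact
    have lin: "linear_map R Z P (\<lambda>z. ?u w \<odot>\<^bsub>P\<^esub> f z (fst w) (snd w))"
      if "w \<in> insert i I" for w
      using that insert.prems by (intro linear_map_smult P assms(3) u) auto
    show ?case
      using insert lin linear_mapD(1)[OF lin]
      by (intro linear_map_cong[OF _ linear_map_add[OF P lin[of i] insert.IH]])
        (auto intro: Z.abelian_monoid_axioms)
  qed (auto simp: linear_map_const_zero[OF P])
  then show ?thesis unfolding sw_def sweedler_def Let_def by auto
qed

text \<open>Both representatives are fixed in advance, so this is the interchange of two finite sums
  together with commutativity of \<open>R\<close>.\<close>

lemma sw_swap:
  assumes "module R A" "module R B" "t \<in> carrier (tensor R M N)" "s \<in> carrier (tensor R A B)"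
    "\<And>x y a b. x \<in> carrier M \<Longrightarrow> y \<in> carrier N \<Longrightarrow> a \<in> carrier A \<Longrightarrow> b \<in> carrier B \<Longrightarrow>
      f x y a b \<in> carrier P"
  shows "sw R M N P t (\<lambda>x y. sw R A B P s (\<lambda>a b. f x y a b)) =
    sw R A B P s (\<lambda>a b. sw R M N P t (\<lambda>x y. f x y a b))"
proof -
  let ?u = "SOME u. u \<in> t" and ?v = "SOME v. v \<in> s"
  let ?I = "{z. ?u z \<noteq> \<zero>\<^bsub>R\<^esub>}" and ?J = "{w. ?v w \<noteq> \<zero>\<^bsub>R\<^esub>}"
  let ?f = "\<lambda>z w. f (fst z) (snd z) (fst w) (snd w)"
  note u = supp[OF assms(3)]
  note v = tensor_rep_support[OF assms(1,2,4)]
  have "sw R M N P t (\<lambda>x y. sw R A B P s (\<lambda>a b. f x y a b)) =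
    finsum P (\<lambda>z. finsum P (\<lambda>w. ?u z \<odot>\<^bsub>P\<^esub> (?v w \<odot>\<^bsub>P\<^esub> ?f z w)) ?J) ?I"
    unfolding sw_def sweedler_def Let_def
    by (intro finsum_cong_strong P.finsum_smult_ldistr) (auto simp: u v assms(5))
  also have "\<dots> = finsum P (\<lambda>w. finsum P (\<lambda>z. ?u z \<odot>\<^bsub>P\<^esub> (?v w \<odot>\<^bsub>P\<^esub> ?f z w)) ?I) ?J"
    by (intro P.finsum_swap) (auto simp: u v assms(5))
  also have "\<dots> = finsum P (\<lambda>w. finsum P (\<lambda>z. ?v w \<odot>\<^bsub>P\<^esub> (?u z \<odot>\<^bsub>P\<^esub> ?f z w)) ?I) ?J"
    by (intro finsum_cong_strong) (simp add: u v assms(5) M.R.m_comm flip: P.smult_assoc1)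
  also have "\<dots> = sw R A B P s (\<lambda>a b. sw R M N P t (\<lambda>x y. f x y a b))"
    unfolding sw_def sweedler_def Let_def
    by (intro finsum_cong_strong P.finsum_smult_ldistr[symmetric]) (auto simp: u v assms(5))
  finally show ?thesis .
qed

context
  fixes f assumes f: "bilinear_map R M N P f"
begin

private lemma lift:
  "linear_map R F' P (\<lambda>u. finsum P (\<lambda>z. u z \<odot>\<^bsub>P\<^esub> f (fst z) (snd z)) {z. u z \<noteq> \<zero>\<^bsub>R\<^esub>})"
  "\<And>x y. x \<in> carrier M \<Longrightarrow> y \<in> carrier N \<Longrightarrow>
    finsum P (\<lambda>z. free_gen R (x, y) z \<odot>\<^bsub>P\<^esub> f (fst z) (snd z)) {z. free_gen R (x, y) z \<noteq> \<zero>\<^bsub>R\<^esub>} = f x y"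
  using free_lift[OF M.R.is_cring P, of "carrier M \<times> carrier N" "\<lambda>z. f (fst z) (snd z)"]
    bilinear_mapD(3)[OF f] by auto

text \<open>Independence of the representative: the linear extension \<open>L\<close> of
  \<open>f\<close> to the free module kills the bilinear relations, hence is constant on cosets, and
  the element that \<open>sweedler\<close> chooses is in the coset of \<open>u\<close>.\<close>

private lemma sw_coset:
  assumes u: "u \<in> carrier F'"
  shows "sw R M N P (K' +>\<^bsub>F'\<^esub> u) f =
    finsum P (\<lambda>z. u z \<odot>\<^bsub>P\<^esub> f (fst z) (snd z)) {z. u z \<noteq> \<zero>\<^bsub>R\<^esub>}"
proof -
  define L where "L u = finsum P (\<lambda>z. u z \<odot>\<^bsub>P\<^esub> f (fst z) (snd z)) {z. u z \<noteq> \<zero>\<^bsub>R\<^esub>}" for u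
  have L: "linear_map R F' P L" "\<And>x y. x \<in> carrier M \<Longrightarrow> y \<in> carrier N \<Longrightarrow> L (free_gen R (x, y)) = f x y"
    using lift unfolding L_def by auto
  note fl = bilinear_mapD(1,2)[OF f]
  have d: "L (v \<ominus>\<^bsub>F'\<^esub> w) = \<zero>\<^bsub>P\<^esub>" if "v \<in> carrier F'" "w \<in> carrier F'" "L v = L w" for v w
    using that linear_mapD(1)[OF L(1) that(2)]
    by (simp only: linear_map_diff[OF F.module_axioms P L(1)]) (simp add: a_minus_def P.r_neg)
  have ker: "K' \<subseteq> {u \<in> carrier F'. L u = \<zero>\<^bsub>P\<^esub>}"
    by (rule tens_relations(3)[OF kernel_submodule[OF F.module_axioms P L(1)]])
      (auto simp: bilinear_relations_def[OF M N] gen_closed L(2) linear_mapD[OF L(1)]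
        linear_mapD(2,3)[OF fl(1)] linear_mapD(2,3)[OF fl(2)]
        intro!: d F.minus_closed F.a_closed F.smult_closed gen_closed)
  let ?v = "SOME v. v \<in> K' +>\<^bsub>F'\<^esub> u"
  have v: "?v \<in> carrier F'" "K' +>\<^bsub>F'\<^esub> ?v = K' +>\<^bsub>F'\<^esub> u"
    using rep[of "K' +>\<^bsub>F'\<^esub> u"] u by (auto simp: quot(3))
  then have "L (?v \<ominus>\<^bsub>F'\<^esub> u) = \<zero>\<^bsub>P\<^esub>" using u ker by (auto simp: quot(4))
  then have "L ?v \<oplus>\<^bsub>P\<^esub> \<ominus>\<^bsub>P\<^esub> L u = \<zero>\<^bsub>P\<^esub>"
    using v(1) u by (simp only: linear_map_diff[OF F.module_axioms P L(1)]) (simp add: a_minus_def)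
  then have "L ?v = L u"
    using linear_mapD(1)[OF L(1)] v(1) u by (metis P.a_inv_closed P.minus_equality P.minus_minus)
  then show ?thesis by (simp add: sw_def sweedler_def L_def)
qed

lemma sw_tens:
  assumes "x \<in> carrier M" "y \<in> carrier N"
  shows "sw R M N P (tens R M N x y) f = f x y"
  unfolding tens_def using assms by (simp add: sw_coset gen_closed lift)

lemma sw_linear: "linear_map R (tensor R M N) P (\<lambda>t. sw R M N P t f)"
  by (rule linear_mapI)
    (auto simp: quot(3) sw_coset linear_mapD[OF lift(1)] simp flip: linear_mapD(2,3)[OF quot(2)])

end

end

end

section \<open>Rewriting Sweedler sums\<close>

definition trilinear_map ::
  "('k, 'r) ring_scheme \<Rightarrow> ('k, 'm, 'x) module_scheme \<Rightarrow> ('k, 'n, 'y) module_scheme \<Rightarrow>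
   ('k, 'o, 'w) module_scheme \<Rightarrow> ('k, 'p, 'z) module_scheme \<Rightarrow> ('m \<Rightarrow> 'n \<Rightarrow> 'o \<Rightarrow> 'p) \<Rightarrow> bool"
  where "trilinear_map R M N L P f \<longleftrightarrow>
    (\<forall>x\<in>carrier M. bilinear_map R N L P (f x)) \<and>
    (\<forall>y\<in>carrier N. \<forall>z\<in>carrier L. linear_map R M P (\<lambda>x. f x y z))"

text \<open>Introduction rules for linearity act here as rewrite rules, so the linearity conditions
  of the rules for \<open>sw\<close> are established by recursive simplification along the structure
  of the summand.\<close>

declare bilinear_mapI [simp] linear_map_id [simp] sw_cong [cong]

lemma trilinear_mapI [simp]:
  assumes "\<And>x y. x \<in> carrier M \<Longrightarrow> y \<in> carrier N \<Longrightarrow> linear_map R L P (\<lambda>z. f x y z)"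
    and "\<And>x z. x \<in> carrier M \<Longrightarrow> z \<in> carrier L \<Longrightarrow> linear_map R N P (\<lambda>y. f x y z)"
    and "\<And>y z. y \<in> carrier N \<Longrightarrow> z \<in> carrier L \<Longrightarrow> linear_map R M P (\<lambda>x. f x y z)"
  shows "trilinear_map R M N L P f"
  using assms by (auto simp: trilinear_map_def)

lemma trilinear_mapD:
  assumes "trilinear_map R M N L P f"
  shows "x \<in> carrier M \<Longrightarrow> y \<in> carrier N \<Longrightarrow> linear_map R L P (\<lambda>z. f x y z)"
    and "x \<in> carrier M \<Longrightarrow> z \<in> carrier L \<Longrightarrow> linear_map R N P (\<lambda>y. f x y z)"
    and "y \<in> carrier N \<Longrightarrow> z \<in> carrier L \<Longrightarrow> linear_map R M P (\<lambda>x. f x y z)"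
    and "x \<in> carrier M \<Longrightarrow> y \<in> carrier N \<Longrightarrow> z \<in> carrier L \<Longrightarrow> f x y z \<in> carrier P"
proof -
  have b: "bilinear_map R N L P (f x)" if "x \<in> carrier M" for x
    using assms that by (auto simp: trilinear_map_def)
  show "x \<in> carrier M \<Longrightarrow> y \<in> carrier N \<Longrightarrow> linear_map R L P (\<lambda>z. f x y z)"
    and "x \<in> carrier M \<Longrightarrow> z \<in> carrier L \<Longrightarrow> linear_map R N P (\<lambda>y. f x y z)"
    and "x \<in> carrier M \<Longrightarrow> y \<in> carrier N \<Longrightarrow> z \<in> carrier L \<Longrightarrow> f x y z \<in> carrier P"
    using bilinear_mapD[OF b] by blast+
  show "y \<in> carrier N \<Longrightarrow> z \<in> carrier L \<Longrightarrow> linear_map R M P (\<lambda>x. f x y z)"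
    using assms by (auto simp: trilinear_map_def)
qed

declare tensor_module [simp] tens_closed [simp] sw_closed [simp] sw_tens [simp]

lemma module_smult_closed:
  "module R M \<Longrightarrow> r \<in> carrier R \<Longrightarrow> x \<in> carrier M \<Longrightarrow> r \<odot>\<^bsub>M\<^esub> x \<in> carrier M"
  by (rule module.smult_closed)

lemma linear_tens_left [simp]:
  assumes "module R M" "module R N" "linear_map R X M f" "y \<in> carrier N"
  shows "linear_map R X (tensor R M N) (\<lambda>x. tens R M N (f x) y)"
  by (rule linear_map_comp[OF assms(3) tens_linear_left]) (use assms in auto)

lemma linear_tens_right [simp]:
  assumes "module R M" "module R N" "linear_map R X N f" "x \<in> carrier M"
  shows "linear_map R X (tensor R M N) (\<lambda>y. tens R M N x (f y))"
  by (rule linear_map_comp[OF assms(3) tens_linear_right]) (use assms in auto)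

lemma linear_sw_left [simp]:
  assumes "module R A" "module R B" "module R P" "linear_map R X (tensor R A B) t"
    "bilinear_map R A B P f"
  shows "linear_map R X P (\<lambda>x. sw R A B P (t x) f)"
  by (rule linear_map_comp[OF assms(4) sw_linear]) (use assms in auto)

text \<open>
  Here and in \<open>sw_push\<close> the variables bound outermost are the last arguments of \<open>f\<close>: otherwise the
  left-hand side would be eta-contracted and never match.
\<close>

lemma linear_sw_right [simp]:
  assumes "module R A" "module R B" "module R P" "module R X" "t \<in> carrier (tensor R A B)"
    "\<And>a b. a \<in> carrier A \<Longrightarrow> b \<in> carrier B \<Longrightarrow> linear_map R X P (\<lambda>x. f a b x)"
  shows "linear_map R X P (\<lambda>x. sw R A B P t (\<lambda>a b. f a b x))"
  using assms by (intro sw_linear_right) auto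

lemma sw_sw [simp]:
  assumes "module R A" "module R B" "module R A'" "module R B'" "module R P"
    "t \<in> carrier (tensor R A B)" "bilinear_map R A' B' P g"
    "\<And>a b. a \<in> carrier A \<Longrightarrow> b \<in> carrier B \<Longrightarrow> f a b \<in> carrier (tensor R A' B')"
  shows "sw R A' B' P (sw R A B (tensor R A' B') t f) g =
    sw R A B P t (\<lambda>a b. sw R A' B' P (f a b) g)"
  using assms by (intro linear_sw[where L = "\<lambda>s. sw R A' B' P s g"] sw_linear) auto

lemma sw_tens_id [simp]:
  assumes "module R M" "module R N" "t \<in> carrier (tensor R M N)"
  shows "sw R M N (tensor R M N) t (\<lambda>x y. tens R M N x y) = t"
  by (rule tensor_ext[rule_format, of R M N "tensor R M N" _ "\<lambda>t. t"]) (use assms in auto)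

lemma tens_sw_left [simp]:
  assumes "module R M" "module R N" "module R A" "module R B" "t \<in> carrier (tensor R A B)"
    "\<And>a b. a \<in> carrier A \<Longrightarrow> b \<in> carrier B \<Longrightarrow> f a b \<in> carrier M" "y \<in> carrier N"
  shows "tens R M N (sw R A B M t f) y = sw R A B (tensor R M N) t (\<lambda>a b. tens R M N (f a b) y)"
  using assms by (intro linear_sw[where L = "\<lambda>s. tens R M N s y"]) auto

lemma tens_sw_right [simp]:
  assumes "module R M" "module R N" "module R A" "module R B" "t \<in> carrier (tensor R A B)"
    "\<And>a b. a \<in> carrier A \<Longrightarrow> b \<in> carrier B \<Longrightarrow> f a b \<in> carrier N" "x \<in> carrier M"
  shows "tens R M N x (sw R A B N t f) = sw R A B (tensor R M N) t (\<lambda>a b. tens R M N x (f a b))"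
  using assms by (intro linear_sw[where L = "\<lambda>s. tens R M N x s"]) auto

lemma smult_sw [simp]:
  assumes "module R P" "module R A" "module R B" "t \<in> carrier (tensor R A B)" "r \<in> carrier R"
    "\<And>a b. a \<in> carrier A \<Longrightarrow> b \<in> carrier B \<Longrightarrow> f a b \<in> carrier P"
  shows "r \<odot>\<^bsub>P\<^esub> sw R A B P t f = sw R A B P t (\<lambda>a b. r \<odot>\<^bsub>P\<^esub> f a b)"
  using assms by (intro linear_sw[where L = "\<lambda>s. r \<odot>\<^bsub>P\<^esub> s"] linear_map_smult) auto

declare linear_map_smult [simp]

lemma tens_smult_left [simp]:
  assumes "module R M" "module R N" "r \<in> carrier R" "x \<in> carrier M" "y \<in> carrier N"
  shows "tens R M N (r \<odot>\<^bsub>M\<^esub> x) y = r \<odot>\<^bsub>tensor R M N\<^esub> tens R M N x y"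
  using assms linear_mapD(3)[OF tens_linear_left] by metis

lemma bilinear_comp_left:
  assumes "bilinear_map R A B P h" "linear_map R X A f" "y \<in> carrier B"
  shows "linear_map R X P (\<lambda>x. h (f x) y)"
  by (rule linear_map_comp[OF assms(2) bilinear_mapD(2)[OF assms(1,3)]])

lemma bilinear_comp_right:
  assumes "bilinear_map R A B P h" "linear_map R X B f" "x \<in> carrier A"
  shows "linear_map R X P (\<lambda>y. h x (f y))"
  by (rule linear_map_comp[OF assms(2) bilinear_mapD(1)[OF assms(1,3)]])

lemma bilinear_sw_left:
  assumes "bilinear_map R M N P h" "module R M" "module R P" "module R A" "module R B"
    "t \<in> carrier (tensor R A B)"
    "\<And>a b. a \<in> carrier A \<Longrightarrow> b \<in> carrier B \<Longrightarrow> f a b \<in> carrier M" "y \<in> carrier N"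
  shows "h (sw R A B M t f) y = sw R A B P t (\<lambda>a b. h (f a b) y)"
  using assms by (intro linear_sw[where L = "\<lambda>s. h s y"] bilinear_mapD(2)[OF assms(1)]) auto

lemma bilinear_sw_right:
  assumes "bilinear_map R M N P h" "module R N" "module R P" "module R A" "module R B"
    "t \<in> carrier (tensor R A B)"
    "\<And>a b. a \<in> carrier A \<Longrightarrow> b \<in> carrier B \<Longrightarrow> f a b \<in> carrier N" "x \<in> carrier M"
  shows "h x (sw R A B N t f) = sw R A B P t (\<lambda>a b. h x (f a b))"
  using assms by (intro linear_sw[where L = "\<lambda>s. h x s"] bilinear_mapD(1)[OF assms(1)]) auto

text \<open>Instantiated with a specific \<open>t\<close> or \<open>s\<close>, this moves a sum inwards.\<close>

lemma sw_push:
  assumes "module R M" "module R N" "module R A" "module R B" "module R P"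
    "t \<in> carrier (tensor R M N)" "s \<in> carrier (tensor R A B)"
    "\<And>x y a b. x \<in> carrier M \<Longrightarrow> y \<in> carrier N \<Longrightarrow> a \<in> carrier A \<Longrightarrow> b \<in> carrier B \<Longrightarrow>
      f a b x y \<in> carrier P"
  shows "sw R M N P t (\<lambda>x y. sw R A B P s (\<lambda>a b. f a b x y)) =
    sw R A B P s (\<lambda>a b. sw R M N P t (\<lambda>x y. f a b x y))"
  using assms by (intro sw_swap) auto

text \<open>Axioms such as coassociativity are equations in a triple tensor product. Applying
  \<open>L\<close> to them yields equations between sums of an arbitrary trilinear \<open>F\<close>,
  which can be used for rewriting under sums.\<close>

lemma trilinear_lift:
  assumes "module R A" "module R B" "module R C" "module R P" "trilinear_map R A B C P F"
  defines "L \<equiv> \<lambda>t. sw R (tensor R A B) C P t (\<lambda>s c. sw R A B P s (\<lambda>a b. F a b c))"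
  shows "linear_map R (tensor3 R A B C) P L"
    and "a \<in> carrier A \<Longrightarrow> b \<in> carrier B \<Longrightarrow> c \<in> carrier C \<Longrightarrow> L (tens3 R A B C a b c) = F a b c"
proof -
  note F [simp] = assms(1-4) trilinear_mapD[OF assms(5)]
  show "linear_map R (tensor3 R A B C) P L"
    unfolding L_def by simp
  show "a \<in> carrier A \<Longrightarrow> b \<in> carrier B \<Longrightarrow> c \<in> carrier C \<Longrightarrow> L (tens3 R A B C a b c) = F a b c"
    unfolding L_def by simp
qed

lemma linear_form_closed:
  "linear_form R M f \<Longrightarrow> x \<in> carrier M \<Longrightarrow> f x \<in> carrier R"
  by (auto simp: linear_form_def)

lemma linear_form_smult:
  assumes "linear_form R M e" "module R P" "linear_map R X M f" "y \<in> carrier P"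
  shows "linear_map R X P (\<lambda>x. e (f x) \<odot>\<^bsub>P\<^esub> y)"
proof -
  interpret P: module R P by fact
  show ?thesis
    using assms(1,3,4) by (auto simp: linear_map_def linear_form_def Pi_iff P.smult_l_distr P.smult_assoc1)
qed

section \<open>Hom-structures\<close>

locale base_ring = fixes R :: "('k, 'r) ring_scheme"
begin

lemmas smult_closed [simp] = module_smult_closed[of R]

lemma smult_mult [simp]:
  assumes "module R P" "r \<in> carrier R" "s \<in> carrier R" "x \<in> carrier P"
  shows "(r \<otimes>\<^bsub>R\<^esub> s) \<odot>\<^bsub>P\<^esub> x = s \<odot>\<^bsub>P\<^esub> (r \<odot>\<^bsub>P\<^esub> x)"
proof -
  interpret P: module R P by fact
  show ?thesis using assms by (simp add: P.m_comm flip: P.smult_assoc1)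
qed

lemma smult_one [simp]: "module R P \<Longrightarrow> x \<in> carrier P \<Longrightarrow> \<one>\<^bsub>R\<^esub> \<odot>\<^bsub>P\<^esub> x = x"
  by (rule module.smult_one)

end

locale hobj = base_ring R for R :: "('k, 'r) ring_scheme" +
  fixes M :: "('k, 'm, 'z) hom_mod_scheme"
  assumes hom_object: "hom_object R M"
begin

lemma module_M [simp]: "module R M"
  and linear_aut: "linear_map R M M (aut M)"
  and bij_aut: "bij_betw (aut M) (carrier M) (carrier M)"
  using hom_object by (auto simp: hom_object_def)

lemma aut_closed [simp]: "x \<in> carrier M \<Longrightarrow> aut M x \<in> carrier M"
  using linear_mapD(1)[OF linear_aut] .

lemma linear_aut_inv: "linear_map R M M (aut_inv M)"
  unfolding aut_inv_def by (rule inv_into_linear[OF module_M linear_aut bij_aut])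

lemma aut_inv_closed [simp]: "x \<in> carrier M \<Longrightarrow> aut_inv M x \<in> carrier M"
  using linear_mapD(1)[OF linear_aut_inv] .

lemma aut_aut_inv [simp]: "x \<in> carrier M \<Longrightarrow> aut M (aut_inv M x) = x"
  using bij_aut by (auto simp: aut_inv_def bij_betw_def f_inv_into_f)

lemma aut_inv_aut [simp]: "x \<in> carrier M \<Longrightarrow> aut_inv M (aut M x) = x"
  using bij_aut by (auto simp: aut_inv_def bij_betw_def)

lemma aut_inv_eqI: "x \<in> carrier M \<Longrightarrow> aut M x = y \<Longrightarrow> aut_inv M y = x"
  by auto

lemma linear_aut_comp [simp]: "linear_map R X M f \<Longrightarrow> linear_map R X M (\<lambda>x. aut M (f x))"
  by (rule linear_map_comp[OF _ linear_aut])

lemma linear_aut_inv_comp [simp]: "linear_map R X M f \<Longrightarrow> linear_map R X M (\<lambda>x. aut_inv M (f x))"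
  by (rule linear_map_comp[OF _ linear_aut_inv])

lemma aut_sw [simp]:
  assumes "module R A" "module R B" "t \<in> carrier (tensor R A B)"
    "\<And>a b. a \<in> carrier A \<Longrightarrow> b \<in> carrier B \<Longrightarrow> f a b \<in> carrier M"
  shows "aut M (sw R A B M t f) = sw R A B M t (\<lambda>a b. aut M (f a b))"
  using assms by (intro linear_sw linear_aut) auto

lemma aut_inv_sw [simp]:
  assumes "module R A" "module R B" "t \<in> carrier (tensor R A B)"
    "\<And>a b. a \<in> carrier A \<Longrightarrow> b \<in> carrier B \<Longrightarrow> f a b \<in> carrier M"
  shows "aut_inv M (sw R A B M t f) = sw R A B M t (\<lambda>a b. aut_inv M (f a b))"
  using assms by (intro linear_sw linear_aut_inv) auto

end

locale halg = hobj R A for R :: "('k, 'r) ring_scheme" and A :: "('k, 'a, 'z) hom_mod_scheme" +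
  assumes hom_algebra: "hom_algebra R A"
begin

lemma bilinear_mult: "bilinear_map R A A A (mult A)"
  using hom_algebra by (auto simp: hom_algebra_def)

lemmas mult_closed [simp] = bilinear_mapD(3)[OF bilinear_mult]
lemmas linear_mult_left [simp] = bilinear_comp_left[OF bilinear_mult]
lemmas linear_mult_right [simp] = bilinear_comp_right[OF bilinear_mult]

lemma one_closed [simp]: "\<one>\<^bsub>A\<^esub> \<in> carrier A"
  and aut_mult [simp]: "a \<in> carrier A \<Longrightarrow> b \<in> carrier A \<Longrightarrow> aut A (a \<otimes>\<^bsub>A\<^esub> b) = aut A a \<otimes>\<^bsub>A\<^esub> aut A b"
  and aut_one [simp]: "aut A \<one>\<^bsub>A\<^esub> = \<one>\<^bsub>A\<^esub>"
  and hom_assoc: "a \<in> carrier A \<Longrightarrow> b \<in> carrier A \<Longrightarrow> c \<in> carrier A \<Longrightarrow>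
    aut A a \<otimes>\<^bsub>A\<^esub> (b \<otimes>\<^bsub>A\<^esub> c) = (a \<otimes>\<^bsub>A\<^esub> b) \<otimes>\<^bsub>A\<^esub> aut A c"
  and mult_one [simp]: "a \<in> carrier A \<Longrightarrow> a \<otimes>\<^bsub>A\<^esub> \<one>\<^bsub>A\<^esub> = aut A a"
  and one_mult [simp]: "a \<in> carrier A \<Longrightarrow> \<one>\<^bsub>A\<^esub> \<otimes>\<^bsub>A\<^esub> a = aut A a"
  using hom_algebra by (auto simp: hom_algebra_def)

lemma aut_inv_mult [simp]:
  "a \<in> carrier A \<Longrightarrow> b \<in> carrier A \<Longrightarrow> aut_inv A (a \<otimes>\<^bsub>A\<^esub> b) = aut_inv A a \<otimes>\<^bsub>A\<^esub> aut_inv A b"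
  by (rule aut_inv_eqI) auto

lemma aut_inv_one [simp]: "aut_inv A \<one>\<^bsub>A\<^esub> = \<one>\<^bsub>A\<^esub>"
  by (rule aut_inv_eqI) auto

end

locale rcomod = M: hobj R M + C: hobj R C
  for R :: "('k, 'r) ring_scheme" and C :: "('k, 'c, 'y) hom_coalg_scheme"
    and M :: "('k, 'm, 'z) hom_mod_scheme" +
  fixes \<rho> :: "'m \<Rightarrow> ('k, 'm, 'c) tensor"
  assumes comodule: "hom_right_comodule R C M \<rho>"
    and linear_comul: "linear_map R C (tensor R C C) (comul C)"
    and linear_counit: "linear_form R C (counit C)"
begin

lemma linear_\<rho>: "linear_map R M (tensor R M C) \<rho>"
  using comodule by (auto simp: hom_right_comodule_def)

lemma \<rho>_closed [simp]: "m \<in> carrier M \<Longrightarrow> \<rho> m \<in> carrier (tensor R M C)"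
  using linear_mapD(1)[OF linear_\<rho>] .

lemma comul_closed' [simp]: "c \<in> carrier C \<Longrightarrow> comul C c \<in> carrier (tensor R C C)"
  using linear_mapD(1)[OF linear_comul] .

lemma linear_comul_comp' [simp]:
  "linear_map R X C f \<Longrightarrow> linear_map R X (tensor R C C) (\<lambda>x. comul C (f x))"
  by (rule linear_map_comp[OF _ linear_comul])

lemma linear_\<rho>_comp [simp]: "linear_map R X M f \<Longrightarrow> linear_map R X (tensor R M C) (\<lambda>x. \<rho> (f x))"
  by (rule linear_map_comp[OF _ linear_\<rho>])

lemma \<rho>_sw [simp]:
  assumes "module R A" "module R B" "t \<in> carrier (tensor R A B)"
    "\<And>a b. a \<in> carrier A \<Longrightarrow> b \<in> carrier B \<Longrightarrow> f a b \<in> carrier M"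
  shows "\<rho> (sw R A B M t f) = sw R A B (tensor R M C) t (\<lambda>a b. \<rho> (f a b))"
  using assms by (intro linear_sw linear_\<rho>) auto

lemma sw_\<rho>_aut [simp]:
  assumes "module R P" "bilinear_map R M C P F" "m \<in> carrier M"
  shows "sw R M C P (\<rho> (aut M m)) F = sw R M C P (\<rho> m) (\<lambda>a b. F (aut M a) (aut C b))"
proof -
  have "\<rho> (aut M m) = sw R M C (tensor R M C) (\<rho> m) (\<lambda>m0 m1. tens R M C (aut M m0) (aut C m1))"
    using comodule assms(3) by (simp add: hom_right_comodule_def sw_def)
  then show ?thesis using assms bilinear_mapD[OF assms(2)] by simp
qed

text \<open>The axiom carries an inverse automorphism on the last leg. It is used for
  \<open>G\<close>, which precomposes \<open>F\<close> with \<open>aut C\<close> there; this cancels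
  the inverse on one side and leaves \<open>aut C\<close> on the other. Read from left to right,
  iterated coactions become comultiplications of the second leg.\<close>

lemma sw_coassoc:
  assumes "module R P" "trilinear_map R M C C P F" "m \<in> carrier M"
  shows "sw R M C P (\<rho> m) (\<lambda>a b. sw R M C P (\<rho> a) (\<lambda>a0 a1. F a0 a1 b)) =
    sw R M C P (\<rho> m) (\<lambda>a b. sw R C C P (comul C b) (\<lambda>b1 b2. F (aut_inv M a) b1 (aut C b2)))"
proof -
  note F = trilinear_mapD[OF assms(2)]
  define G where "G a b c = F a b (aut C c)" for a b c
  define L where "L = (\<lambda>t. sw R (tensor R M C) C P t (\<lambda>s c. sw R M C P s (\<lambda>a b. G a b c)))"
  have G: "trilinear_map R M C C P G"
    unfolding G_def by (intro trilinear_mapI F linear_map_comp[OF C.linear_aut F(1)]) auto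
  note G' = trilinear_mapD[OF G]
  have L: "linear_map R (tensor3 R M C C) P L"
    "\<And>a b c. a \<in> carrier M \<Longrightarrow> b \<in> carrier C \<Longrightarrow> c \<in> carrier C \<Longrightarrow> L (tens3 R M C C a b c) = G a b c"
    unfolding L_def using trilinear_lift[OF _ _ _ assms(1) G] by auto
  note Lsw = linear_sw[where L = L, OF _ _ _ assms(1) L(1)]
  have "L (sw R M C (tensor3 R M C C) (\<rho> m) (\<lambda>m0 m1.
         sw R M C (tensor3 R M C C) (\<rho> m0) (\<lambda>m00 m01.
           tens3 R M C C m00 m01 (aut_inv C m1)))) =
       L (sw R M C (tensor3 R M C C) (\<rho> m) (\<lambda>m0 m1.
         sw R C C (tensor3 R M C C) (comul C m1) (\<lambda>m11 m12.
           tens3 R M C C (aut_inv M m0) m11 m12)))"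
    using comodule assms(3) by (simp add: hom_right_comodule_def sw_def)
  then show ?thesis
    using assms(1,3) by (simp add: Lsw L) (simp add: G_def)
qed

lemma sw_counit:
  assumes "module R P" "linear_map R M P f" "m \<in> carrier M"
  shows "sw R M C P (\<rho> m) (\<lambda>a b. counit C b \<odot>\<^bsub>P\<^esub> f a) = f (aut_inv M m)"
proof -
  have e: "counit C c \<in> carrier R" if "c \<in> carrier C" for c
    using linear_form_closed[OF linear_counit that] .
  have "f (aut_inv M m) = f (sw R M C M (\<rho> m) (\<lambda>a b. counit C b \<odot>\<^bsub>M\<^esub> a))"
    using comodule assms(3) by (simp add: hom_right_comodule_def sw_def)
  also have "\<dots> = sw R M C P (\<rho> m) (\<lambda>a b. f (counit C b \<odot>\<^bsub>M\<^esub> a))"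
    using assms by (intro linear_sw) (auto simp: e)
  also have "\<dots> = sw R M C P (\<rho> m) (\<lambda>a b. counit C b \<odot>\<^bsub>P\<^esub> f a)"
    using assms by (intro sw_cong) (auto simp: e linear_mapD(3)[OF assms(2)])
  finally show ?thesis ..
qed

end

locale hcoalg = hobj R C
  for R :: "('k, 'r) ring_scheme" and C :: "('k, 'c, 'z) hom_coalg_scheme" +
  assumes coalgebra: "hom_coalgebra R C"
begin

text \<open>A Hom-coalgebra coacts on itself from the right, so the rules for coactions also serve
  for \<open>comul C\<close>. One counit law is part of the comodule structure; the other one is
  \<open>counit_left\<close>.\<close>

sublocale self: rcomod R C C "comul C"
  using coalgebra hom_object
  by unfold_locales
    (auto simp: hom_coalgebra_def hom_right_comodule_def)

lemma counit_closed [simp]: "c \<in> carrier C \<Longrightarrow> counit C c \<in> carrier R"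
  using linear_form_closed[OF self.linear_counit] .

lemma counit_aut [simp]: "c \<in> carrier C \<Longrightarrow> counit C (aut C c) = counit C c"
  using coalgebra by (auto simp: hom_coalgebra_def)

lemma counit_aut_inv [simp]: "c \<in> carrier C \<Longrightarrow> counit C (aut_inv C c) = counit C c"
  using counit_aut[of "aut_inv C c"] by simp

lemmas linear_counit_smult [simp] = linear_form_smult[OF self.linear_counit]

lemma comul_aut: "c \<in> carrier C \<Longrightarrow>
    comul C (aut C c) = sw R C C (tensor R C C) (comul C c) (\<lambda>a b. tens R C C (aut C a) (aut C b))"
  using coalgebra by (auto simp: hom_coalgebra_def sw_def)

lemma counit_left:
  assumes "module R P" "linear_map R C P f" "c \<in> carrier C"
  shows "sw R C C P (comul C c) (\<lambda>a b. counit C a \<odot>\<^bsub>P\<^esub> f b) = f (aut_inv C c)"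
proof -
  have "f (aut_inv C c) = f (sw R C C C (comul C c) (\<lambda>a b. counit C a \<odot>\<^bsub>C\<^esub> b))"
    using coalgebra assms(3) by (simp add: hom_coalgebra_def sw_def)
  also have "\<dots> = sw R C C P (comul C c) (\<lambda>a b. f (counit C a \<odot>\<^bsub>C\<^esub> b))"
    using assms by (intro linear_sw) auto
  also have "\<dots> = sw R C C P (comul C c) (\<lambda>a b. counit C a \<odot>\<^bsub>P\<^esub> f b)"
    using assms by (intro sw_cong) (auto simp: linear_mapD(3)[OF assms(2)])
  finally show ?thesis ..
qed

end

locale hbialg = halg R C + hcoalg R C
  for R :: "('k, 'r) ring_scheme" and C :: "('k, 'c, 'z) hom_coalg_scheme" +
  assumes bialgebra: "hom_bialgebra R C"
begin

lemma comul_mult: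
  "a \<in> carrier C \<Longrightarrow> b \<in> carrier C \<Longrightarrow> comul C (a \<otimes>\<^bsub>C\<^esub> b) =
     sw R C C (tensor R C C) (comul C a) (\<lambda>a1 a2. sw R C C (tensor R C C) (comul C b) (\<lambda>b1 b2.
       tens R C C (a1 \<otimes>\<^bsub>C\<^esub> b1) (a2 \<otimes>\<^bsub>C\<^esub> b2)))"
  using bialgebra by (auto simp: hom_bialgebra_def sw_def)

lemma comul_one [simp]: "comul C \<one>\<^bsub>C\<^esub> = tens R C C \<one>\<^bsub>C\<^esub> \<one>\<^bsub>C\<^esub>"
  and counit_mult [simp]: "a \<in> carrier C \<Longrightarrow> b \<in> carrier C \<Longrightarrow>
    counit C (a \<otimes>\<^bsub>C\<^esub> b) = counit C a \<otimes>\<^bsub>R\<^esub> counit C b"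
  and counit_one [simp]: "counit C \<one>\<^bsub>C\<^esub> = \<one>\<^bsub>R\<^esub>"
  using bialgebra by (auto simp: hom_bialgebra_def)

lemma sw_comul_mult [simp]:
  assumes "module R P" "bilinear_map R C C P F" "a \<in> carrier C" "b \<in> carrier C"
  shows "sw R C C P (comul C (a \<otimes>\<^bsub>C\<^esub> b)) F =
    sw R C C P (comul C a) (\<lambda>a1 a2. sw R C C P (comul C b) (\<lambda>b1 b2. F (a1 \<otimes>\<^bsub>C\<^esub> b1) (a2 \<otimes>\<^bsub>C\<^esub> b2)))"
  using assms by (simp add: comul_mult)

end

lemma hbialgI: "hom_bialgebra R C \<Longrightarrow> hbialg R C"
  by unfold_locales (auto simp: hom_algebra_def hom_bialgebra_def)

text \<open>The part of a monoidal datum on which the tensor product of modules depends.\<close>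

locale tdatum = A: halg R A + C: hbialg R C
  for R :: "('k, 'r) ring_scheme" and H :: "('k, 'h) hom_coalg" and A :: "('k, 'h, 'a) comod_alg"
    and C :: "('k, 'h, 'c) mod_coalg" +
  assumes module_H [simp]: "module R H"
    and linear_hcoact: "linear_map R A (tensor R A H) (hcoact A)"
    and bilinear_hact: "bilinear_map R H C C (hact C)"
    and linear_comul_A: "linear_map R A (tensor R A A) (comul A)"
    and comul_aut_A: "a \<in> carrier A \<Longrightarrow>
      comul A (aut A a) = sw R A A (tensor R A A) (comul A a) (\<lambda>a1 a2. tens R A A (aut A a1) (aut A a2))"
    and comul_mult_A: "a \<in> carrier A \<Longrightarrow> b \<in> carrier A \<Longrightarrow> comul A (a \<otimes>\<^bsub>A\<^esub> b) =
      sw R A A (tensor R A A) (comul A a) (\<lambda>a1 a2. sw R A A (tensor R A A) (comul A b) (\<lambda>b1 b2.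
        tens R A A (a1 \<otimes>\<^bsub>A\<^esub> b1) (a2 \<otimes>\<^bsub>A\<^esub> b2)))"
    and comul_one_A: "comul A \<one>\<^bsub>A\<^esub> = tens R A A \<one>\<^bsub>A\<^esub> \<one>\<^bsub>A\<^esub>"
    and compat: "a \<in> carrier A \<Longrightarrow> c \<in> carrier C \<Longrightarrow> d \<in> carrier C \<Longrightarrow>
      sw R A A (tensor3 R A A C) (comul A a) (\<lambda>a1 a2.
         sw R A H (tensor3 R A A C) (hcoact A a1) (\<lambda>a10 a11.
           sw R A H (tensor3 R A A C) (hcoact A a2) (\<lambda>a20 a21.
             tens3 R A A C a10 a20 (hact C a11 c \<otimes>\<^bsub>C\<^esub> hact C a21 d)))) =
       sw R A H (tensor3 R A A C) (hcoact A a) (\<lambda>a0 a1.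
         sw R A A (tensor3 R A A C) (comul A a0) (\<lambda>a01 a02.
           tens3 R A A C a01 a02 (hact C a1 (c \<otimes>\<^bsub>C\<^esub> d))))"
begin

lemma hcoact_closed [simp]: "a \<in> carrier A \<Longrightarrow> hcoact A a \<in> carrier (tensor R A H)"
  using linear_mapD(1)[OF linear_hcoact] .

lemma linear_hcoact_comp [simp]:
  "linear_map R X A f \<Longrightarrow> linear_map R X (tensor R A H) (\<lambda>x. hcoact A (f x))"
  by (rule linear_map_comp[OF _ linear_hcoact])

lemma comul_A_closed [simp]: "a \<in> carrier A \<Longrightarrow> comul A a \<in> carrier (tensor R A A)"
  using linear_mapD(1)[OF linear_comul_A] .

lemma linear_comul_A_comp [simp]:
  "linear_map R X A f \<Longrightarrow> linear_map R X (tensor R A A) (\<lambda>x. comul A (f x))"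
  by (rule linear_map_comp[OF _ linear_comul_A])

lemmas hact_closed [simp] = bilinear_mapD(3)[OF bilinear_hact]
lemmas linear_hact_left [simp] = bilinear_comp_left[OF bilinear_hact]
lemmas linear_hact_right [simp] = bilinear_comp_right[OF bilinear_hact]
lemmas hact_sw_right [simp] = bilinear_sw_right[OF bilinear_hact C.module_M C.module_M]

lemma sw_comul_aut_A [simp]:
  assumes "module R P" "bilinear_map R A A P F" "a \<in> carrier A"
  shows "sw R A A P (comul A (aut A a)) F = sw R A A P (comul A a) (\<lambda>a b. F (aut A a) (aut A b))"
  using assms by (simp add: comul_aut_A)

lemma sw_comul_mult_A [simp]:
  assumes "module R P" "bilinear_map R A A P F" "a \<in> carrier A" "b \<in> carrier A"
  shows "sw R A A P (comul A (a \<otimes>\<^bsub>A\<^esub> b)) F =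
    sw R A A P (comul A a) (\<lambda>a1 a2. sw R A A P (comul A b) (\<lambda>b1 b2. F (a1 \<otimes>\<^bsub>A\<^esub> b1) (a2 \<otimes>\<^bsub>A\<^esub> b2)))"
  using assms by (simp add: comul_mult_A)

declare comul_one_A [simp]

lemma sw_compat:
  assumes "module R P" "trilinear_map R A A C P F" "a \<in> carrier A" "c \<in> carrier C" "d \<in> carrier C"
  shows "sw R A A P (comul A a) (\<lambda>a1 a2.
         sw R A H P (hcoact A a1) (\<lambda>a10 a11.
           sw R A H P (hcoact A a2) (\<lambda>a20 a21.
             F a10 a20 (hact C a11 c \<otimes>\<^bsub>C\<^esub> hact C a21 d)))) =
       sw R A H P (hcoact A a) (\<lambda>a0 a1.
         sw R A A P (comul A a0) (\<lambda>a01 a02. F a01 a02 (hact C a1 (c \<otimes>\<^bsub>C\<^esub> d))))"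
proof -
  note [simp] = trilinear_mapD[OF assms(2)]
  define L where "L = (\<lambda>t. sw R (tensor R A A) C P t (\<lambda>s c. sw R A A P s (\<lambda>a b. F a b c)))"
  have L: "linear_map R (tensor3 R A A C) P L"
    "\<And>a b c. a \<in> carrier A \<Longrightarrow> b \<in> carrier A \<Longrightarrow> c \<in> carrier C \<Longrightarrow> L (tens3 R A A C a b c) = F a b c"
    unfolding L_def using trilinear_lift[OF _ _ _ assms(1,2)] by auto
  note Lsw = linear_sw[where L = L, OF _ _ _ assms(1) L(1)]
  show ?thesis
    using arg_cong[OF compat[OF assms(3-5)], of L] assms by (simp add: Lsw L)
qed

text \<open>In \<open>sw_compat\<close> the unknown \<open>F\<close> is applied to a compound term,
  which is out of reach of higher-order pattern matching. Here the unknowns \<open>f\<close> and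
  \<open>g\<close> are applied to bound variables only, so the rule can be used for
  rewriting.\<close>

lemma sw_compat_tens:
  assumes [simp]: "module R M" "module R N" and fg: "linear_map R A M f" "linear_map R A N g"
    and [simp]: "a \<in> carrier A" "c \<in> carrier C" "d \<in> carrier C"
  shows "sw R A A (tensor3 R M N C) (comul A a) (\<lambda>a1 a2.
         sw R A H (tensor3 R M N C) (hcoact A a1) (\<lambda>a10 a11.
           sw R A H (tensor3 R M N C) (hcoact A a2) (\<lambda>a20 a21.
             tens3 R M N C (f a10) (g a20) (hact C a11 c \<otimes>\<^bsub>C\<^esub> hact C a21 d)))) =
       sw R A H (tensor3 R M N C) (hcoact A a) (\<lambda>a0 a1.
         sw R A A (tensor3 R M N C) (comul A a0) (\<lambda>a01 a02.
           tens3 R M N C (f a01) (g a02) (hact C a1 (c \<otimes>\<^bsub>C\<^esub> d))))"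
  using fg linear_mapD(1)[OF fg(1)] linear_mapD(1)[OF fg(2)]
  by (intro sw_compat[where F = "\<lambda>a b e. tens3 R M N C (f a) (g b) e"]) simp_all

end

section \<open>Doi Hom-Hopf modules\<close>

text \<open>The free module is built on the carriers and the relations use only addition and
  scalars, so all further fields of the records are invisible to the tensor product.\<close>

lemma tensor_eqI:
  assumes "carrier M = carrier M'" "add M = add M'" "smult M = smult M'"
    and "carrier N = carrier N'" "add N = add N'" "smult N = smult N'"
  shows "tensor R M N = tensor R M' N'" "tens R M N = tens R M' N'"
  using assms by (auto simp: tensor_def tens_def tensor_relations_def fun_eq_iff)

lemma linear_map_eqI:
  assumes "carrier M = carrier M'" "add M = add M'" "smult M = smult M'"
    and "carrier N = carrier N'" "add N = add N'" "smult N = smult N'"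
  shows "linear_map R M N f = linear_map R M' N' f"
  using assms by (simp add: linear_map_def)

lemma module_eqI:
  assumes "module R M"
    and "carrier M = carrier M'" "add M = add M'" "smult M = smult M'" "zero M = zero M'"
  shows "module R M'"
proof -
  interpret M: module R M by fact
  have "abelian_group M'"
  proof (rule abelian_groupI)
    show "\<exists>y\<in>carrier M'. y \<oplus>\<^bsub>M'\<^esub> x = \<zero>\<^bsub>M'\<^esub>" if "x \<in> carrier M'" for x
      using that M.l_neg M.a_inv_closed unfolding assms(2-5)[symmetric] by blast
  qed (auto simp flip: assms(2-5) simp: M.a_ac)
  then show ?thesis
    by (intro moduleI M.R.is_cring)
      (auto simp flip: assms(2-5) simp: M.smult_l_distr M.smult_r_distr M.smult_assoc1)
qed

text \<open>The source modules do not enter the value and the target enters only through its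
  additive and scalar structure; so a sum into a \<open>dhh_make\<close> object is the sum into the
  module it is built on.\<close>

lemma sw_eqI:
  assumes "zero P = zero P'" "carrier P = carrier P'" "add P = add P'" "smult P = smult P'"
  shows "sw R M N P t f = sw R M' N' P' t f"
  using assms by (simp add: sw_def sweedler_def finsum_def finprod_def Let_def cong: if_cong)

lemma dhh_make_sel [simp]:
  "carrier (dhh_make M \<mu> l \<rho>) = carrier M" "add (dhh_make M \<mu> l \<rho>) = add M"
  "smult (dhh_make M \<mu> l \<rho>) = smult M" "zero (dhh_make M \<mu> l \<rho>) = zero M"
  "aut (dhh_make M \<mu> l \<rho>) = \<mu>" "act (dhh_make M \<mu> l \<rho>) = l" "coact (dhh_make M \<mu> l \<rho>) = \<rho>"
  by (simp_all add: dhh_make_def)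

lemma tensor_dhh_make [simp]:
  "tensor R (dhh_make M \<mu> l \<rho>) N = tensor R M N" "tensor R N (dhh_make M \<mu> l \<rho>) = tensor R N M"
  "tens R (dhh_make M \<mu> l \<rho>) N = tens R M N" "tens R N (dhh_make M \<mu> l \<rho>) = tens R N M"
  by (intro tensor_eqI; simp)+

lemma linear_map_dhh_make [simp]:
  "linear_map R (dhh_make M \<mu> l \<rho>) N f = linear_map R M N f"
  "linear_map R N (dhh_make M \<mu> l \<rho>) g = linear_map R N M g"
  by (intro linear_map_eqI; simp)+

lemma bilinear_map_dhh_make [simp]:
  "bilinear_map R (dhh_make M \<mu> l \<rho>) N P f = bilinear_map R M N P f"
  "bilinear_map R N (dhh_make M \<mu> l \<rho>) P g = bilinear_map R N M P g"
  "bilinear_map R N P (dhh_make M \<mu> l \<rho>) h = bilinear_map R N P M h"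
  by (simp_all add: bilinear_map_def)

lemma module_dhh_make [simp]: "module R (dhh_make M \<mu> l \<rho>) = module R M"
  by (rule iffI; erule module_eqI) simp_all

lemma sw_dhh_make [simp]:
  "sw R (dhh_make M \<mu> l \<rho>) N P t f = sw R M N P t f"
  "sw R N (dhh_make M \<mu> l \<rho>) P s g = sw R N M P s g"
  "sw R N P (dhh_make M \<mu> l \<rho>) u h = sw R N P M u h"
  by (rule sw_eqI; simp)+

lemma aut_inv_dhh_make:
  assumes "\<And>x. x \<in> carrier M \<Longrightarrow> \<nu> x \<in> carrier M" "\<And>x. x \<in> carrier M \<Longrightarrow> \<mu> x \<in> carrier M"
    "\<And>x. x \<in> carrier M \<Longrightarrow> \<mu> (\<nu> x) = x" "\<And>x. x \<in> carrier M \<Longrightarrow> \<nu> (\<mu> x) = x" "x \<in> carrier M"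
  shows "aut_inv (dhh_make M \<mu> l \<rho>) x = \<nu> x"
proof -
  have "inj_on \<mu> (carrier M)" using assms(4) by (rule inj_on_inverseI)
  then show ?thesis unfolding aut_inv_def by (simp add: inv_into_f_eq assms)
qed

locale dhh = A: halg R A + C: hcoalg R C
  for R :: "('k, 'r) ring_scheme" and H :: "('k, 'h) hom_coalg" and A :: "('k, 'h, 'a) comod_alg"
    and C :: "('k, 'h, 'c) mod_coalg" +
  fixes M :: "('k, 'a, 'c, 'm) dhh"
  assumes dhh_module: "dhh_module R A C M"
    and module_H' [simp]: "module R H"
    and linear_hcoact': "linear_map R A (tensor R A H) (hcoact A)"
    and bilinear_hact': "bilinear_map R H C C (hact C)"
begin

sublocale rcomod R C M "coact M"
  using dhh_module
  by unfold_locales (auto simp: dhh_module_def hom_right_comodule_def C.self.linear_comul C.self.linear_counit)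

lemma bilinear_act: "bilinear_map R A M M (act M)"
  and act_act: "a \<in> carrier A \<Longrightarrow> b \<in> carrier A \<Longrightarrow> m \<in> carrier M \<Longrightarrow>
    act M (aut A a) (act M b m) = act M (a \<otimes>\<^bsub>A\<^esub> b) (aut M m)"
  and act_one [simp]: "m \<in> carrier M \<Longrightarrow> act M \<one>\<^bsub>A\<^esub> m = aut M m"
  and aut_act [simp]: "a \<in> carrier A \<Longrightarrow> m \<in> carrier M \<Longrightarrow>
    aut M (act M a m) = act M (aut A a) (aut M m)"
  using dhh_module by (auto simp: dhh_module_def hom_left_module_def)

lemmas act_closed [simp] = bilinear_mapD(3)[OF bilinear_act]
lemmas linear_act_left [simp] = bilinear_comp_left[OF bilinear_act]
lemmas linear_act_right [simp] = bilinear_comp_right[OF bilinear_act]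
lemmas act_sw_left [simp] = bilinear_sw_left[OF bilinear_act A.module_M M.module_M]
lemmas act_sw_right [simp] = bilinear_sw_right[OF bilinear_act M.module_M M.module_M]

lemma hcoact_closed' [simp]: "a \<in> carrier A \<Longrightarrow> hcoact A a \<in> carrier (tensor R A H)"
  using linear_mapD(1)[OF linear_hcoact'] .

lemmas hact_closed' [simp] = bilinear_mapD(3)[OF bilinear_hact']
lemmas linear_hact_right' [simp] = bilinear_comp_right[OF bilinear_hact']

lemma coact_aut: "m \<in> carrier M \<Longrightarrow>
    coact M (aut M m) = sw R M C (tensor R M C) (coact M m) (\<lambda>m0 m1. tens R M C (aut M m0) (aut C m1))"
  using dhh_module by (auto simp: dhh_module_def hom_right_comodule_def sw_def)

lemma sw_coact_act [simp]:
  assumes "module R P" "bilinear_map R M C P F" "a \<in> carrier A" "m \<in> carrier M"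
  shows "sw R M C P (coact M (act M a m)) F =
    sw R A H P (hcoact A a) (\<lambda>a0 a1. sw R M C P (coact M m) (\<lambda>m0 m1. F (act M a0 m0) (hact C a1 m1)))"
proof -
  have "coact M (act M a m) = sw R A H (tensor R M C) (hcoact A a) (\<lambda>a0 a1.
          sw R M C (tensor R M C) (coact M m) (\<lambda>m0 m1. tens R M C (act M a0 m0) (hact C a1 m1)))"
    using dhh_module assms(3,4) by (simp add: dhh_module_def sw_def)
  then show ?thesis using assms(1-4) by simp
qed

end

text \<open>The inverse of the automorphism is supplied as an explicit map \<open>\<nu>\<close>, so
  that for constructed objects no computation with \<open>inv_into\<close> is necessary.\<close>

lemma dhh_moduleI:
  fixes A :: "('k, 'h, 'a) comod_alg" and C :: "('k, 'h, 'c) mod_coalg"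
    and M :: "('k, 'm, 'z) module_scheme"
    and H :: "('k, 'h) hom_coalg"
  assumes C: "hobj R C" and M: "module R M"
    and mu: "linear_map R M M \<mu>"
    and nu: "\<And>x. x \<in> carrier M \<Longrightarrow> \<nu> x \<in> carrier M"
    and mu_nu: "\<And>x. x \<in> carrier M \<Longrightarrow> \<mu> (\<nu> x) = x" "\<And>x. x \<in> carrier M \<Longrightarrow> \<nu> (\<mu> x) = x"
    and l: "bilinear_map R A M M l"
    and act_act: "\<And>a b m. a \<in> carrier A \<Longrightarrow> b \<in> carrier A \<Longrightarrow> m \<in> carrier M \<Longrightarrow>
      l (aut A a) (l b m) = l (a \<otimes>\<^bsub>A\<^esub> b) (\<mu> m)"
    and act_one: "\<And>m. m \<in> carrier M \<Longrightarrow> l \<one>\<^bsub>A\<^esub> m = \<mu> m"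
    and aut_act: "\<And>a m. a \<in> carrier A \<Longrightarrow> m \<in> carrier M \<Longrightarrow> \<mu> (l a m) = l (aut A a) (\<mu> m)"
    and rho: "linear_map R M (tensor R M C) \<rho>"
    and comul: "\<And>c. c \<in> carrier C \<Longrightarrow> comul C c \<in> carrier (tensor R C C)"
    and coassoc: "\<And>m. m \<in> carrier M \<Longrightarrow>
       sw R M C (tensor3 R M C C) (\<rho> m) (\<lambda>m0 m1.
         sw R M C (tensor3 R M C C) (\<rho> m0) (\<lambda>m00 m01. tens3 R M C C m00 m01 (aut_inv C m1))) =
       sw R M C (tensor3 R M C C) (\<rho> m) (\<lambda>m0 m1.
         sw R C C (tensor3 R M C C) (comul C m1) (\<lambda>m11 m12. tens3 R M C C (\<nu> m0) m11 m12))"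
    and counit: "\<And>m. m \<in> carrier M \<Longrightarrow> sw R M C M (\<rho> m) (\<lambda>m0 m1. counit C m1 \<odot>\<^bsub>M\<^esub> m0) = \<nu> m"
    and rho_aut: "\<And>m. m \<in> carrier M \<Longrightarrow>
       \<rho> (\<mu> m) = sw R M C (tensor R M C) (\<rho> m) (\<lambda>m0 m1. tens R M C (\<mu> m0) (aut C m1))"
    and rho_act: "\<And>a m. a \<in> carrier A \<Longrightarrow> m \<in> carrier M \<Longrightarrow>
       \<rho> (l a m) = sw R A H (tensor R M C) (hcoact A a) (\<lambda>a0 a1.
         sw R M C (tensor R M C) (\<rho> m) (\<lambda>m0 m1. tens R M C (l a0 m0) (hact C a1 m1)))"
  shows "dhh_module R A C (dhh_make M \<mu> l \<rho>)"
proof -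
  let ?E = "dhh_make M \<mu> l \<rho>"
  interpret C: hobj R C by fact
  note [simp] = M linear_mapD(1)[OF mu] linear_mapD(1)[OF rho] nu mu_nu comul
  have inv: "aut_inv ?E x = \<nu> x" if "x \<in> carrier M" for x
    by (rule aut_inv_dhh_make) (use that in auto)
  have "bij_betw \<mu> (carrier M) (carrier M)"
    by (rule bij_betwI[of _ _ _ \<nu>]) auto
  then have obj: "hom_object R ?E" by (simp add: hom_object_def mu)
  have coassoc': "sweedler R (tensor3 R M C C) (\<rho> m) (\<lambda>m0 m1.
         sweedler R (tensor3 R M C C) (\<rho> m0) (\<lambda>m00 m01. tens3 R M C C m00 m01 (aut_inv C m1))) =
       sweedler R (tensor3 R M C C) (\<rho> m) (\<lambda>m0 m1.
         sweedler R (tensor3 R M C C) (comul C m1) (\<lambda>m11 m12. tens3 R M C C (aut_inv ?E m0) m11 m12))"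
    if "m \<in> carrier M" for m
  proof -
    have "sw R M C (tensor3 R M C C) (\<rho> m) (\<lambda>m0 m1.
         sw R C C (tensor3 R M C C) (comul C m1) (\<lambda>m11 m12. tens3 R M C C (\<nu> m0) m11 m12)) =
      sw R M C (tensor3 R M C C) (\<rho> m) (\<lambda>m0 m1.
         sw R C C (tensor3 R M C C) (comul C m1) (\<lambda>m11 m12. tens3 R M C C (aut_inv ?E m0) m11 m12))"
      using that by (simp add: inv)
    then show ?thesis using coassoc[OF that] by (simp add: sw_def del: sw_cong cong del: sw_cong)
  qed
  have "hom_left_module R A ?E l"
    unfolding hom_left_module_def using obj l by (simp add: act_act act_one aut_act)
  moreover have "hom_right_comodule R C ?E \<rho>"
    unfolding hom_right_comodule_def using obj rho coassoc' counit rho_aut inv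
    by (simp add: sw_def sweedler_def finsum_def finprod_def Let_def cong: if_cong)
  ultimately show ?thesis
    unfolding dhh_module_def using rho_act by (simp add: sw_def)
qed

section \<open>Tensor products of Doi Hom-Hopf modules\<close>

locale tpair = D: tdatum R H A C + M: dhh R H A C M + N: dhh R H A C N
  for R :: "('k, 'r) ring_scheme" and H :: "('k, 'h) hom_coalg" and A :: "('k, 'h, 'a) comod_alg"
    and C :: "('k, 'h, 'c) mod_coalg"
    and M :: "('k, 'a, 'c, 'm) dhh" and N :: "('k, 'a, 'c, 'n) dhh"
begin

abbreviation "T \<equiv> tensor R M N"

definition "tau t = sw R M N T t (\<lambda>m n. tens R M N (aut M m) (aut N n))"
definition "tau' t = sw R M N T t (\<lambda>m n. tens R M N (aut_inv M m) (aut_inv N n))"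
definition "tact a t = sw R A A T (comul A a) (\<lambda>a1 a2.
         sw R M N T t (\<lambda>m n. tens R M N (act M a1 m) (act N a2 n)))"
definition "tcoact t = sw R M N (tensor R T C) t (\<lambda>m n.
         sw R M C (tensor R T C) (coact M m) (\<lambda>m0 m1.
           sw R N C (tensor R T C) (coact N n) (\<lambda>n0 n1.
             tens R T C (tens R M N m0 n0) (m1 \<otimes>\<^bsub>C\<^esub> n1))))"

lemma dhh_tensor_eq: "dhh_tensor R A C M N = dhh_make T tau tact tcoact"
  unfolding dhh_tensor_def tau_def[abs_def] tact_def[abs_def] tcoact_def[abs_def] sw_def by (rule refl)

lemma linear_tau: "linear_map R T T tau"
  unfolding tau_def by simp

lemma linear_tau': "linear_map R T T tau'"
  unfolding tau'_def by simp

lemma bilinear_tact: "bilinear_map R A T T tact"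
  unfolding tact_def by simp

lemma linear_tcoact: "linear_map R T (tensor R T C) tcoact"
  unfolding tcoact_def by simp

lemma tau_tens: "m \<in> carrier M \<Longrightarrow> n \<in> carrier N \<Longrightarrow>
    tau (tens R M N m n) = tens R M N (aut M m) (aut N n)"
  unfolding tau_def by simp

lemma tau'_tens: "m \<in> carrier M \<Longrightarrow> n \<in> carrier N \<Longrightarrow>
    tau' (tens R M N m n) = tens R M N (aut_inv M m) (aut_inv N n)"
  unfolding tau'_def by simp

lemma tact_tens: "a \<in> carrier A \<Longrightarrow> m \<in> carrier M \<Longrightarrow> n \<in> carrier N \<Longrightarrow>
    tact a (tens R M N m n) = sw R A A T (comul A a) (\<lambda>a1 a2. tens R M N (act M a1 m) (act N a2 n))"
  unfolding tact_def by simp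

lemma tcoact_tens: "m \<in> carrier M \<Longrightarrow> n \<in> carrier N \<Longrightarrow>
    tcoact (tens R M N m n) = sw R M C (tensor R T C) (coact M m) (\<lambda>m0 m1.
           sw R N C (tensor R T C) (coact N n) (\<lambda>n0 n1.
             tens R T C (tens R M N m0 n0) (m1 \<otimes>\<^bsub>C\<^esub> n1)))"
  unfolding tcoact_def by simp

lemmas tau_closed [simp] = linear_mapD(1)[OF linear_tau]
lemmas tau'_closed [simp] = linear_mapD(1)[OF linear_tau']
lemmas tact_closed [simp] = bilinear_mapD(3)[OF bilinear_tact]
lemmas tcoact_closed [simp] = linear_mapD(1)[OF linear_tcoact]
lemmas linear_tau_comp [simp] = linear_map_comp[OF _ linear_tau]
lemmas linear_tau'_comp [simp] = linear_map_comp[OF _ linear_tau']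
lemmas linear_tcoact_comp [simp] = linear_map_comp[OF _ linear_tcoact]
lemmas linear_tact_left [simp] = bilinear_comp_left[OF bilinear_tact]
lemmas linear_tact_right [simp] = bilinear_comp_right[OF bilinear_tact]

lemma module_T: "module R T" by simp

lemmas tau_sw [simp] = linear_sw[OF _ _ module_T module_T linear_tau]
lemmas tcoact_sw [simp] = linear_sw[OF _ _ module_T tensor_module[OF module_T D.C.module_M] linear_tcoact]
lemmas tact_sw_right [simp] = bilinear_sw_right[OF bilinear_tact module_T module_T]

declare tau_tens [simp] tau'_tens [simp] tact_tens [simp] tcoact_tens [simp]

lemma tau_tau': "\<forall>t\<in>carrier T. tau (tau' t) = t"
  by (rule tensor_ext[where P = T]) simp_all

lemma tau'_tau: "\<forall>t\<in>carrier T. tau' (tau t) = t"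
  by (rule tensor_ext[where P = T]) simp_all

lemma tact_tact:
  assumes "a \<in> carrier A" "b \<in> carrier A"
  shows "\<forall>t\<in>carrier T. tact (aut A a) (tact b t) = tact (a \<otimes>\<^bsub>A\<^esub> b) (tau t)"
  by (rule tensor_ext[where P = T]) (simp_all add: assms M.act_act N.act_act sw_push[where t = "comul A b"])

lemma tact_one: "\<forall>t\<in>carrier T. tact \<one>\<^bsub>A\<^esub> t = tau t"
  by (rule tensor_ext[where P = T]) simp_all

lemma tau_tact:
  assumes "a \<in> carrier A"
  shows "\<forall>t\<in>carrier T. tau (tact a t) = tact (aut A a) (tau t)"
  by (rule tensor_ext[where P = T]) (simp_all add: assms)

text \<open>The iterated coaction sums over \<open>m\<close>, \<open>n\<close>, the first leg of
  \<open>m\<close> and the first leg of \<open>n\<close>, in this order. Moving the sum over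
  \<open>coact N\<close> inwards makes the two coactions of \<open>m\<close> adjacent, and then
  those of \<open>n\<close>, so that coassociativity applies to each.\<close>

lemma tcoact_coassoc:
  "\<forall>t\<in>carrier T.
       sw R T C (tensor3 R T C C) (tcoact t) (\<lambda>m0 m1.
         sw R T C (tensor3 R T C C) (tcoact m0) (\<lambda>m00 m01. tens3 R T C C m00 m01 (aut_inv C m1))) =
       sw R T C (tensor3 R T C C) (tcoact t) (\<lambda>m0 m1.
         sw R C C (tensor3 R T C C) (comul C m1) (\<lambda>m11 m12. tens3 R T C C (tau' m0) m11 m12))"
  by (rule tensor_ext[where P = "tensor3 R T C C"]) (simp_all add: sw_push[where t = "coact N _"] M.sw_coassoc N.sw_coassoc)

lemma tcoact_counit:
  "\<forall>t\<in>carrier T. sw R T C T (tcoact t) (\<lambda>m0 m1. counit C m1 \<odot>\<^bsub>T\<^esub> m0) = tau' t"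
  by (rule tensor_ext[where P = "T"]) (simp_all add: M.sw_counit N.sw_counit)

lemma tcoact_tau:
  "\<forall>t\<in>carrier T. tcoact (tau t) =
    sw R T C (tensor R T C) (tcoact t) (\<lambda>m0 m1. tens R T C (tau m0) (aut C m1))"
  by (rule tensor_ext[where P = "tensor R T C"]) (simp_all add: M.coact_aut N.coact_aut)

lemma tcoact_tact:
  assumes "a \<in> carrier A"
  shows "\<forall>t\<in>carrier T. tcoact (tact a t) = sw R A H (tensor R T C) (hcoact A a) (\<lambda>a0 a1.
         sw R T C (tensor R T C) (tcoact t) (\<lambda>m0 m1. tens R T C (tact a0 m0) (hact C a1 m1)))" (is "\<forall>t\<in>_. ?l t = ?r t")
proof (rule tensor_ext[where P = "tensor R T C"])
  fix m n assume [simp]: "m \<in> carrier M" "n \<in> carrier N"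
  show "?l (tens R M N m n) = ?r (tens R M N m n)"
    \<comment> \<open>The sums over the coactions of \<open>m\<close> and \<open>n\<close> are
      pulled outwards, which leaves the sums over \<open>A\<close> and \<open>H\<close> innermost,
      in the shape of the compatibility law.\<close>
    by (simp add: assms D.sw_compat_tens
      sw_push[where s = "coact M m" and t = "hcoact A _"] sw_push[where s = "coact M m" and t = "comul A _"]
      sw_push[where s = "coact N n" and t = "hcoact A _"] sw_push[where s = "coact N n" and t = "comul A _"])
qed (simp_all add: assms)

theorem dhh_tensor_module: "dhh_module R A C (dhh_tensor R A C M N)"
  unfolding dhh_tensor_eq
  by (rule dhh_moduleI[where H = H and \<nu> = tau'])
    (use tau_tau' tau'_tau tact_tact tact_one tau_tact tcoact_coassoc tcoact_counit tcoact_tau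
      tcoact_tact D.C.hobj_axioms linear_tau bilinear_tact linear_tcoact in simp_all)

end

section \<open>Recognizing \<open>G(P)\<close>\<close>

text \<open>
  Injectivity of \<open>J \<otimes> C\<close> does not follow from that of \<open>J\<close> over a general base ring; it yields the
  uniqueness of the induced coaction.
\<close>

locale gtransport = E: dhh R H A C E + P: dhh R H A D P
  for R :: "('k, 'r) ring_scheme" and H :: "('k, 'h) hom_coalg" and A :: "('k, 'h, 'a) comod_alg"
    and C :: "('k, 'h, 'c) mod_coalg" and D :: "('k, 'h, 'd) mod_coalg"
    and \<phi> :: "'c \<Rightarrow> 'd"
    and E :: "('k, 'a, 'c, 'e) dhh" and P :: "('k, 'a, 'd, 'p) dhh"
    and J :: "'e \<Rightarrow> ('k, 'p, 'c) tensor" +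
  assumes J_linear: "linear_map R E (tensor R P C) J"
    and J_inj: "inj_on J (carrier E)"
    and J_image: "J ` carrier E = cotensor R C D \<phi> P"
    and J_aut: "e \<in> carrier E \<Longrightarrow>
      J (aut E e) = sw R P C (tensor R P C) (J e) (\<lambda>n c. tens R P C (aut P n) (aut C c))"
    and J_act: "a \<in> carrier A \<Longrightarrow> e \<in> carrier E \<Longrightarrow>
      J (act E a e) = sw R A H (tensor R P C) (hcoact A a) (\<lambda>a0 a1.
        sw R P C (tensor R P C) (J e) (\<lambda>n c. tens R P C (act P a0 n) (hact C a1 c)))"
    and J_coact: "e \<in> carrier E \<Longrightarrow>
      sw R E C (tensor3 R P C C) (coact E e) (\<lambda>e0 e1. tens R (tensor R P C) C (J e0) e1) =
      sw R P C (tensor3 R P C C) (J e) (\<lambda>n c.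
        sw R C C (tensor3 R P C C) (comul C c) (\<lambda>c1 c2. tens3 R P C C (aut_inv P n) c1 (aut C c2)))"
    and JC_inj: "inj_on (\<lambda>t. sw R E C (tensor3 R P C C) t (\<lambda>e c. tens R (tensor R P C) C (J e) c))
      (carrier (tensor R E C))"
begin

abbreviation "G \<equiv> cotensor_module R C D \<phi> P"

lemma G_carrier: "carrier G = cotensor R C D \<phi> P"
  by (simp add: cotensor_module_def)

lemma G_sel [simp]:
  "add G = add (tensor R P C)" "smult G = smult (tensor R P C)"
  "zero G = zero (tensor R P C)"
  by (simp_all add: cotensor_module_def)

lemma G_module [simp]: "module R G"
  unfolding cotensor_module_def J_image[symmetric]
  by (rule submodule.submodule_is_module[OF image_submodule[OF _ _ J_linear]]) simp_all

lemma J_linear_G: "linear_map R E G J"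
  using J_linear J_image by (auto simp: linear_map_def G_carrier)

lemma J_bij: "bij_betw J (carrier E) (carrier G)"
  using J_inj J_image by (simp add: bij_betw_def G_carrier)

definition "J' = inv_into (carrier E) J"

lemma J'_linear: "linear_map R G E J'"
  unfolding J'_def by (rule inv_into_linear[OF _ J_linear_G J_bij]) simp

lemma J'_J [simp]: "e \<in> carrier E \<Longrightarrow> J' (J e) = e"
  unfolding J'_def using J_inj by simp

lemma J_cotensor [simp]: "e \<in> carrier E \<Longrightarrow> J e \<in> carrier G"
  using J_image by (auto simp: G_carrier)

lemma cotensor_cases:
  assumes "x \<in> carrier G" obtains e where "e \<in> carrier E" "x = J e"
  using assms J_image by (auto simp: G_carrier)

lemma J_J' [simp]: "x \<in> carrier G \<Longrightarrow> J (J' x) = x"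
  by (auto elim: cotensor_cases)

lemma J'_closed [simp]: "x \<in> carrier G \<Longrightarrow> J' x \<in> carrier E"
  by (auto elim: cotensor_cases)

text \<open>\<open>J\<close> is a linear bijection onto \<open>G\<close>, so linearity of a map on
  \<open>G\<close> can be tested after composing with \<open>J\<close>.\<close>

lemma linear_from_G:
  assumes "linear_map R E X g" "\<And>e. e \<in> carrier E \<Longrightarrow> f (J e) = g e"
  shows "linear_map R G X f"
proof (rule linear_map_cong[OF _ linear_map_comp[OF J'_linear assms(1)]])
  show "g (J' x) = f x" if "x \<in> carrier G" for x
    using that assms(2)[of "J' x"] by simp
  show "abelian_monoid G"
    by (rule abelian_group.axioms(1)[OF module.axioms(2)[OF G_module]])
  show "s \<odot>\<^bsub>G\<^esub> x \<in> carrier G" if "s \<in> carrier R" "x \<in> carrier G" for s x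
    by (rule module_smult_closed[OF G_module that])
qed

lemma incl_linear [simp]: "linear_map R G (tensor R P C) (\<lambda>x. x)"
  by (rule linear_from_G[OF J_linear]) simp

lemma incl_closed [simp]: "x \<in> carrier G \<Longrightarrow> x \<in> carrier (tensor R P C)"
  using linear_mapD(1)[OF incl_linear] .

lemmas J_linear_comp [simp] = linear_map_comp[OF _ J_linear]
lemmas J_linear_comp_G [simp] = linear_map_comp[OF _ J_linear_G]
lemmas J'_linear_comp [simp] = linear_map_comp[OF _ J'_linear]

text \<open>The coaction of \<open>E\<close> carried over by \<open>J\<close>. It lives in
  \<open>G \<otimes> C\<close> from the start, unlike the formula that defines the coaction of the
  cotensor product.\<close>

definition "r e = sw R E C (tensor R G C) (coact E e) (\<lambda>e0 e1. tens R G C (J e0) e1)"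

lemma r_linear: "linear_map R E (tensor R G C) r"
  unfolding r_def by simp

lemma r_closed [simp]: "e \<in> carrier E \<Longrightarrow> r e \<in> carrier (tensor R G C)"
  unfolding r_def by simp

lemma is_induced_coaction_iff:
  "is_induced_coaction R C D \<phi> P x t \<longleftrightarrow> t \<in> carrier (tensor R G C) \<and>
    sw R G C (tensor3 R P C C) t (\<lambda>y c. tens R (tensor R P C) C y c) =
    sw R P C (tensor3 R P C C) x (\<lambda>n c.
        sw R C C (tensor3 R P C C) (comul C c) (\<lambda>c1 c2. tens3 R P C C (aut_inv P n) c1 (aut C c2)))"
  by (simp add: is_induced_coaction_def sw_def cong del: sw_cong)

text \<open>Under the bijection \<open>J\<close> between \<open>E\<close> and \<open>G\<close>,
  tensored with \<open>C\<close>, the map induced by the inclusion of \<open>G\<close> becomes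
  \<open>J \<otimes> C\<close>, whose injectivity is assumed.\<close>

lemma incl_injective:
  assumes t: "t \<in> carrier (tensor R G C)" "t' \<in> carrier (tensor R G C)"
    and eq: "sw R G C (tensor3 R P C C) t (\<lambda>y c. tens R (tensor R P C) C y c) =
      sw R G C (tensor3 R P C C) t' (\<lambda>y c. tens R (tensor R P C) C y c)"
  shows "t = t'"
proof -
  define s where "s t = sw R G C (tensor R E C) t (\<lambda>y c. tens R E C (J' y) c)" for t
  have s: "s t \<in> carrier (tensor R E C)" if "t \<in> carrier (tensor R G C)" for t
    unfolding s_def using that by simp
  have 1: "\<forall>t\<in>carrier (tensor R G C). sw R E C (tensor R G C) (s t) (\<lambda>e c. tens R G C (J e) c) = t"
    unfolding s_def by (rule tensor_ext[where P = "tensor R G C"]) simp_all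
  have 2: "\<forall>t\<in>carrier (tensor R G C).
      sw R E C (tensor3 R P C C) (s t) (\<lambda>e c. tens R (tensor R P C) C (J e) c) =
      sw R G C (tensor3 R P C C) t (\<lambda>y c. tens R (tensor R P C) C y c)"
    unfolding s_def by (rule tensor_ext[where P = "tensor3 R P C C"]) simp_all
  have "s t = s t'" using inj_onD[OF JC_inj _ s s] 2 eq t by metis
  then show ?thesis using 1 t by metis
qed

text \<open>Existence of the preimage is \<open>J_coact\<close> and uniqueness is
  \<open>incl_injective\<close>; so the description operator in \<open>induced_G\<close> yields
  \<open>r e\<close>.\<close>

lemma is_induced_coaction_J:
  assumes "e \<in> carrier E"
  shows "is_induced_coaction R C D \<phi> P (J e) t \<longleftrightarrow> t = r e"
proof -
  have "is_induced_coaction R C D \<phi> P (J e) (r e)"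
    using assms J_coact[OF assms] by (simp add: is_induced_coaction_iff r_def)
  then show ?thesis
    using incl_injective[of t "r e"] by (auto simp: is_induced_coaction_iff)
qed

definition "gaut t = sw R P C (tensor R P C) t (\<lambda>n c. tens R P C (aut P n) (aut C c))"
definition "gact a t = sw R A H (tensor R P C) (hcoact A a) (\<lambda>a0 a1.
         sw R P C (tensor R P C) t (\<lambda>n c. tens R P C (act P a0 n) (hact C a1 c)))"
definition "gcoact x = (THE t. is_induced_coaction R C D \<phi> P x t)"

lemma induced_G_eq: "induced_G R A C D \<phi> P = dhh_make G gaut gact gcoact"
  unfolding induced_G_def gaut_def[abs_def] gact_def[abs_def] gcoact_def[abs_def] sw_def by (rule refl)

lemma gaut_J [simp]: "e \<in> carrier E \<Longrightarrow> gaut (J e) = J (aut E e)"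
  by (simp add: gaut_def J_aut)

lemma gact_J [simp]: "a \<in> carrier A \<Longrightarrow> e \<in> carrier E \<Longrightarrow> gact a (J e) = J (act E a e)"
  by (simp add: gact_def J_act)

lemma gcoact_J [simp]: "e \<in> carrier E \<Longrightarrow> gcoact (J e) = r e"
  by (simp add: gcoact_def is_induced_coaction_J)

lemma gact_bilinear: "bilinear_map R A G G gact"
proof (rule bilinear_mapI)
  fix a assume "a \<in> carrier A"
  then show "linear_map R G G (gact a)"
    by (intro linear_from_G[where g = "\<lambda>e. J (act E a e)"]) simp_all
next
  fix x assume "x \<in> carrier G"
  then obtain e where e: "e \<in> carrier E" "x = J e" by (auto elim: cotensor_cases)
  have "linear_map R A G (\<lambda>a. J (act E a e))" using e(1) by simp
  then show "linear_map R A G (\<lambda>a. gact a x)"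
    by (rule linear_map_cong[rotated])
      (auto simp: e intro: module_smult_closed[OF E.A.module_M]
        abelian_group.axioms(1)[OF module.axioms(2)[OF E.A.module_M]])
qed

lemma gcoact_linear: "linear_map R G (tensor R G C) gcoact"
  by (rule linear_from_G[OF r_linear]) simp

lemma gaut_linear: "linear_map R G G gaut"
  by (rule linear_from_G[where g = "\<lambda>e. J (aut E e)"]) simp_all

lemmas gact_closed [simp] = bilinear_mapD(3)[OF gact_bilinear]
lemmas gact_linear_right [simp] = bilinear_comp_right[OF gact_bilinear]
lemmas gcoact_closed [simp] = linear_mapD(1)[OF gcoact_linear]
lemmas gaut_closed [simp] = linear_mapD(1)[OF gaut_linear]
lemmas gcoact_linear_comp [simp] = linear_map_comp[OF _ gcoact_linear]
lemmas gaut_linear_comp [simp] = linear_map_comp[OF _ gaut_linear]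

lemma sw_r [simp]:
  assumes "module R X" "bilinear_map R G C X F" "e \<in> carrier E"
  shows "sw R G C X (r e) F = sw R E C X (coact E e) (\<lambda>e0 e1. F (J e0) e1)"
  unfolding r_def using assms by simp

text \<open>Every element of the cotensor product is some \<open>J e\<close>, and there each
  structure map is the image of the one of \<open>E\<close>; so each axiom is inherited. Nothing is
  compared in \<open>((P \<otimes> C) \<otimes> C) \<otimes> C\<close>, where the inclusion could
  fail to be injective.\<close>

lemma G_dhh_module: "dhh_module R A C (induced_G R A C D \<phi> P)"
  unfolding induced_G_eq
proof (rule dhh_moduleI[where H = H and \<nu> = "\<lambda>x. J (aut_inv E (J' x))"], goal_cases)
  \<comment> \<open>Cases 13 to 16 are coassociativity, the counit law, and compatibility of the
    coaction with the automorphism and with the action.\<close>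
  case (13 m)
  then obtain e where e [simp]: "e \<in> carrier E" and m: "m = J e" by (auto elim: cotensor_cases)
  show ?case unfolding m by (simp add: E.sw_coassoc)
next
  case (14 m)
  then obtain e where e [simp]: "e \<in> carrier E" and m: "m = J e" by (auto elim: cotensor_cases)
  show ?case unfolding m using E.sw_counit[OF G_module J_linear_G e] by (simp del: G_sel)
next
  case (15 m)
  then obtain e where e [simp]: "e \<in> carrier E" and m: "m = J e" by (auto elim: cotensor_cases)
  show ?case unfolding m by (simp add: r_def E.coact_aut)
next
  case (16 a m)
  then obtain e where e [simp]: "e \<in> carrier E" and m: "m = J e" by (auto elim: cotensor_cases)
  show ?case unfolding m using 16(1) by (simp add: r_def)
qed (auto elim!: cotensor_cases simp: E.C.hobj_axioms gaut_linear gact_bilinear gcoact_linear E.act_act)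

lemma G_defined: "G_defined_at R A C D \<phi> P"
  unfolding G_defined_at_def using G_dhh_module
  by (auto elim!: cotensor_cases simp: is_induced_coaction_J simp flip: G_carrier)

theorem G_iso: "dhh_iso_map R A C E (induced_G R A C D \<phi> P) J"
proof -
  have "dhh_morphism R A C E (induced_G R A C D \<phi> P) J"
    unfolding induced_G_eq dhh_morphism_def
    by (simp add: J_linear_G) (simp add: r_def sw_def cong del: sw_cong)
  moreover have "dhh_morphism R A C (induced_G R A C D \<phi> P) E J'"
    unfolding induced_G_eq dhh_morphism_def
  proof (intro conjI ballI, goal_cases)
    case (4 x)
    then obtain e where e: "e \<in> carrier E" "x = J e" by (auto elim: cotensor_cases)
    have "coact E e = sw R G C (tensor R E C) (r e) (\<lambda>m0 m1. tens R E C (J' m0) m1)"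
      using e by simp
    then show ?case using e by (simp add: sw_def cong del: sw_cong)
  qed (auto elim!: cotensor_cases simp: J'_linear)
  ultimately show ?thesis
    unfolding dhh_iso_map_def using E.dhh_module G_dhh_module
    by (auto simp: induced_G_eq intro!: exI[of _ J'])
qed

end

section \<open>The isomorphism \<open>G(C') = C\<close>\<close>

context hobj
begin

lemma aut_smult [simp]: "r \<in> carrier R \<Longrightarrow> x \<in> carrier M \<Longrightarrow> aut M (r \<odot>\<^bsub>M\<^esub> x) = r \<odot>\<^bsub>M\<^esub> aut M x"
  using linear_mapD(3)[OF linear_aut] .

lemma smult_commute:
  assumes "module R P" "r \<in> carrier R" "s \<in> carrier R" "x \<in> carrier P"
  shows "r \<odot>\<^bsub>P\<^esub> (s \<odot>\<^bsub>P\<^esub> x) = s \<odot>\<^bsub>P\<^esub> (r \<odot>\<^bsub>P\<^esub> x)"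
proof -
  interpret P: module R P by fact
  show ?thesis using assms by (simp add: P.m_comm del: smult_mult flip: P.smult_assoc1)
qed

end

section \<open>\<open>C\<close> as a Doi Hom-Hopf module over itself\<close>

locale datum = tdatum R H A C + A: hbialg R A + H: hbialg R H + Ac: rcomod R H A "hcoact A"
  for R :: "('k, 'r) ring_scheme" and H :: "('k, 'h) hom_coalg" and A :: "('k, 'h, 'a) comod_alg"
    and C :: "('k, 'h, 'c) mod_coalg" +
  assumes datum: "monoidal_doi_datum R H A C"
begin

lemma hcoact_mult: "a \<in> carrier A \<Longrightarrow> b \<in> carrier A \<Longrightarrow>
    hcoact A (a \<otimes>\<^bsub>A\<^esub> b) = sw R A H (tensor R A H) (hcoact A a) (\<lambda>a0 a1.
      sw R A H (tensor R A H) (hcoact A b) (\<lambda>b0 b1. tens R A H (a0 \<otimes>\<^bsub>A\<^esub> b0) (a1 \<otimes>\<^bsub>H\<^esub> b1)))"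
  and hcoact_one [simp]: "hcoact A \<one>\<^bsub>A\<^esub> = tens R A H \<one>\<^bsub>A\<^esub> \<one>\<^bsub>H\<^esub>"
  using datum by (auto simp: monoidal_doi_datum_def doi_datum_def hom_comodule_algebra_def sw_def)

lemma hact_hact [simp]: "h \<in> carrier H \<Longrightarrow> k \<in> carrier H \<Longrightarrow> c \<in> carrier C \<Longrightarrow>
    hact C (aut H h) (hact C k c) = hact C (h \<otimes>\<^bsub>H\<^esub> k) (aut C c)"
  and hact_one [simp]: "c \<in> carrier C \<Longrightarrow> hact C \<one>\<^bsub>H\<^esub> c = aut C c"
  and aut_hact [simp]: "h \<in> carrier H \<Longrightarrow> c \<in> carrier C \<Longrightarrow>
    aut C (hact C h c) = hact C (aut H h) (aut C c)"
  and comul_hact: "h \<in> carrier H \<Longrightarrow> c \<in> carrier C \<Longrightarrow> comul C (hact C h c) =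
    sw R H H (tensor R C C) (comul H h) (\<lambda>h1 h2. sw R C C (tensor R C C) (comul C c) (\<lambda>c1 c2.
      tens R C C (hact C h1 c1) (hact C h2 c2)))"
  using datum by (auto simp: monoidal_doi_datum_def doi_datum_def hom_module_coalgebra_def
      hom_left_module_def sw_def)

lemma hact_smult [simp]: "r \<in> carrier R \<Longrightarrow> h \<in> carrier H \<Longrightarrow> c \<in> carrier C \<Longrightarrow>
    hact C h (r \<odot>\<^bsub>C\<^esub> c) = r \<odot>\<^bsub>C\<^esub> hact C h c"
  by (rule linear_mapD(3)[OF bilinear_mapD(1)[OF bilinear_hact]])

lemma comul_smult [simp]: "r \<in> carrier R \<Longrightarrow> c \<in> carrier C \<Longrightarrow>
    comul C (r \<odot>\<^bsub>C\<^esub> c) = r \<odot>\<^bsub>tensor R C C\<^esub> comul C c"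
  by (rule linear_mapD(3)[OF C.self.linear_comul])

definition "sact a c = sw R A H C (hcoact A a) (\<lambda>a0 a1. counit A a0 \<odot>\<^bsub>C\<^esub> hact C (aut H a1) c)"

lemma self_dhh_eq: "self_dhh R H A C = dhh_make C (aut C) sact (comul C)"
  unfolding self_dhh_def sact_def[abs_def] sw_def by (rule refl)

lemma bilinear_sact: "bilinear_map R A C C sact"
  unfolding sact_def by simp

lemmas sact_closed [simp] = bilinear_mapD(3)[OF bilinear_sact]
lemmas linear_sact_right [simp] = bilinear_comp_right[OF bilinear_sact]

lemma sact_sact:
  assumes [simp]: "a \<in> carrier A" "b \<in> carrier A" "c \<in> carrier C"
  shows "sact (aut A a) (sact b c) = sact (a \<otimes>\<^bsub>A\<^esub> b) (aut C c)"
  unfolding sact_def by (simp add: hcoact_mult C.smult_commute)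

text \<open>Coassociativity of \<open>hcoact A\<close> puts \<open>aut H\<close> on the last leg.
  The \<open>aut H\<close> in \<open>sact\<close> supplies the same twist on the other leg, so both
  together match the comultiplication of the twisted element; the inverse automorphism left on the
  \<open>A\<close>-leg is invisible to \<open>counit A\<close>.\<close>

lemma comul_sact:
  assumes [simp]: "a \<in> carrier A" "c \<in> carrier C"
  shows "comul C (sact a c) = sw R A H (tensor R C C) (hcoact A a) (\<lambda>a0 a1.
         sw R C C (tensor R C C) (comul C c) (\<lambda>m0 m1. tens R C C (sact a0 m0) (hact C a1 m1)))"
  unfolding sact_def
  by (simp add: comul_hact Ac.sw_coassoc sw_push[where t = "comul C c"])

theorem self_dhh_module: "dhh_module R A C (self_dhh R H A C)"
  unfolding self_dhh_eq
  by (rule dhh_moduleI[where H = H and \<nu> = "aut_inv C"])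
    (simp_all add: C.hobj_axioms bilinear_sact sact_sact comul_sact C.comul_aut C.linear_aut
      C.self.linear_comul C.self.sw_coassoc, simp_all add: sact_def C.self.sw_counit)

end

lemma sw_smult [simp]:
  assumes "module R A" "module R B" "module R P" "r \<in> carrier R" "t \<in> carrier (tensor R A B)"
    "bilinear_map R A B P f"
  shows "sw R A B P (r \<odot>\<^bsub>tensor R A B\<^esub> t) f = r \<odot>\<^bsub>P\<^esub> sw R A B P t f"
  using assms(4,5) by (rule linear_mapD(3)[OF sw_linear[OF assms(1-3,6)]])

lemmas dhh_make_simps = dhh_make_sel tensor_dhh_make linear_map_dhh_make bilinear_map_dhh_make
  module_dhh_make sw_dhh_make

lemma rcomodI:
  assumes "hom_right_comodule R C M \<rho>" "hom_coalgebra R C"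
  shows "rcomod R C M \<rho>"
  using assms by unfold_locales (auto simp: hom_right_comodule_def hom_coalgebra_def)

lemma tdatumI:
  assumes "monoidal_doi_datum R H A C"
  shows "tdatum R H A C"
proof -
  have A: "hom_bialgebra R A" and C: "hom_bialgebra R C" and H: "hom_bialgebra R H"
    using assms by (auto simp: monoidal_doi_datum_def doi_datum_def hom_hopf_algebra_def)
  interpret A: hbialg R A by (rule hbialgI[OF A])
  interpret C: hbialg R C by (rule hbialgI[OF C])
  interpret H: hbialg R H by (rule hbialgI[OF H])
  show ?thesis
  proof (intro tdatum.intro tdatum_axioms.intro)
    show "halg R A" "hbialg R C" by unfold_locales
    show "linear_map R A (tensor R A H) (hcoact A)" "bilinear_map R H C C (hact C)"
      using assms by (auto simp: monoidal_doi_datum_def doi_datum_def hom_comodule_algebra_def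
          hom_right_comodule_def hom_module_coalgebra_def hom_left_module_def)
  qed (use assms in \<open>simp_all add: A.self.linear_comul A.comul_aut A.comul_mult
      monoidal_doi_datum_def sw_def cong del: sw_cong\<close>)
qed

lemma datumI:
  assumes "monoidal_doi_datum R H A C"
  shows "datum R H A C"
proof -
  have A: "hom_bialgebra R A" and H: "hom_bialgebra R H" and Ac: "hom_right_comodule R H A (hcoact A)"
    using assms by (auto simp: monoidal_doi_datum_def doi_datum_def hom_hopf_algebra_def
        hom_comodule_algebra_def)
  show ?thesis
    by (intro datum.intro tdatumI hbialgI rcomodI datum_axioms.intro assms A H Ac)
      (use H in \<open>auto simp: hom_bialgebra_def\<close>)
qed

section \<open>The canonical map from \<open>C\<close> to the cotensor product of \<open>C'\<close>
  with \<open>C\<close>\<close>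

locale dmor = C: datum R H A C + D: datum R H A D
  for R :: "('k, 'r) ring_scheme" and H :: "('k, 'h) hom_coalg" and A :: "('k, 'h, 'a) comod_alg"
    and C :: "('k, 'h, 'c) mod_coalg" and D :: "('k, 'h, 'd) mod_coalg" +
  fixes \<phi> :: "'c \<Rightarrow> 'd"
  assumes morphism: "monoidal_doi_morphism R H C D \<phi>"
begin

lemma linear_\<phi>: "linear_map R C D \<phi>"
  and \<phi>_aut [simp]: "c \<in> carrier C \<Longrightarrow> \<phi> (aut C c) = aut D (\<phi> c)"
  and \<phi>_mult [simp]: "c \<in> carrier C \<Longrightarrow> c' \<in> carrier C \<Longrightarrow> \<phi> (c \<otimes>\<^bsub>C\<^esub> c') = \<phi> c \<otimes>\<^bsub>D\<^esub> \<phi> c'"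
  and \<phi>_one [simp]: "\<phi> \<one>\<^bsub>C\<^esub> = \<one>\<^bsub>D\<^esub>"
  and \<phi>_comul: "c \<in> carrier C \<Longrightarrow>
    comul D (\<phi> c) = sw R C C (tensor R D D) (comul C c) (\<lambda>c1 c2. tens R D D (\<phi> c1) (\<phi> c2))"
  and \<phi>_counit [simp]: "c \<in> carrier C \<Longrightarrow> counit D (\<phi> c) = counit C c"
  and \<phi>_hact [simp]: "h \<in> carrier H \<Longrightarrow> c \<in> carrier C \<Longrightarrow> \<phi> (hact C h c) = hact D h (\<phi> c)"
  using morphism by (auto simp: monoidal_doi_morphism_def sw_def)

lemmas \<phi>_closed [simp] = linear_mapD(1)[OF linear_\<phi>]
lemmas linear_\<phi>_comp [simp] = linear_map_comp[OF _ linear_\<phi>]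
lemmas \<phi>_sw [simp] = linear_sw[OF _ _ C.C.module_M D.C.module_M linear_\<phi>]
lemmas \<phi>_smult [simp] = linear_mapD(3)[OF linear_\<phi>]

lemma \<phi>_aut_inv [simp]: "c \<in> carrier C \<Longrightarrow> \<phi> (aut_inv C c) = aut_inv D (\<phi> c)"
  by (rule D.C.aut_inv_eqI[symmetric]) (simp_all flip: \<phi>_aut)

lemma sw_\<phi>_comul [simp]:
  assumes "module R P" "bilinear_map R D D P F" "c \<in> carrier C"
  shows "sw R D D P (comul D (\<phi> c)) F = sw R C C P (comul C c) (\<lambda>c1 c2. F (\<phi> c1) (\<phi> c2))"
  using assms by (simp add: \<phi>_comul)

lemma \<phi>_sact: "a \<in> carrier A \<Longrightarrow> c \<in> carrier C \<Longrightarrow> \<phi> (C.sact a c) = D.sact a (\<phi> c)"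
  by (simp add: C.sact_def D.sact_def)

lemma dhhI: "dhh_module R A C M \<Longrightarrow> dhh R H A C M"
  by (intro dhh.intro dhh_axioms.intro C.A.halg_axioms C.C.hcoalg_axioms C.module_H
      C.linear_hcoact C.bilinear_hact)

lemma dhhI_D: "dhh_module R A D M \<Longrightarrow> dhh R H A D M"
  by (intro dhh.intro dhh_axioms.intro C.A.halg_axioms D.C.hcoalg_axioms C.module_H
      C.linear_hcoact D.bilinear_hact)

definition "can c = sw R C C (tensor R D C) (comul C c) (\<lambda>c1 c2. tens R D C (\<phi> c1) c2)"

lemma can_linear: "linear_map R C (tensor R D C) can"
  unfolding can_def by simp

lemmas can_closed [simp] = linear_mapD(1)[OF can_linear]
lemmas can_linear_comp [simp] = linear_map_comp[OF _ can_linear]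

lemma sw_can [simp]:
  assumes "module R P" "bilinear_map R D C P F" "c \<in> carrier C"
  shows "sw R D C P (can c) F = sw R C C P (comul C c) (\<lambda>c1 c2. F (\<phi> c1) c2)"
  using assms by (simp add: can_def)

lemma sw_comul_sact [simp]:
  assumes "module R P" "bilinear_map R C C P F" "a \<in> carrier A" "c \<in> carrier C"
  shows "sw R C C P (comul C (C.sact a c)) F = sw R A H P (hcoact A a) (\<lambda>a0 a1.
    sw R C C P (comul C c) (\<lambda>c1 c2. F (C.sact a0 c1) (hact C a1 c2)))"
  using assms by (simp add: C.comul_sact)

text \<open>The counit law produces an inverse automorphism; \<open>aut C\<close> undoes it, which
  makes this an exact left inverse of \<open>can\<close>.\<close>

definition "can' t = sw R D C C t (\<lambda>d c. counit D d \<odot>\<^bsub>C\<^esub> aut C c)"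

lemma can'_linear: "linear_map R (tensor R D C) C can'"
  unfolding can'_def by simp

lemmas can'_closed [simp] = linear_mapD(1)[OF can'_linear]
lemmas can'_linear_comp [simp] = linear_map_comp[OF _ can'_linear]

lemma can'_can [simp]: "c \<in> carrier C \<Longrightarrow> can' (can c) = c"
  unfolding can'_def by (simp add: C.C.counit_left)

abbreviation "selfC \<equiv> self_dhh R H A C"
abbreviation "selfD \<equiv> self_dhh R H A D"

lemma cotensor_self_iff: "t \<in> cotensor R C D \<phi> selfD \<longleftrightarrow>
   t \<in> carrier (tensor R D C) \<and>
    sw R D C (tensor3 R D D C) t (\<lambda>n c.
      sw R D D (tensor3 R D D C) (comul D n) (\<lambda>n0 n1. tens3 R D D C n0 n1 c)) =
    sw R D C (tensor3 R D D C) t (\<lambda>n c.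
      sw R C C (tensor3 R D D C) (comul C c) (\<lambda>c1 c2.
        tens3 R D D C (aut_inv D n) (\<phi> c1) (aut C c2)))"
  by (simp add: cotensor_def D.self_dhh_eq sw_def aut_inv_def cong del: sw_cong)

lemma can_cotensor: "c \<in> carrier C \<Longrightarrow> can c \<in> cotensor R C D \<phi> selfD"
  by (simp add: cotensor_self_iff C.C.self.sw_coassoc)

lemma can_can':
  assumes "t \<in> cotensor R C D \<phi> selfD"
  shows "can (can' t) = t"
proof -
  \<comment> \<open>\<open>L\<close> applies the counit to the first and \<open>aut D\<close> to the
    second factor. On the side of the cotensor equation that uses \<open>comul D\<close> this gives
    back \<open>t\<close>; the other side becomes \<open>can (can' t)\<close>.\<close>
  define L where "L u = sw R (tensor R D D) C (tensor R D C) u (\<lambda>s c.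
    sw R D D (tensor R D C) s (\<lambda>d e. counit D d \<odot>\<^bsub>tensor R D C\<^esub> tens R D C (aut D e) c))" for u
  have t [simp]: "t \<in> carrier (tensor R D C)" using assms by (simp add: cotensor_self_iff)
  have "t = sw R D C (tensor R D C) t (\<lambda>d c.
      sw R C C (tensor R D C) (comul C c) (\<lambda>c1 c2.
        counit D d \<odot>\<^bsub>tensor R D C\<^esub> tens R D C (aut D (\<phi> c1)) (aut C c2)))"
    using arg_cong[OF conjunct2[OF assms[unfolded cotensor_self_iff]], of L]
    unfolding L_def by (simp add: D.C.counit_left)
  also have "\<dots> = can (can' t)"
    unfolding can_def can'_def by (simp add: sw_push[where s = t])
  finally show ?thesis ..
qed

lemma self_gtransport:
  "gtransport R H A C D \<phi> selfC selfD can"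
proof (intro gtransport.intro gtransport_axioms.intro dhhI dhhI_D C.self_dhh_module D.self_dhh_module)
  show "linear_map R selfC (tensor R selfD C) can"
    by (simp add: C.self_dhh_eq D.self_dhh_eq can_linear)
  show "inj_on can (carrier selfC)"
    by (rule inj_on_inverseI[where g = can']) (simp add: C.self_dhh_eq)
  show "can ` carrier selfC = cotensor R C D \<phi> selfD"
  proof (intro equalityI subsetI)
    fix t assume t: "t \<in> cotensor R C D \<phi> selfD"
    then have "can' t \<in> carrier C" by (simp add: cotensor_self_iff)
    then show "t \<in> can ` carrier selfC"
      using can_can'[OF t] by (auto simp: C.self_dhh_eq intro!: image_eqI[of t can "can' t"])
  qed (auto simp: C.self_dhh_eq can_cotensor)
  fix e assume "e \<in> carrier selfC"
  then have e [simp]: "e \<in> carrier C" by (simp add: C.self_dhh_eq)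
  show "can (aut selfC e) = sw R selfD C (tensor R selfD C)
      (can e) (\<lambda>n c. tens R selfD C (aut selfD n) (aut C c))"
    unfolding C.self_dhh_eq D.self_dhh_eq dhh_make_simps by (simp add: can_def)
  show "sw R selfC C (tensor3 R selfD C C) (coact selfC e)
      (\<lambda>e0 e1. tens R (tensor R selfD C) C (can e0) e1) =
    sw R selfD C (tensor3 R selfD C C) (can e) (\<lambda>n c.
      sw R C C (tensor3 R selfD C C) (comul C c) (\<lambda>c1 c2.
        tens3 R selfD C C (aut_inv selfD n) c1 (aut C c2)))"
    unfolding C.self_dhh_eq D.self_dhh_eq dhh_make_simps
    by (simp add: aut_inv_dhh_make[where \<nu> = "aut_inv D"] can_def C.C.self.sw_coassoc)
  fix a assume a [simp]: "a \<in> carrier A"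
  show "can (act selfC a e) =
      sw R A H (tensor R selfD C) (hcoact A a) (\<lambda>a0 a1.
        sw R selfD C (tensor R selfD C) (can e) (\<lambda>n c.
          tens R selfD C (act selfD a0 n) (hact C a1 c)))"
    unfolding C.self_dhh_eq D.self_dhh_eq dhh_make_simps by (simp add: can_def \<phi>_sact)
next
  \<comment> \<open>\<open>can\<close> has a linear left inverse, so its injectivity survives
    tensoring with \<open>C\<close>.\<close>
  define K where "K u = sw R (tensor R D C) C (tensor R C C) u (\<lambda>y c. tens R C C (can' y) c)" for u
  have K: "\<forall>t\<in>carrier (tensor R C C).
      K (sw R C C (tensor3 R D C C) t (\<lambda>e c. tens R (tensor R D C) C (can e) c)) = t"
    unfolding K_def by (rule tensor_ext[where P = "tensor R C C"]) simp_all
  show "inj_on (\<lambda>t. sw R selfC C (tensor3 R selfD C C) t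
      (\<lambda>e c. tens R (tensor R selfD C) C (can e) c))
    (carrier (tensor R selfC C))"
    unfolding C.self_dhh_eq D.self_dhh_eq dhh_make_simps by (rule inj_on_inverseI[where g = K]) (use K in simp)
qed

end

section \<open>The map \<open>\<Theta>\<close> and its inverse\<close>

text \<open>
  \<open>\<Theta>\<close> is needed both for \<open>\<psi> = id\<close> and for \<open>\<psi> = \<phi>\<close>, hence with a second algebra \<open>B\<close>.
\<close>

locale theta = rcomod R C M \<rho> + Cb: hbialg R C + B: halg R B
  for R :: "('k, 'r) ring_scheme" and C :: "('k, 'c, 'y) hom_coalg_scheme"
    and M :: "('k, 'm, 'z) hom_mod_scheme" and \<rho> :: "'m \<Rightarrow> ('k, 'm, 'c) tensor"
    and B :: "('k, 'b, 'w) hom_mod_scheme" +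
  fixes \<psi> :: "'c \<Rightarrow> 'b" and S :: "'c \<Rightarrow> 'c"
  assumes linear_\<psi>: "linear_map R C B \<psi>"
    and \<psi>_aut [simp]: "c \<in> carrier C \<Longrightarrow> \<psi> (aut C c) = aut B (\<psi> c)"
    and \<psi>_mult [simp]: "c \<in> carrier C \<Longrightarrow> c' \<in> carrier C \<Longrightarrow> \<psi> (c \<otimes>\<^bsub>C\<^esub> c') = \<psi> c \<otimes>\<^bsub>B\<^esub> \<psi> c'"
    and \<psi>_one [simp]: "\<psi> \<one>\<^bsub>C\<^esub> = \<one>\<^bsub>B\<^esub>"
    and antipode: "is_antipode R C S"
begin

lemmas \<psi>_closed [simp] = linear_mapD(1)[OF linear_\<psi>]
lemmas linear_\<psi>_comp [simp] = linear_map_comp[OF _ linear_\<psi>]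

lemma linear_S: "linear_map R C C S"
  and S_aut [simp]: "c \<in> carrier C \<Longrightarrow> S (aut C c) = aut C (S c)"
  and S_left: "c \<in> carrier C \<Longrightarrow> sw R C C C (comul C c) (\<lambda>c1 c2. S c1 \<otimes>\<^bsub>C\<^esub> c2) = counit C c \<odot>\<^bsub>C\<^esub> \<one>\<^bsub>C\<^esub>"
  and S_right: "c \<in> carrier C \<Longrightarrow> sw R C C C (comul C c) (\<lambda>c1 c2. c1 \<otimes>\<^bsub>C\<^esub> S c2) = counit C c \<odot>\<^bsub>C\<^esub> \<one>\<^bsub>C\<^esub>"
  using antipode by (auto simp: is_antipode_def sw_def)

lemmas S_closed [simp] = linear_mapD(1)[OF linear_S]
lemmas linear_S_comp [simp] = linear_map_comp[OF _ linear_S]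

lemma sw_S_left:
  assumes "module R P" "linear_map R C P F" "c \<in> carrier C"
  shows "sw R C C P (comul C c) (\<lambda>c1 c2. F (S c1 \<otimes>\<^bsub>C\<^esub> c2)) = counit C c \<odot>\<^bsub>P\<^esub> F \<one>\<^bsub>C\<^esub>"
proof -
  have "F (sw R C C C (comul C c) (\<lambda>c1 c2. S c1 \<otimes>\<^bsub>C\<^esub> c2)) = counit C c \<odot>\<^bsub>P\<^esub> F \<one>\<^bsub>C\<^esub>"
    using assms by (simp add: S_left linear_mapD(3)[OF assms(2)])
  moreover have "F (sw R C C C (comul C c) (\<lambda>c1 c2. S c1 \<otimes>\<^bsub>C\<^esub> c2)) =
      sw R C C P (comul C c) (\<lambda>c1 c2. F (S c1 \<otimes>\<^bsub>C\<^esub> c2))"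
    using assms by (intro linear_sw) simp_all
  ultimately show ?thesis by simp
qed

lemma sw_S_right:
  assumes "module R P" "linear_map R C P F" "c \<in> carrier C"
  shows "sw R C C P (comul C c) (\<lambda>c1 c2. F (c1 \<otimes>\<^bsub>C\<^esub> S c2)) = counit C c \<odot>\<^bsub>P\<^esub> F \<one>\<^bsub>C\<^esub>"
proof -
  have "F (sw R C C C (comul C c) (\<lambda>c1 c2. c1 \<otimes>\<^bsub>C\<^esub> S c2)) = counit C c \<odot>\<^bsub>P\<^esub> F \<one>\<^bsub>C\<^esub>"
    using assms by (simp add: S_right linear_mapD(3)[OF assms(2)])
  moreover have "F (sw R C C C (comul C c) (\<lambda>c1 c2. c1 \<otimes>\<^bsub>C\<^esub> S c2)) =
      sw R C C P (comul C c) (\<lambda>c1 c2. F (c1 \<otimes>\<^bsub>C\<^esub> S c2))"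
    using assms by (intro linear_sw) simp_all
  ultimately show ?thesis by simp
qed

text \<open>Hom-associativity with the twists that occur in \<open>\<Psi>\<close> after
  \<open>\<Theta>\<close>: they are such that \<open>x\<close> and \<open>y\<close> reappear as one
  product, to which the antipode law applies. The next lemma does the same for the other
  composite.\<close>

lemma aut_inv_twice_mult:
  assumes [simp]: "x \<in> carrier B" "y \<in> carrier B" "b \<in> carrier B"
  shows "x \<otimes>\<^bsub>B\<^esub> (aut_inv B y \<otimes>\<^bsub>B\<^esub> aut_inv B (aut_inv B b)) = aut_inv B (x \<otimes>\<^bsub>B\<^esub> y) \<otimes>\<^bsub>B\<^esub> aut_inv B b"
  using B.hom_assoc[of "aut_inv B x" "aut_inv B y" "aut_inv B (aut_inv B b)"] by simp

lemma aut_twice_mult: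
  assumes [simp]: "x \<in> carrier B" "y \<in> carrier B" "b \<in> carrier B"
  shows "aut B (aut B x) \<otimes>\<^bsub>B\<^esub> (aut B y \<otimes>\<^bsub>B\<^esub> aut_inv B (aut_inv B b)) = aut B (x \<otimes>\<^bsub>B\<^esub> y) \<otimes>\<^bsub>B\<^esub> aut_inv B b"
  using B.hom_assoc[of "aut B x" "aut B y" "aut_inv B (aut_inv B b)"] by simp

text \<open>After regrouping, the sum contains the antipode product, which is the counit times
  \<open>1\<close>; the unit law then turns \<open>1\<close> times \<open>aut_inv B b\<close> into
  \<open>b\<close>.\<close>

lemma cancel_left:
  assumes [simp]: "module R Q" "c \<in> carrier C" "b \<in> carrier B" "m \<in> carrier M" "q \<in> carrier Q"
  shows "sw R C C (tensor R M (tensor R Q B)) (comul C c) (\<lambda>x y. tens R M (tensor R Q B) m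
      (tens R Q B q (\<psi> (S x) \<otimes>\<^bsub>B\<^esub> (aut_inv B (\<psi> y) \<otimes>\<^bsub>B\<^esub> aut_inv B (aut_inv B b))))) =
    counit C c \<odot>\<^bsub>tensor R M (tensor R Q B)\<^esub> tens R M (tensor R Q B) m (tens R Q B q b)" (is "?l = ?r")
proof -
  have "?l =
    sw R C C (tensor R M (tensor R Q B)) (comul C c) (\<lambda>x y. tens R M (tensor R Q B) m
      (tens R Q B q (aut_inv B (\<psi> (S x \<otimes>\<^bsub>C\<^esub> y)) \<otimes>\<^bsub>B\<^esub> aut_inv B b)))"
    by (intro sw_cong refl) (simp_all add: aut_inv_twice_mult del: B.aut_inv_mult)
  also have "\<dots> = ?r"
    by (subst sw_S_left[where F = "\<lambda>z. tens R M (tensor R Q B) m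
      (tens R Q B q (aut_inv B (\<psi> z) \<otimes>\<^bsub>B\<^esub> aut_inv B b))"]) simp_all
  finally show ?thesis .
qed

lemma cancel_right:
  assumes [simp]: "module R Q" "c \<in> carrier C" "b \<in> carrier B" "m \<in> carrier M" "q \<in> carrier Q"
  shows "sw R C C (tensor3 R M Q B) (comul C c) (\<lambda>x y. tens3 R M Q B m q
      (aut B (aut B (\<psi> x)) \<otimes>\<^bsub>B\<^esub> (aut B (\<psi> (S y)) \<otimes>\<^bsub>B\<^esub> aut_inv B (aut_inv B b)))) =
    counit C c \<odot>\<^bsub>tensor3 R M Q B\<^esub> tens3 R M Q B m q b" (is "?l = ?r")
proof -
  have "?l =
    sw R C C (tensor3 R M Q B) (comul C c) (\<lambda>x y. tens3 R M Q B m q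
      (aut B (\<psi> (x \<otimes>\<^bsub>C\<^esub> S y)) \<otimes>\<^bsub>B\<^esub> aut_inv B b))"
    by (intro sw_cong refl) (simp_all add: aut_twice_mult del: B.aut_mult)
  also have "\<dots> = ?r"
    by (subst sw_S_right[where F = "\<lambda>z. tens3 R M Q B m q (aut B (\<psi> z) \<otimes>\<^bsub>B\<^esub> aut_inv B b)"]) simp_all
  finally show ?thesis .
qed

text \<open>\<open>Q\<close> is a parameter because the map is applied to \<open>N\<close> as well
  as to \<open>N \<otimes> D\<close>.\<close>

definition \<Theta> :: "('k, 'q, 'v) module_scheme \<Rightarrow> ('k, 'm, ('k, 'q, 'b) tensor) tensor \<Rightarrow>
    ('k, ('k, 'm, 'q) tensor, 'b) tensor"
  where "\<Theta> Q t = sw R M (tensor R Q B) (tensor3 R M Q B) t (\<lambda>m x.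
    sw R Q B (tensor3 R M Q B) x (\<lambda>q b.
      sw R M C (tensor3 R M Q B) (\<rho> m) (\<lambda>m0 m1. tens3 R M Q B m0 q (\<psi> m1 \<otimes>\<^bsub>B\<^esub> b))))"

text \<open>The powers are forced. Coassociativity and the counit law each contribute one inverse
  automorphism of \<open>M\<close>, whence the two \<open>aut M\<close>. Two
  \<open>aut_inv B\<close> is the power at which Hom-associativity brings \<open>S m1\<close> and
  the neighbouring leg of the coaction to the same twist, so that they cancel, and at which the unit
  law returns \<open>b\<close> itself.\<close>

definition \<Psi> :: "('k, 'q, 'v) module_scheme \<Rightarrow> ('k, ('k, 'm, 'q) tensor, 'b) tensor \<Rightarrow>
    ('k, 'm, ('k, 'q, 'b) tensor) tensor"
  where "\<Psi> Q t = sw R (tensor R M Q) B (tensor R M (tensor R Q B)) t (\<lambda>p b.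
    sw R M Q (tensor R M (tensor R Q B)) p (\<lambda>m q.
      sw R M C (tensor R M (tensor R Q B)) (\<rho> m) (\<lambda>m0 m1.
        tens R M (tensor R Q B) (aut M (aut M m0))
          (tens R Q B q (\<psi> (S m1) \<otimes>\<^bsub>B\<^esub> aut_inv B (aut_inv B b))))))"

context
  fixes Q :: "('k, 'q, 'v) module_scheme"
  assumes Q [simp]: "module R Q"
begin

lemma \<Theta>_linear: "linear_map R (tensor R M (tensor R Q B)) (tensor3 R M Q B) (\<Theta> Q)"
  unfolding \<Theta>_def by simp

lemma \<Psi>_linear: "linear_map R (tensor3 R M Q B) (tensor R M (tensor R Q B)) (\<Psi> Q)"
  unfolding \<Psi>_def by simp

lemma \<Theta>_tens: "m \<in> carrier M \<Longrightarrow> x \<in> carrier (tensor R Q B) \<Longrightarrow>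
    \<Theta> Q (tens R M (tensor R Q B) m x) = sw R Q B (tensor3 R M Q B) x (\<lambda>q b.
      sw R M C (tensor3 R M Q B) (\<rho> m) (\<lambda>m0 m1. tens3 R M Q B m0 q (\<psi> m1 \<otimes>\<^bsub>B\<^esub> b)))"
  unfolding \<Theta>_def by simp

lemma \<Psi>_tens: "m \<in> carrier M \<Longrightarrow> q \<in> carrier Q \<Longrightarrow> b \<in> carrier B \<Longrightarrow>
    \<Psi> Q (tens3 R M Q B m q b) = sw R M C (tensor R M (tensor R Q B)) (\<rho> m) (\<lambda>m0 m1.
        tens R M (tensor R Q B) (aut M (aut M m0))
          (tens R Q B q (\<psi> (S m1) \<otimes>\<^bsub>B\<^esub> aut_inv B (aut_inv B b))))"
  unfolding \<Psi>_def by simp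

lemmas \<Theta>_closed [simp] = linear_mapD(1)[OF \<Theta>_linear]
lemmas \<Psi>_closed [simp] = linear_mapD(1)[OF \<Psi>_linear]
lemmas \<Theta>_linear_comp [simp] = linear_map_comp[OF _ \<Theta>_linear]
lemmas \<Psi>_linear_comp [simp] = linear_map_comp[OF _ \<Psi>_linear]

lemma \<Theta>_sw [simp]:
  assumes "module R X" "module R Y" "t \<in> carrier (tensor R X Y)"
    "\<And>a b. a \<in> carrier X \<Longrightarrow> b \<in> carrier Y \<Longrightarrow> f a b \<in> carrier (tensor R M (tensor R Q B))"
  shows "\<Theta> Q (sw R X Y (tensor R M (tensor R Q B)) t f) = sw R X Y (tensor3 R M Q B) t (\<lambda>a b. \<Theta> Q (f a b))"
  using assms by (intro linear_sw \<Theta>_linear) simp_all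

lemma \<Psi>_sw [simp]:
  assumes "module R X" "module R Y" "t \<in> carrier (tensor R X Y)"
    "\<And>a b. a \<in> carrier X \<Longrightarrow> b \<in> carrier Y \<Longrightarrow> f a b \<in> carrier (tensor3 R M Q B)"
  shows "\<Psi> Q (sw R X Y (tensor3 R M Q B) t f) = sw R X Y (tensor R M (tensor R Q B)) t (\<lambda>a b. \<Psi> Q (f a b))"
  using assms by (intro linear_sw \<Psi>_linear) simp_all

lemma \<Psi>_\<Theta>: "\<forall>t\<in>carrier (tensor R M (tensor R Q B)). \<Psi> Q (\<Theta> Q t) = t"
proof (rule tensor_ext[where P = "tensor R M (tensor R Q B)"])
  fix m x assume m [simp]: "m \<in> carrier M" and x: "x \<in> carrier (tensor R Q B)"
  have "\<forall>x\<in>carrier (tensor R Q B).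
      \<Psi> Q (\<Theta> Q (tens R M (tensor R Q B) m x)) = tens R M (tensor R Q B) m x"
  proof (rule tensor_ext[where P = "tensor R M (tensor R Q B)"])
    fix q b assume [simp]: "q \<in> carrier Q" "b \<in> carrier B"
    show "\<Psi> Q (\<Theta> Q (tens R M (tensor R Q B) m (tens R Q B q b))) =
        tens R M (tensor R Q B) m (tens R Q B q b)"
      by (simp add: \<Theta>_tens \<Psi>_tens sw_coassoc cancel_left sw_counit)
  qed simp_all
  then show "\<Psi> Q (\<Theta> Q (tens R M (tensor R Q B) m x)) = tens R M (tensor R Q B) m x"
    using x by blast
qed simp_all

lemma \<Theta>_\<Psi>: "\<forall>t\<in>carrier (tensor3 R M Q B). \<Theta> Q (\<Psi> Q t) = t"
proof (rule tensor_ext[where P = "tensor3 R M Q B"])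
  fix p b assume p: "p \<in> carrier (tensor R M Q)" and b [simp]: "b \<in> carrier B"
  have "\<forall>p\<in>carrier (tensor R M Q). \<Theta> Q (\<Psi> Q (tens R (tensor R M Q) B p b)) = tens R (tensor R M Q) B p b"
  proof (rule tensor_ext[where P = "tensor3 R M Q B"])
    fix m q assume [simp]: "m \<in> carrier M" "q \<in> carrier Q"
    show "\<Theta> Q (\<Psi> Q (tens3 R M Q B m q b)) = tens3 R M Q B m q b"
      by (simp add: \<Theta>_tens \<Psi>_tens sw_coassoc cancel_right sw_counit)
  qed simp_all
  then show "\<Theta> Q (\<Psi> Q (tens R (tensor R M Q) B p b)) = tens R (tensor R M Q) B p b"
    using p by blast
qed simp_all

end

end

section \<open>The functor \<open>F\<close> on objects\<close>

context dmor
begin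

text \<open>Compatibility of \<open>\<phi>\<close> with comultiplication, counit and automorphisms
  gives the comodule axioms; its compatibility with \<open>hact\<close> links the new coaction to
  the action.\<close>

lemma induced_F_module:
  assumes "dhh_module R A C M"
  shows "dhh_module R A D (induced_F R D \<phi> M)"
proof -
  interpret M: dhh R H A C M by (rule dhhI[OF assms])
  define f where "f m = sw R M C (tensor R M D) (coact M m) (\<lambda>m0 m1. tens R M D m0 (\<phi> m1))" for m
  have eq: "induced_F R D \<phi> M = dhh_make M (aut M) (act M) f"
    unfolding induced_F_def f_def[abs_def] sw_def by (rule refl)
  have lin: "linear_map R M (tensor R M D) f" unfolding f_def by simp
  note [simp] = linear_map_comp[OF _ lin] linear_mapD(1)[OF lin]
  have sw_f [simp]: "sw R M D P (f m) F = sw R M C P (coact M m) (\<lambda>m0 m1. F m0 (\<phi> m1))"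
    if "module R P" "bilinear_map R M D P F" "m \<in> carrier M" for P :: "('k, 'x, 'y) module_scheme" and m F
    unfolding f_def using that by simp
  show ?thesis
    unfolding eq
    by (rule dhh_moduleI[where H = H and \<nu> = "aut_inv M"])
      (simp_all add: D.C.hobj_axioms M.M.linear_aut M.bilinear_act M.act_act lin
        sw_f M.sw_coassoc, simp_all add: f_def M.sw_counit)
qed

end

section \<open>Flatness\<close>

text \<open>
  Let \<open>I\<close> be the image of \<open>d = d1 - d2\<close>.  Flatness embeds \<open>M \<otimes> I\<close> into \<open>M \<otimes> Z\<close>, and
  \<open>m \<otimes> d y \<mapsto> [m \<otimes> y]\<close> is a well-defined map from \<open>M \<otimes> I\<close> to \<open>(M \<otimes> Y) / (M \<otimes> K)\<close>; so the kernel of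
  \<open>M \<otimes> d\<close> vanishes in that quotient.
\<close>

lemma flat_equalizer:
  fixes R :: "('k, 'r) ring_scheme" and M :: "('k, 'm, 'w) module_scheme"
    and Y :: "('k, 'y) module" and Z :: "('k, 'z) module"
  assumes flat: "flat_module TYPE('y) R M" "flat_module TYPE('z) R M"
    and Y [simp]: "module R Y" and Z [simp]: "module R Z"
    and d: "linear_map R Y Z d1" "linear_map R Y Z d2"
  defines "K \<equiv> Y\<lparr>carrier := {y \<in> carrier Y. d1 y = d2 y}\<rparr>"
  shows "module R K"
    and "inj_on (\<lambda>t. sw R M K (tensor R M Y) t (\<lambda>m y. tens R M Y m y)) (carrier (tensor R M K))"
    and "(\<lambda>t. sw R M K (tensor R M Y) t (\<lambda>m y. tens R M Y m y)) ` carrier (tensor R M K) =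
      {t \<in> carrier (tensor R M Y).
        sw R M Y (tensor R M Z) t (\<lambda>m y. tens R M Z m (d1 y)) =
        sw R M Y (tensor R M Z) t (\<lambda>m y. tens R M Z m (d2 y))}"
proof -
  have M [simp]: "module R M" using flat by (simp add: flat_module_def)
  interpret base_ring R .
  interpret Y: module R Y by fact
  interpret Z: module R Z by fact
  note [simp] = linear_map_comp[OF _ d(1)] linear_map_comp[OF _ d(2)]
    linear_mapD(1)[OF d(1)] linear_mapD(1)[OF d(2)]
  show K [simp]: "module R K"
    unfolding K_def by (rule submodule.submodule_is_module[OF equalizer_submodule[OF Y Z d] Y])
  have K_carrier: "carrier K = {y \<in> carrier Y. d1 y = d2 y}" by (simp add: K_def)
  have K_incl [simp]: "linear_map R K Y (\<lambda>y. y)" "y \<in> carrier K \<Longrightarrow> y \<in> carrier Y" for y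
    by (auto simp: K_def linear_map_def)
  have flatD: "inj_on (\<lambda>t. sw R M X (tensor R M X') t (\<lambda>m x. tens R M X' m (f x))) (carrier (tensor R M X))"
    if "flat_module TYPE('x) R M" "module R X" "module R X'" "linear_map R X X' f" "inj_on f (carrier X)"
    for X X' :: "('k, 'x) module" and f
    using that by (simp add: flat_module_def sw_def)
  define incl where "incl t = sw R M K (tensor R M Y) t (\<lambda>m y. tens R M Y m y)" for t
  have incl_lin: "linear_map R (tensor R M K) (tensor R M Y) incl"
    unfolding incl_def by simp
  show "inj_on (\<lambda>t. sw R M K (tensor R M Y) t (\<lambda>m y. tens R M Y m y)) (carrier (tensor R M K))"
    by (rule flatD[OF flat(1)]) simp_all
  define d where "d y = d1 y \<ominus>\<^bsub>Z\<^esub> d2 y" for y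
  have d_lin: "linear_map R Y Z d" unfolding d_def by (intro linear_map_sub Z assms)
  note [simp] = linear_map_comp[OF _ d_lin] linear_mapD(1)[OF d_lin]
  define I where "I = Z\<lparr>carrier := d ` carrier Y\<rparr>"
  have I [simp]: "module R I"
    unfolding I_def by (rule submodule.submodule_is_module[OF image_submodule[OF Y Z d_lin] Z])
  have I_incl [simp]: "linear_map R I Z (\<lambda>y. y)" "i \<in> carrier I \<Longrightarrow> i \<in> carrier Z" for i
    by (auto simp: I_def linear_map_def)
  have d_I: "linear_map R Y I d"
    using d_lin by (auto simp: I_def linear_map_def)
  note [simp] = linear_map_comp[OF _ d_I] linear_mapD(1)[OF d_I]
  define W where "W = incl ` carrier (tensor R M K)"
  have W: "submodule W R (tensor R M Y)"
    unfolding W_def by (rule image_submodule[OF _ _ incl_lin]) simp_all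
  note Q = quotient_module_module[OF tensor_module[OF M Y] W]
  let ?Q = "quotient_module R (tensor R M Y) W"
  let ?p = "\<lambda>x. W +>\<^bsub>tensor R M Y\<^esub> x"
  note [simp] = Q(1) linear_map_comp[OF _ Q(2)] linear_mapD(1)[OF Q(2)]
  define s where "s i = (SOME y. y \<in> carrier Y \<and> d y = i)" for i
  have s: "s i \<in> carrier Y" "d (s i) = i" if "i \<in> carrier I" for i
    using that someI_ex[of "\<lambda>y. y \<in> carrier Y \<and> d y = i"] by (auto simp: I_def s_def)
  define b where "b m i = ?p (tens R M Y m (s i))" for m i
  \<comment> \<open>\<open>s\<close> is a mere choice of preimages, in general not linear. Two
    preimages of the same element differ by an element of \<open>K\<close>, and tensors with such an
    element lie in \<open>W\<close>; so modulo \<open>W\<close> the choice is immaterial, and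
    linearity of \<open>b\<close> can be read off from that of \<open>d\<close>.\<close>
  have b: "?p (tens R M Y m y) = b m (d y)" if "m \<in> carrier M" "y \<in> carrier Y" for m y
  proof -
    have sy: "s (d y) \<in> carrier Y" "d (s (d y)) = d y"
      using s[of "d y"] linear_mapD(1)[OF d_I that(2)] by auto
    have "d (y \<ominus>\<^bsub>Y\<^esub> s (d y)) = \<zero>\<^bsub>Z\<^esub>"
      using that sy linear_map_diff[OF Y Z d_lin that(2) sy(1)]
      by (simp add: a_minus_def Z.r_neg)
    moreover have mem: "y \<ominus>\<^bsub>Y\<^esub> s (d y) \<in> carrier Y" using that sy by simp
    ultimately have "d1 (y \<ominus>\<^bsub>Y\<^esub> s (d y)) = d2 (y \<ominus>\<^bsub>Y\<^esub> s (d y))"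
      unfolding d_def[of "y \<ominus>\<^bsub>Y\<^esub> s (d y)"] a_minus_def[of Z]
      using linear_mapD(1)[OF assms(5) mem] linear_mapD(1)[OF assms(6) mem]
      by (metis Z.a_inv_closed Z.minus_equality Z.minus_minus)
    then have "y \<ominus>\<^bsub>Y\<^esub> s (d y) \<in> carrier K"
      using mem unfolding K_carrier by blast
    then have "incl (tens R M K m (y \<ominus>\<^bsub>Y\<^esub> s (d y))) = tens R M Y m (y \<ominus>\<^bsub>Y\<^esub> s (d y))"
      "tens R M K m (y \<ominus>\<^bsub>Y\<^esub> s (d y)) \<in> carrier (tensor R M K)"
      using that(1) unfolding incl_def by simp_all
    then have "tens R M Y m (y \<ominus>\<^bsub>Y\<^esub> s (d y)) \<in> W" unfolding W_def by force
    then have "tens R M Y m y \<ominus>\<^bsub>tensor R M Y\<^esub> tens R M Y m (s (d y)) \<in> W"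
      using linear_map_diff[OF Y tensor_module[OF M Y] tens_linear_right[OF M Y that(1)] that(2) sy(1)]
      by simp
    then show ?thesis
      unfolding b_def using that sy by (simp add: Q(4))
  qed
  have b_bil: "bilinear_map R M I ?Q b"
  proof (rule bilinear_mapI)
    fix i assume i: "i \<in> carrier I"
    then show "linear_map R M ?Q (\<lambda>m. b m i)" unfolding b_def using s[OF i] by simp
  next
    fix m assume m: "m \<in> carrier M"
    have lin: "linear_map R Y ?Q (\<lambda>y. b m (d y))"
      by (rule linear_map_cong[of Y "\<lambda>y. ?p (tens R M Y m y)"])
        (use m b Y.abelian_monoid_axioms in simp_all)
    show "linear_map R I ?Q (b m)"
    proof (rule linear_mapI)
      fix i assume "i \<in> carrier I"
      then obtain y where y: "y \<in> carrier Y" "i = d y" by (auto simp: I_def)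
      then show "b m i \<in> carrier ?Q" using linear_mapD(1)[OF lin] by simp
      fix i' assume "i' \<in> carrier I"
      then obtain y' where y': "y' \<in> carrier Y" "i' = d y'" by (auto simp: I_def)
      show "b m (i \<oplus>\<^bsub>I\<^esub> i') = b m i \<oplus>\<^bsub>?Q\<^esub> b m i'"
        using linear_mapD(2)[OF lin y(1) y'(1)] linear_mapD(2)[OF d_I y(1) y'(1)] y y' by simp
    next
      fix r i assume r: "r \<in> carrier R" and "i \<in> carrier I"
      then obtain y where y: "y \<in> carrier Y" "i = d y" by (auto simp: I_def)
      show "b m (r \<odot>\<^bsub>I\<^esub> i) = r \<odot>\<^bsub>?Q\<^esub> b m i"
        using linear_mapD(3)[OF lin r y(1)] linear_mapD(3)[OF d_I r y(1)] y by simp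
    qed
  qed
  let ?e1 = "\<lambda>t. sw R M Y (tensor R M Z) t (\<lambda>m y. tens R M Z m (d1 y))"
  let ?e2 = "\<lambda>t. sw R M Y (tensor R M Z) t (\<lambda>m y. tens R M Z m (d2 y))"
  let ?e = "\<lambda>t. sw R M Y (tensor R M Z) t (\<lambda>m y. tens R M Z m (d y))"
  have sub: "?e t = ?e1 t \<ominus>\<^bsub>tensor R M Z\<^esub> ?e2 t"
    if "t \<in> carrier (tensor R M Y)" for t
  proof -
    have "\<forall>t\<in>carrier (tensor R M Y). ?e t = ?e1 t \<ominus>\<^bsub>tensor R M Z\<^esub> ?e2 t"
    proof (rule tensor_ext[where P = "tensor R M Z"])
      show "linear_map R (tensor R M Y) (tensor R M Z) (\<lambda>t.
        ?e1 t \<ominus>\<^bsub>tensor R M Z\<^esub>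
        ?e2 t)"
        by (intro linear_map_sub) simp_all
      fix m y assume "m \<in> carrier M" "y \<in> carrier Y"
      then show "?e (tens R M Y m y) =
        ?e1 (tens R M Y m y) \<ominus>\<^bsub>tensor R M Z\<^esub>
        ?e2 (tens R M Y m y)"
        using linear_map_diff[OF Z tensor_module[OF M Z] tens_linear_right[OF M Z], of m "d1 y" "d2 y"]
        by (simp flip: d_def)
    qed simp_all
    then show ?thesis using that by blast
  qed
  show "(\<lambda>t. sw R M K (tensor R M Y) t (\<lambda>m y. tens R M Y m y)) ` carrier (tensor R M K) =
      {t \<in> carrier (tensor R M Y).
        ?e1 t =
        ?e2 t}"
    unfolding incl_def[abs_def, symmetric]
  proof (intro equalityI subsetI)
    fix t assume "t \<in> incl ` carrier (tensor R M K)"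
    then obtain u where u: "u \<in> carrier (tensor R M K)" "t = incl u" by auto
    have "\<forall>u\<in>carrier (tensor R M K).
        ?e1 (incl u) =
        ?e2 (incl u)"
      unfolding incl_def
    proof (rule tensor_ext[where P = "tensor R M Z"])
      fix m y assume "m \<in> carrier M" "y \<in> carrier K"
      moreover from this have "d1 y = d2 y" unfolding K_carrier by blast
      ultimately show "sw R M Y (tensor R M Z) (sw R M K (tensor R M Y) (tens R M K m y) (tens R M Y))
          (\<lambda>m y. tens R M Z m (d1 y)) =
        sw R M Y (tensor R M Z) (sw R M K (tensor R M Y) (tens R M K m y) (tens R M Y))
          (\<lambda>m y. tens R M Z m (d2 y))"
        by simp
    qed simp_all
    with u show "t \<in> {t \<in> carrier (tensor R M Y).
        ?e1 t =
        ?e2 t}"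
      using linear_mapD(1)[OF incl_lin] by simp
  next
    fix t assume "t \<in> {t \<in> carrier (tensor R M Y).
        ?e1 t =
        ?e2 t}"
    then have t [simp]: "t \<in> carrier (tensor R M Y)"
      and eq: "?e1 t =
        ?e2 t" by auto
    define e where "e = sw R M Y (tensor R M I) t (\<lambda>m y. tens R M I m (d y))"
    have e [simp]: "e \<in> carrier (tensor R M I)" unfolding e_def by simp
    interpret TZ: module R "tensor R M Z" by simp
    interpret TI: module R "tensor R M I" by simp
    define i where "i u = sw R M I (tensor R M Z) u (\<lambda>m y. tens R M Z m y)" for u
    have i_lin: "linear_map R (tensor R M I) (tensor R M Z) i" unfolding i_def by simp
    \<comment> \<open>The second use of flatness. It is applied to the inclusion of the image of
      \<open>d\<close>, since \<open>d\<close> itself need not be injective.\<close>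
    have i_inj: "inj_on i (carrier (tensor R M I))"
      unfolding i_def by (rule flatD[OF flat(2)]) simp_all
    have "i e = ?e t"
      unfolding i_def e_def by simp
    also have "\<dots> = \<zero>\<^bsub>tensor R M Z\<^esub>"
      unfolding sub[OF t] eq by (simp add: a_minus_def TZ.r_neg)
    also have "\<dots> = i \<zero>\<^bsub>tensor R M I\<^esub>"
      by (rule linear_map_zero[OF _ _ i_lin, symmetric]) simp_all
    finally have e0: "e = \<zero>\<^bsub>tensor R M I\<^esub>"
      by (rule inj_onD[OF i_inj]) simp_all
    \<comment> \<open>The class of \<open>t\<close> modulo \<open>W\<close> is recovered from the
      image of \<open>t\<close> in \<open>M \<otimes> I\<close>; hence it vanishes as soon as that
      image does.\<close>
    have lift: "\<forall>t\<in>carrier (tensor R M Y).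
        sw R M I ?Q (sw R M Y (tensor R M I) t (\<lambda>m y. tens R M I m (d y))) b = ?p t"
      by (rule tensor_ext[where P = ?Q]) (simp_all add: b b_bil Q(2) linear_sw_left[OF M I Q(1) _ b_bil])
    have "?p t = sw R M I ?Q e b" using lift t unfolding e_def by simp
    also have "\<dots> = \<zero>\<^bsub>?Q\<^esub>"
      unfolding e0 by (rule linear_map_zero[OF _ _ sw_linear[OF M I Q(1) b_bil]]) simp_all
    finally show "t \<in> incl ` carrier (tensor R M K)"
      using Q(5)[OF t] by (simp add: W_def)
  qed
qed

lemma tensor3_ext:
  assumes [simp]: "module R X" "module R Y" "module R Z" "module R P"
    and lin: "linear_map R (tensor3 R X Y Z) P f" "linear_map R (tensor3 R X Y Z) P g"
    and eq: "\<And>x y z. x \<in> carrier X \<Longrightarrow> y \<in> carrier Y \<Longrightarrow> z \<in> carrier Z \<Longrightarrow>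
      f (tens3 R X Y Z x y z) = g (tens3 R X Y Z x y z)"
  shows "\<forall>t\<in>carrier (tensor3 R X Y Z). f t = g t"
proof (rule tensor_ext[OF _ _ _ lin])
  fix p z assume p: "p \<in> carrier (tensor R X Y)" and z [simp]: "z \<in> carrier Z"
  note [simp] = linear_map_comp[OF _ lin(1)] linear_map_comp[OF _ lin(2)]
  have "\<forall>p\<in>carrier (tensor R X Y). f (tens R (tensor R X Y) Z p z) = g (tens R (tensor R X Y) Z p z)"
    by (rule tensor_ext[where P = P]) (simp_all add: eq)
  then show "f (tens R (tensor R X Y) Z p z) = g (tens R (tensor R X Y) Z p z)"
    using p by blast
qed simp_all

lemma tensor_right_ext:
  assumes [simp]: "module R X" "module R Y" "module R Z" "module R P"
    and lin: "linear_map R (tensor R X (tensor R Y Z)) P f" "linear_map R (tensor R X (tensor R Y Z)) P g"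
    and eq: "\<And>x y z. x \<in> carrier X \<Longrightarrow> y \<in> carrier Y \<Longrightarrow> z \<in> carrier Z \<Longrightarrow>
      f (tens R X (tensor R Y Z) x (tens R Y Z y z)) = g (tens R X (tensor R Y Z) x (tens R Y Z y z))"
  shows "\<forall>t\<in>carrier (tensor R X (tensor R Y Z)). f t = g t"
proof (rule tensor_ext[OF _ _ _ lin])
  fix x p assume x [simp]: "x \<in> carrier X" and p: "p \<in> carrier (tensor R Y Z)"
  note [simp] = linear_map_comp[OF _ lin(1)] linear_map_comp[OF _ lin(2)]
  have "\<forall>p\<in>carrier (tensor R Y Z). f (tens R X (tensor R Y Z) x p) = g (tens R X (tensor R Y Z) x p)"
    by (rule tensor_ext[where P = P]) (simp_all add: eq)
  then show "f (tens R X (tensor R Y Z) x p) = g (tens R X (tensor R Y Z) x p)"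
    using p by blast
qed simp_all

text \<open>Rebracketing turns \<open>(M \<otimes> i) \<otimes> C\<close> into
  \<open>M \<otimes> (i \<otimes> C)\<close>. Flatness of \<open>M\<close> speaks about the second
  form, whereas uniqueness of coactions on \<open>M \<otimes> G(N)\<close> is about the first. In
  the proof \<open>a\<close> and \<open>b\<close> are the two rebracketings and \<open>a'\<close> is
  a left inverse of \<open>a\<close>.\<close>

lemma flat_tensor_right:
  fixes R :: "('k, 'r) ring_scheme" and M :: "('k, 'm, 'w) module_scheme"
    and X :: "('k, 'x, 'u) module_scheme" and Y :: "('k, 'y, 'v) module_scheme"
    and C :: "('k, 'c, 's) module_scheme"
  assumes M [simp]: "module R M" and XYC [simp]: "module R X" "module R Y" "module R C"
    and i: "linear_map R X Y i"
    and inj: "inj_on (\<lambda>u. sw R M (tensor R X C) (tensor R M (tensor R Y C)) u (\<lambda>m s.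
      tens R M (tensor R Y C) m (sw R X C (tensor R Y C) s (\<lambda>x c. tens R Y C (i x) c))))
        (carrier (tensor R M (tensor R X C)))"
  shows "inj_on (\<lambda>t. sw R (tensor R M X) C (tensor3 R M Y C) t (\<lambda>p c.
      tens R (tensor R M Y) C (sw R M X (tensor R M Y) p (\<lambda>m x. tens R M Y m (i x))) c))
        (carrier (tensor3 R M X C))" (is "inj_on ?k _")
proof (rule inj_onI)
  note [simp] = linear_map_comp[OF _ i] linear_mapD(1)[OF i]
  define a where "a t = sw R (tensor R M X) C (tensor R M (tensor R X C)) t (\<lambda>p c.
    sw R M X (tensor R M (tensor R X C)) p (\<lambda>m x. tens R M (tensor R X C) m (tens R X C x c)))" for t
  define a' where "a' t = sw R M (tensor R X C) (tensor3 R M X C) t (\<lambda>m s.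
    sw R X C (tensor3 R M X C) s (\<lambda>x c. tens3 R M X C m x c))" for t
  define b where "b t = sw R (tensor R M Y) C (tensor R M (tensor R Y C)) t (\<lambda>p c.
    sw R M Y (tensor R M (tensor R Y C)) p (\<lambda>m x. tens R M (tensor R Y C) m (tens R Y C x c)))" for t
  define h where "h u = sw R M (tensor R X C) (tensor R M (tensor R Y C)) u (\<lambda>m s.
      tens R M (tensor R Y C) m (sw R X C (tensor R Y C) s (\<lambda>x c. tens R Y C (i x) c)))" for u
  have 1: "\<forall>t\<in>carrier (tensor3 R M X C). a' (a t) = t"
    unfolding a_def a'_def by (rule tensor3_ext[where P = "tensor3 R M X C"]) simp_all
  have 2: "\<forall>t\<in>carrier (tensor3 R M X C). b (?k t) = h (a t)"
    unfolding a_def b_def h_def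
    by (rule tensor3_ext[where P = "tensor R M (tensor R Y C)"]) simp_all
  have 3: "a t \<in> carrier (tensor R M (tensor R X C))" if "t \<in> carrier (tensor3 R M X C)" for t
    unfolding a_def using that by simp
  fix t t' assume t: "t \<in> carrier (tensor3 R M X C)" "t' \<in> carrier (tensor3 R M X C)"
    and "?k t = ?k t'"
  then have "h (a t) = h (a t')" using 2 t by metis
  then have "a t = a t'" by (rule inj_onD[OF inj[folded h_def[abs_def]] _ 3[OF t(1)] 3[OF t(2)]])
  then show "t = t'" using 1 t by metis
qed

text \<open>After simplification the two inner sums can stand in either order; this is the
  compatibility law for the exchanged order.\<close>

lemma (in tdatum) sw_compat_tens':
  assumes [simp]: "module R M" "module R N" and fg: "linear_map R A M f" "linear_map R A N g"
    and [simp]: "a \<in> carrier A" "c \<in> carrier C" "d \<in> carrier C"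
  shows "sw R A A (tensor3 R M N C) (comul A a) (\<lambda>a1 a2.
         sw R A H (tensor3 R M N C) (hcoact A a2) (\<lambda>a20 a21.
           sw R A H (tensor3 R M N C) (hcoact A a1) (\<lambda>a10 a11.
             tens3 R M N C (f a10) (g a20) (hact C a11 c \<otimes>\<^bsub>C\<^esub> hact C a21 d)))) =
       sw R A H (tensor3 R M N C) (hcoact A a) (\<lambda>a0 a1.
         sw R A A (tensor3 R M N C) (comul A a0) (\<lambda>a01 a02.
           tens3 R M N C (f a01) (g a02) (hact C a1 (c \<otimes>\<^bsub>C\<^esub> d))))"
proof -
  note [simp] = linear_mapD(1)[OF fg(1)] linear_mapD(1)[OF fg(2)]
  show ?thesis
    unfolding sw_compat_tens[OF assms, symmetric]
    by (intro sw_cong refl sw_swap) simp_all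
qed

section \<open>The isomorphism \<open>M \<otimes> G(N) \<cong> G(F(M) \<otimes> N)\<close>\<close>

locale cotensor_defined = dmor R H A C D \<phi> + N: dhh R H A D N
  for R :: "('k, 'r) ring_scheme" and H :: "('k, 'h) hom_coalg" and A :: "('k, 'h, 'a) comod_alg"
    and C :: "('k, 'h, 'c) mod_coalg" and D :: "('k, 'h, 'd) mod_coalg"
    and \<phi> :: "'c \<Rightarrow> 'd" and N :: "('k, 'a, 'd, 'n) dhh" +
  assumes G_def: "G_defined_at R A C D \<phi> N"
begin

abbreviation "Y \<equiv> tensor R N C"
abbreviation "Z \<equiv> tensor3 R N D C"
abbreviation "K \<equiv> cotensor_module R C D \<phi> N"
abbreviation "GN \<equiv> induced_G R A C D \<phi> N"

definition "d1 x = sw R N C Z x (\<lambda>n c. sw R N D Z (coact N n) (\<lambda>n0 n1. tens3 R N D C n0 n1 c))"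
definition "d2 x = sw R N C Z x (\<lambda>n c. sw R C C Z (comul C c) (\<lambda>c1 c2.
  tens3 R N D C (aut_inv N n) (\<phi> c1) (aut C c2)))"

lemma d1_linear: "linear_map R Y Z d1"
  unfolding d1_def by simp

lemma d2_linear: "linear_map R Y Z d2"
  unfolding d2_def by simp

text \<open>The cotensor product in the shape to which \<open>flat_equalizer\<close>
  applies.\<close>

lemma K_eq: "K = Y\<lparr>carrier := {y \<in> carrier Y. d1 y = d2 y}\<rparr>"
  unfolding cotensor_module_def cotensor_def d1_def[abs_def] d2_def[abs_def] sw_def by (rule refl)

lemma K_module [simp]: "module R K"
  unfolding K_eq
  by (rule submodule.submodule_is_module[OF equalizer_submodule[OF _ _ d1_linear d2_linear]]) simp_all

lemma K_linear [simp]: "linear_map R K Y (\<lambda>x. x)"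
  by (auto simp: K_eq linear_map_def)

lemma K_closed [simp]: "x \<in> carrier K \<Longrightarrow> x \<in> carrier Y"
  using linear_mapD(1)[OF K_linear] .

definition "gaut t = sw R N C Y t (\<lambda>n c. tens R N C (aut N n) (aut C c))"
definition "gact a t = sw R A H Y (hcoact A a) (\<lambda>a0 a1.
         sw R N C Y t (\<lambda>n c. tens R N C (act N a0 n) (hact C a1 c)))"
definition "gcoact x = (THE t. is_induced_coaction R C D \<phi> N x t)"

lemma GN_eq: "GN = dhh_make K gaut gact gcoact"
  unfolding induced_G_def gaut_def[abs_def] gact_def[abs_def] gcoact_def[abs_def] sw_def by (rule refl)

sublocale GN: dhh R H A C GN
  using G_def by (intro dhhI) (simp add: G_defined_at_def)

lemma GN_tensor:
  "carrier GN = carrier K" "tensor R X GN = tensor R X K" "tens R X GN = tens R X K"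
  "tensor R GN X' = tensor R K X'" "tens R GN X' = tens R K X'"
  unfolding GN_eq dhh_make_simps by (rule refl)+

lemma K_carrier: "carrier K = cotensor R C D \<phi> N"
  by (simp add: cotensor_module_def)

lemma coaction_ex1: "x \<in> carrier K \<Longrightarrow> \<exists>!t. is_induced_coaction R C D \<phi> N x t"
  using G_def unfolding G_defined_at_def K_carrier by blast

lemma gcoact: "x \<in> carrier K \<Longrightarrow> is_induced_coaction R C D \<phi> N x (gcoact x)"
  unfolding gcoact_def by (rule theI'[OF coaction_ex1])

lemma gcoact_closed [simp]: "x \<in> carrier K \<Longrightarrow> gcoact x \<in> carrier (tensor R K C)"
  using gcoact by (simp add: is_induced_coaction_def)

text \<open>The coaction of \<open>G(N)\<close> is specified only by its image in
  \<open>Y \<otimes> C\<close>. So a sum over it can be computed when the summand \<open>F\<close>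
  is bilinear on all of \<open>Y\<close> and not just on \<open>K\<close>: then it factors through
  that image.\<close>

lemma sw_gcoact:
  assumes P: "module R P" and F: "bilinear_map R Y C P F" and x: "x \<in> carrier K"
  shows "sw R K C P (gcoact x) (\<lambda>x0 x1. F x0 x1) = sw R N C P x (\<lambda>n c.
    sw R C C P (comul C c) (\<lambda>c1 c2. F (tens R N C (aut_inv N n) c1) (aut C c2)))"
proof -
  note [simp] = P F x bilinear_comp_left[OF F] bilinear_comp_right[OF F] bilinear_mapD(3)[OF F]
  have "sw R K C (tensor R Y C) (gcoact x) (\<lambda>y c. tens R Y C y c) =
    sw R N C (tensor R Y C) x (\<lambda>n c. sw R C C (tensor R Y C) (comul C c) (\<lambda>c1 c2.
      tens3 R N C C (aut_inv N n) c1 (aut C c2)))"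
    using gcoact[OF x] by (simp add: is_induced_coaction_def sw_def cong del: sw_cong)
  then have "sw R Y C P (sw R K C (tensor R Y C) (gcoact x) (\<lambda>y c. tens R Y C y c)) F =
    sw R Y C P (sw R N C (tensor R Y C) x (\<lambda>n c. sw R C C (tensor R Y C) (comul C c) (\<lambda>c1 c2.
      tens3 R N C C (aut_inv N n) c1 (aut C c2)))) F"
    by (rule arg_cong)
  then show ?thesis by simp
qed

text \<open>Uniqueness of the coaction of \<open>0\<close> means that the kernel of this map is trivial.\<close>

lemma KC_inj: "inj_on (\<lambda>s. sw R K C (tensor R Y C) s (\<lambda>y c. tens R Y C y c)) (carrier (tensor R K C))"
proof (rule injective_iff_kernel)
  let ?i = "\<lambda>s. sw R K C (tensor R Y C) s (\<lambda>y c. tens R Y C y c)"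
  show lin: "linear_map R (tensor R K C) (tensor R Y C) ?i" by simp
  interpret K: module R K by simp
  interpret KC: module R "tensor R K C" by simp
  define f where "f x = sw R N C (tensor R Y C) x (\<lambda>n c. sw R C C (tensor R Y C) (comul C c) (\<lambda>c1 c2.
      tens3 R N C C (aut_inv N n) c1 (aut C c2)))" for x
  have f: "linear_map R K (tensor R Y C) f"
    unfolding f_def by simp
  have z: "\<zero>\<^bsub>K\<^esub> \<in> carrier K" by simp
  have ex: "\<exists>!t. is_induced_coaction R C D \<phi> N \<zero>\<^bsub>K\<^esub> t"
    by (rule coaction_ex1[OF z])
  have "is_induced_coaction R C D \<phi> N \<zero>\<^bsub>K\<^esub> t" if "t \<in> carrier (tensor R K C)"
    "?i t = \<zero>\<^bsub>tensor R Y C\<^esub>" for t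
  proof -
    have "f \<zero>\<^bsub>K\<^esub> = \<zero>\<^bsub>tensor R Y C\<^esub>" by (rule linear_map_zero[OF _ _ f]) simp_all
    with that have "?i t = f \<zero>\<^bsub>K\<^esub>" by simp
    with that(1) show ?thesis
      unfolding f_def by (simp add: is_induced_coaction_def sw_def cong del: sw_cong)
  qed
  moreover have "?i \<zero>\<^bsub>tensor R K C\<^esub> = \<zero>\<^bsub>tensor R Y C\<^esub>"
    by (rule linear_map_zero[OF _ _ lin]) simp_all
  ultimately show "t = \<zero>\<^bsub>tensor R K C\<^esub>" if "t \<in> carrier (tensor R K C)"
    "?i t = \<zero>\<^bsub>tensor R Y C\<^esub>" for t
    using that ex by (metis KC.zero_closed)
qed simp_all

end

context cotensor_defined
begin

lemma gaut_closed [simp]: "x \<in> carrier K \<Longrightarrow> gaut x \<in> carrier K"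
  using GN.M.aut_closed[of x] by (simp add: GN_eq)

lemma gact_closed [simp]: "a \<in> carrier A \<Longrightarrow> x \<in> carrier K \<Longrightarrow> gact a x \<in> carrier K"
  using GN.act_closed[of a x] by (simp add: GN_eq)

end

locale antipode_transport = cotensor_defined R H A C D \<phi> N + M: dhh R H A C M
  for R :: "('k, 'r) ring_scheme" and H :: "('k, 'h) hom_coalg" and A :: "('k, 'h, 'a) comod_alg"
    and C :: "('k, 'h, 'c) mod_coalg" and D :: "('k, 'h, 'd) mod_coalg"
    and \<phi> :: "'c \<Rightarrow> 'd" and N :: "('k, 'a, 'd, 'n) dhh" and M :: "('k, 'a, 'c, 'm) dhh" +
  fixes S :: "'c \<Rightarrow> 'c"
  assumes antipode: "is_antipode R C S"
    and flat1: "flat_module TYPE(('k, 'n, 'c) tensor) R M"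
    and flat2: "flat_module TYPE(('k, ('k, 'n, 'd) tensor, 'c) tensor) R M"
    and flat3: "flat_module TYPE(('k, ('k, 'n, 'c) tensor, 'c) tensor) R M"
begin

sublocale th: theta R C M "coact M" C id S
  by unfold_locales (simp_all add: linear_map_id antipode id_def)

sublocale thD: theta R C M "coact M" D \<phi> S
  by unfold_locales (simp_all add: linear_\<phi> antipode)

abbreviation "FM \<equiv> induced_F R D \<phi> M"
abbreviation "E \<equiv> dhh_tensor R A C M GN"
abbreviation "P \<equiv> dhh_tensor R A D FM N"
abbreviation "T \<equiv> tensor R M N"
abbreviation "TK \<equiv> tensor R M K"

sublocale FM: dhh R H A D FM
  by (rule dhhI_D[OF induced_F_module[OF M.dhh_module]])

sublocale TE: tpair R H A C M GN ..
sublocale TP: tpair R H A D FM N ..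
sublocale ED: dhh R H A C E by (rule dhhI[OF TE.dhh_tensor_module])
sublocale PD: dhh R H A D P by (rule dhhI_D[OF TP.dhh_tensor_module])

definition "fco m = sw R M C (tensor R M D) (coact M m) (\<lambda>m0 m1. tens R M D m0 (\<phi> m1))"

lemma FM_eq: "FM = dhh_make M (aut M) (act M) fco"
  unfolding induced_F_def fco_def[abs_def] sw_def by (rule refl)

lemma sw_fco:
  assumes "module R X" "bilinear_map R M D X F" "m \<in> carrier M"
  shows "sw R M D X (fco m) F = sw R M C X (coact M m) (\<lambda>m0 m1. F m0 (\<phi> m1))"
  unfolding fco_def using assms by simp

lemma P_eq: "P = dhh_make T TP.tau TP.tact TP.tcoact"
proof -
  have "TP.T = T" unfolding FM_eq dhh_make_simps by (rule refl)
  then show ?thesis using TP.dhh_tensor_eq by (simp only:)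
qed

lemma E_eq: "E = dhh_make TK TE.tau TE.tact TE.tcoact"
proof -
  have "TE.T = TK" unfolding GN_eq dhh_make_simps by (rule refl)
  then show ?thesis using TE.dhh_tensor_eq by (simp only:)
qed

lemma P_simps:
  "carrier P = carrier T" "tensor R P X = tensor R T X" "tens R P X = tens R T X"
  "linear_map R P U f = linear_map R T U f" "linear_map R U P g = linear_map R U T g"
  "sw R P U U' t h = sw R T U U' t h"
  unfolding P_eq dhh_make_simps by (rule refl)+

lemma E_simps:
  "carrier E = carrier TK" "tensor R E X = tensor R TK X" "tens R E X = tens R TK X"
  "linear_map R E U f = linear_map R TK U f" "linear_map R U E g = linear_map R U TK g"
  "sw R E U U' t h = sw R TK U U' t h"
  unfolding E_eq dhh_make_simps by (rule refl)+

lemma P_aut: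
  assumes "m \<in> carrier M" "n \<in> carrier N"
  shows "aut P (tens R M N m n) = tens R M N (aut M m) (aut N n)"
  using TP.tau_tens[of m n] assms unfolding P_eq unfolding dhh_make_simps FM_eq by simp

lemma P_aut_inv:
  assumes [simp]: "m \<in> carrier M" "n \<in> carrier N"
  shows "aut_inv P (tens R M N m n) = tens R M N (aut_inv M m) (aut_inv N n)"
  by (rule PD.M.aut_inv_eqI) (simp_all add: P_aut P_simps(1))

lemma P_act:
  assumes "a \<in> carrier A" "m \<in> carrier M" "n \<in> carrier N"
  shows "act P a (tens R M N m n) =
    sw R A A T (comul A a) (\<lambda>a1 a2. tens R M N (act M a1 m) (act N a2 n))"
  using TP.tact_tens[of a m n] assms unfolding P_eq unfolding dhh_make_simps FM_eq by simp

lemma P_coact: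
  assumes "m \<in> carrier M" "n \<in> carrier N"
  shows "coact P (tens R M N m n) = sw R M C (tensor R T D) (coact M m) (\<lambda>m0 m1.
    sw R N D (tensor R T D) (coact N n) (\<lambda>n0 n1. tens3 R M N D m0 n0 (\<phi> m1 \<otimes>\<^bsub>D\<^esub> n1)))"
  using TP.tcoact_tens[of m n] assms unfolding P_eq unfolding dhh_make_simps FM_eq
  by (simp add: sw_fco)

lemma E_aut:
  assumes "m \<in> carrier M" "x \<in> carrier K"
  shows "aut E (tens R M K m x) = tens R M K (aut M m) (gaut x)"
  using TE.tau_tens[of m x] assms unfolding E_eq unfolding dhh_make_simps GN_eq by simp

lemma E_act:
  assumes "a \<in> carrier A" "m \<in> carrier M" "x \<in> carrier K"
  shows "act E a (tens R M K m x) =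
    sw R A A TK (comul A a) (\<lambda>a1 a2. tens R M K (act M a1 m) (gact a2 x))"
  using TE.tact_tens[of a m x] assms unfolding E_eq unfolding dhh_make_simps GN_eq by simp

lemma E_coact:
  assumes "m \<in> carrier M" "x \<in> carrier K"
  shows "coact E (tens R M K m x) = sw R M C (tensor R TK C) (coact M m) (\<lambda>m0 m1.
    sw R K C (tensor R TK C) (gcoact x) (\<lambda>x0 x1. tens R TK C (tens R M K m0 x0) (m1 \<otimes>\<^bsub>C\<^esub> x1)))"
  using TE.tcoact_tens[of m x] assms unfolding E_eq unfolding dhh_make_simps GN_eq by simp

lemmas P_linear = PD.M.linear_aut[unfolded P_simps] PD.M.linear_aut_inv[unfolded P_simps]
  PD.linear_\<rho>[unfolded P_simps]
lemmas P_linear_comp [simp] = P_linear[THEN linear_map_comp[rotated]]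
lemmas P_closed [simp] = P_linear[THEN linear_mapD(1)]
lemmas P_act_linear [simp] = PD.linear_act_left[unfolded P_simps] PD.linear_act_right[unfolded P_simps]
lemmas P_act_closed [simp] = PD.act_closed[unfolded P_simps]
lemmas P_sw [simp] =
  PD.\<rho>_sw[unfolded P_simps] PD.act_sw_left[unfolded P_simps] PD.act_sw_right[unfolded P_simps]
declare P_aut [simp] P_aut_inv [simp] P_act [simp] P_coact [simp]
declare E_aut [simp] E_act [simp] E_coact [simp]

lemmas E_linear = ED.M.linear_aut[unfolded E_simps] ED.linear_\<rho>[unfolded E_simps]
lemmas E_linear_comp [simp] = E_linear[THEN linear_map_comp[rotated]]
lemmas E_closed [simp] = E_linear[THEN linear_mapD(1)]
lemmas E_act_linear [simp] = ED.linear_act_left[unfolded E_simps] ED.linear_act_right[unfolded E_simps]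

definition "incl t = sw R M K (tensor R M Y) t (\<lambda>m x. tens R M Y m x)"

lemma incl_linear: "linear_map R TK (tensor R M Y) incl"
  unfolding incl_def by simp

lemmas incl_closed [simp] = linear_mapD(1)[OF incl_linear]
lemmas incl_linear_comp [simp] = linear_map_comp[OF _ incl_linear]

lemma incl_tens [simp]: "m \<in> carrier M \<Longrightarrow> x \<in> carrier K \<Longrightarrow> incl (tens R M K m x) = tens R M Y m x"
  unfolding incl_def by simp

definition "J t = th.\<Theta> N (incl t)"

lemma J_linear: "linear_map R TK (tensor R T C) J"
  unfolding J_def by simp

lemmas J_closed [simp] = linear_mapD(1)[OF J_linear]
lemmas J_linear_comp [simp] = linear_map_comp[OF _ J_linear]
lemmas J_sw [simp] = linear_sw[OF _ _ _ _ J_linear]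

lemma J_tens [simp]: "m \<in> carrier M \<Longrightarrow> x \<in> carrier K \<Longrightarrow>
    J (tens R M K m x) = sw R N C (tensor3 R M N C) x (\<lambda>n c.
      sw R M C (tensor3 R M N C) (coact M m) (\<lambda>m0 m1. tens3 R M N C m0 n (m1 \<otimes>\<^bsub>C\<^esub> c)))"
  unfolding J_def by (simp add: th.\<Theta>_tens)

lemma J_aut:
  "\<forall>e\<in>carrier TK. J (aut E e) = sw R T C (tensor R T C) (J e) (\<lambda>p c. tens R T C (aut P p) (aut C c))"
  by (rule tensor_ext[where P = "tensor R T C"]) (simp_all, simp add: gaut_def)

lemma J_act:
  assumes [simp]: "a \<in> carrier A"
  shows "\<forall>e\<in>carrier TK. J (act E a e) = sw R A H (tensor R T C) (hcoact A a) (\<lambda>a0 a1.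
        sw R T C (tensor R T C) (J e) (\<lambda>p c. tens R T C (act P a0 p) (hact C a1 c)))" (is "\<forall>e\<in>_. ?l e = ?r e")
proof (rule tensor_ext[where P = "tensor R T C"])
  fix m x assume [simp]: "m \<in> carrier M" "x \<in> carrier K"
  show "?l (tens R M K m x) = ?r (tens R M K m x)"
    by simp (simp add: gact_def C.sw_compat_tens C.sw_compat_tens'
      sw_push[where s = x and t = "hcoact A _"] sw_push[where s = x and t = "comul A _"]
      sw_push[where s = "coact M m" and t = "hcoact A _"] sw_push[where s = "coact M m" and t = "comul A _"])
qed simp_all

lemma J_coact:
  "\<forall>e\<in>carrier TK. sw R TK C (tensor3 R T C C) (coact E e) (\<lambda>e0 e1. tens R (tensor R T C) C (J e0) e1) =
      sw R T C (tensor3 R T C C) (J e) (\<lambda>p c.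
        sw R C C (tensor3 R T C C) (comul C c) (\<lambda>c1 c2. tens3 R T C C (aut_inv P p) c1 (aut C c2)))" (is "\<forall>e\<in>_. ?l e = ?r e")
proof (rule tensor_ext[where P = "tensor3 R T C C"])
  fix m x assume [simp]: "m \<in> carrier M" "x \<in> carrier K"
  \<comment> \<open>\<open>J\<close> accepts only tensors with second factor in \<open>K\<close>.
    Writing it as \<open>th.\<Theta> N\<close>, which is defined on all of
    \<open>M \<otimes> Y\<close>, extends the summand as \<open>sw_gcoact\<close> requires.\<close>
  have "?l (tens R M K m x) =
    sw R M C (tensor3 R T C C) (coact M m) (\<lambda>m0 m1. sw R K C (tensor3 R T C C) (gcoact x) (\<lambda>x0 x1.
      tens R (tensor R T C) C (th.\<Theta> N (tens R M Y m0 x0)) (m1 \<otimes>\<^bsub>C\<^esub> x1)))"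
    by (simp add: th.\<Theta>_tens)
  also have "\<dots> = sw R M C (tensor3 R T C C) (coact M m) (\<lambda>m0 m1.
    sw R N C (tensor3 R T C C) x (\<lambda>n c. sw R C C (tensor3 R T C C) (comul C c) (\<lambda>c1 c2.
      tens R (tensor R T C) C (th.\<Theta> N (tens R M Y m0 (tens R N C (aut_inv N n) c1))) (m1 \<otimes>\<^bsub>C\<^esub> aut C c2))))"
    by (intro sw_cong refl sw_gcoact) simp_all
  also have "\<dots> = ?r (tens R M K m x)"
    by (simp add: th.\<Theta>_tens M.sw_coassoc sw_push[where t = x and s = "coact M _"]
      sw_push[where t = "comul C _" and s = "coact M _"] sw_push[where t = x and s = "comul C _"])
  finally show "?l (tens R M K m x) = ?r (tens R M K m x)" .
qed simp_all

section \<open>Injectivity and image of \<open>J\<close>\<close>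

lemma incl_inj: "inj_on incl (carrier TK)"
  and incl_image: "incl ` carrier TK = {t \<in> carrier (tensor R M Y).
    sw R M Y (tensor R M Z) t (\<lambda>m y. tens R M Z m (d1 y)) =
    sw R M Y (tensor R M Z) t (\<lambda>m y. tens R M Z m (d2 y))}"
  using flat_equalizer(2,3)[OF flat1 flat2 _ _ d1_linear d2_linear, folded K_eq]
  unfolding incl_def[abs_def] by simp_all

lemma J_inj: "inj_on J (carrier TK)"
proof (rule inj_onI)
  fix t t' assume t: "t \<in> carrier TK" "t' \<in> carrier TK" and "J t = J t'"
  then have "incl t = incl t'" unfolding J_def using th.\<Psi>_\<Theta>[of N] by (metis N.M.module_M incl_closed)
  then show "t = t'" using inj_onD[OF incl_inj] t by blast
qed

definition "cL y = sw R T C (tensor3 R T D C) y (\<lambda>p c.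
  sw R T D (tensor3 R T D C) (coact P p) (\<lambda>p0 p1. tens3 R T D C p0 p1 c))"
definition "cR y = sw R T C (tensor3 R T D C) y (\<lambda>p c.
  sw R C C (tensor3 R T D C) (comul C c) (\<lambda>c1 c2. tens3 R T D C (aut_inv P p) (\<phi> c1) (aut C c2)))"

lemma cotensor_P: "cotensor R C D \<phi> P = {y \<in> carrier (tensor R T C). cL y = cR y}"
  unfolding cotensor_def P_simps cL_def cR_def sw_def by (rule refl)

text \<open>
  \<open>\<Theta>2\<close> carries \<open>M \<otimes> d1\<close> and \<open>M \<otimes> d2\<close> to the two maps whose equalizer is \<open>P \<box> C\<close>.
\<close>

definition "\<Theta>2 u = sw R (tensor R M (tensor R N D)) C (tensor3 R T D C) (th.\<Theta> (tensor R N D) u)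
  (\<lambda>v c. tens R (tensor R T D) C (thD.\<Theta> N v) c)"
definition "\<Psi>2 w = th.\<Psi> (tensor R N D) (sw R (tensor R T D) C (tensor3 R M (tensor R N D) C) w
  (\<lambda>v c. tens R (tensor R M (tensor R N D)) C (thD.\<Psi> N v) c))"

text \<open>What is used is injectivity of \<open>\<Theta>2\<close>: equality of the two defining
  maps of the cotensor product can be tested before applying it.\<close>

lemma \<Psi>2_\<Theta>2:
  assumes "u \<in> carrier (tensor R M Z)"
  shows "\<Psi>2 (\<Theta>2 u) = u"
proof -
  have "\<forall>w\<in>carrier (tensor3 R M (tensor R N D) C).
    sw R (tensor R T D) C (tensor3 R M (tensor R N D) C)
      (sw R (tensor R M (tensor R N D)) C (tensor3 R T D C) w
        (\<lambda>v c. tens R (tensor R T D) C (thD.\<Theta> N v) c))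
      (\<lambda>v c. tens R (tensor R M (tensor R N D)) C (thD.\<Psi> N v) c) = w"
    by (rule tensor_ext[where P = "tensor3 R M (tensor R N D) C"]) (simp_all add: thD.\<Psi>_\<Theta>)
  then show ?thesis
    unfolding \<Psi>2_def \<Theta>2_def using assms by (simp add: th.\<Psi>_\<Theta>)
qed

text \<open>Both sides expand to \<open>(m\<^sub>0\<^sub>0 \<otimes> n\<^sub>0) \<otimes>
  \<phi>(m\<^sub>0\<^sub>1)n\<^sub>1 \<otimes> m\<^sub>1c\<close>: coacting twice on
  \<open>m\<close> is what the two factors of \<open>\<Theta>2\<close> do.\<close>

lemma cL_\<Theta>: "\<forall>t\<in>carrier (tensor R M Y). cL (th.\<Theta> N t) =
    \<Theta>2 (sw R M Y (tensor R M Z) t (\<lambda>m y. tens R M Z m (d1 y)))" (is "\<forall>t\<in>_. ?l t = ?r t")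
proof (rule tensor_right_ext[where P = "tensor3 R T D C"])
  fix m n c assume [simp]: "m \<in> carrier M" "n \<in> carrier N" "c \<in> carrier C"
  show "?l (tens R M Y m (tens R N C n c)) = ?r (tens R M Y m (tens R N C n c))"
    unfolding cL_def \<Theta>2_def d1_def
    by (simp add: th.\<Theta>_tens thD.\<Theta>_tens sw_push[where t = "coact N n"])
qed (simp_all add: cL_def \<Theta>2_def d1_def)

text \<open>On the left the comultiplication of the product \<open>m\<^sub>1c\<close> splits both
  factors; on the right \<open>\<Theta>2\<close> coacts twice on \<open>m\<close>. Coassociativity
  of \<open>M\<close> and multiplicativity of \<open>\<phi>\<close> make the two agree.\<close>

lemma cR_\<Theta>: "\<forall>t\<in>carrier (tensor R M Y). cR (th.\<Theta> N t) =
    \<Theta>2 (sw R M Y (tensor R M Z) t (\<lambda>m y. tens R M Z m (d2 y)))" (is "\<forall>t\<in>_. ?l t = ?r t")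
proof (rule tensor_right_ext[where P = "tensor3 R T D C"])
  fix m n c assume [simp]: "m \<in> carrier M" "n \<in> carrier N" "c \<in> carrier C"
  show "?l (tens R M Y m (tens R N C n c)) = ?r (tens R M Y m (tens R N C n c))"
    unfolding cR_def \<Theta>2_def d2_def
    by (simp add: th.\<Theta>_tens thD.\<Theta>_tens M.sw_coassoc sw_push[where t = "comul C c"])
qed (simp_all add: cR_def \<Theta>2_def d2_def)

text \<open>\<open>\<Theta>\<close> is a bijection from \<open>M \<otimes> Y\<close> to
  \<open>T \<otimes> C\<close>. Along it the cotensor equation of \<open>P\<close> pulls back, up to
  the injective \<open>\<Theta>2\<close>, to equality of \<open>M \<otimes> d1\<close> and
  \<open>M \<otimes> d2\<close>, whose solutions are the image of \<open>incl\<close>.\<close>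

lemma J_image: "J ` carrier TK = cotensor R C D \<phi> P"
proof -
  have iff: "th.\<Theta> N t \<in> cotensor R C D \<phi> P \<longleftrightarrow> t \<in> incl ` carrier TK"
    if t: "t \<in> carrier (tensor R M Y)" for t
  proof -
    let ?d1 = "sw R M Y (tensor R M Z) t (\<lambda>m y. tens R M Z m (d1 y))"
    let ?d2 = "sw R M Y (tensor R M Z) t (\<lambda>m y. tens R M Z m (d2 y))"
    note [simp] = linear_map_comp[OF _ d1_linear] linear_mapD(1)[OF d1_linear]
      linear_map_comp[OF _ d2_linear] linear_mapD(1)[OF d2_linear]
    have "?d1 \<in> carrier (tensor R M Z)" "?d2 \<in> carrier (tensor R M Z)" using t by simp_all
    then have "\<Theta>2 ?d1 = \<Theta>2 ?d2 \<longleftrightarrow> ?d1 = ?d2" using \<Psi>2_\<Theta>2 by metis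
    then show ?thesis
      using t cL_\<Theta> cR_\<Theta> unfolding cotensor_P incl_image by simp
  qed
  show ?thesis
  proof (intro equalityI subsetI)
    fix y assume "y \<in> J ` carrier TK"
    then show "y \<in> cotensor R C D \<phi> P" unfolding J_def using iff by auto
  next
    fix y assume y: "y \<in> cotensor R C D \<phi> P"
    then have yT: "y \<in> carrier (tensor R T C)" by (simp add: cotensor_P)
    then have "th.\<Theta> N (th.\<Psi> N y) = y" "th.\<Psi> N y \<in> carrier (tensor R M Y)"
      using th.\<Theta>_\<Psi>[of N] by simp_all
    then show "y \<in> J ` carrier TK" using iff[of "th.\<Psi> N y"] y unfolding J_def by auto
  qed
qed

text \<open>Composing with \<open>\<Psi> \<otimes> C\<close> reduces this to injectivity of
  \<open>incl \<otimes> C\<close>. Rebracketed, that map is \<open>M\<close> tensored with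
  \<open>K \<otimes> C \<rightarrow> Y \<otimes> C\<close>, which is injective by
  \<open>KC_inj\<close> and \<open>flat3\<close>.\<close>

lemma JC_inj: "inj_on (\<lambda>t. sw R TK C (tensor3 R T C C) t (\<lambda>e c. tens R (tensor R T C) C (J e) c))
    (carrier (tensor R TK C))" (is "inj_on ?f _")
proof (rule inj_onI)
  define g where "g t = sw R TK C (tensor3 R M Y C) t (\<lambda>e c. tens R (tensor R M Y) C (incl e) c)" for t
  have inj: "inj_on g (carrier (tensor3 R M K C))"
    unfolding g_def incl_def
  proof -
    have KC_module: "module R (tensor R K C)" and YC_module: "module R (tensor R Y C)"
      and KC_linear: "linear_map R (tensor R K C) (tensor R Y C)
        (\<lambda>s. sw R K C (tensor R Y C) s (\<lambda>y c. tens R Y C y c))" by simp_all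
    show "inj_on (\<lambda>t. sw R TK C (tensor3 R M Y C) t (\<lambda>e c. tens R (tensor R M Y) C
        (sw R M K (tensor R M Y) e (\<lambda>m x. tens R M Y m x)) c)) (carrier (tensor3 R M K C))"
    proof (rule flat_tensor_right[where i = "\<lambda>x. x"])
      show "inj_on (\<lambda>u. sw R M (tensor R K C) (tensor R M (tensor R Y C)) u
        (\<lambda>m s. tens R M (tensor R Y C) m (sw R K C (tensor R Y C) s (\<lambda>x c. tens R Y C x c))))
        (carrier (tensor R M (tensor R K C)))"
        unfolding sw_def[of R M]
        using flat3[unfolded flat_module_def, THEN conjunct2, rule_format,
          OF conjI[OF KC_module conjI[OF YC_module conjI[OF KC_linear KC_inj]]]] .
    qed simp_all
  qed
  have "\<forall>t\<in>carrier (tensor R TK C).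
      sw R (tensor R T C) C (tensor3 R M Y C) (?f t) (\<lambda>y c. tens R (tensor R M Y) C (th.\<Psi> N y) c) = g t"
    unfolding g_def J_def by (rule tensor_ext[where P = "tensor3 R M Y C"]) (simp_all add: th.\<Psi>_\<Theta>)
  then have fg: "?f t = ?f t' \<Longrightarrow> g t = g t'"
    if "t \<in> carrier (tensor R TK C)" "t' \<in> carrier (tensor R TK C)" for t t'
    using that by metis
  fix t t' assume t: "t \<in> carrier (tensor R TK C)" "t' \<in> carrier (tensor R TK C)"
    and "?f t = ?f t'"
  then show "t = t'" using fg[OF t] inj_onD[OF inj] by blast
qed

sublocale transport: gtransport R H A C D \<phi> E P J
proof (intro gtransport.intro gtransport_axioms.intro ED.dhh_axioms PD.dhh_axioms)
qed (unfold P_simps E_simps, use J_linear J_inj J_image J_aut J_act J_coact JC_inj in simp_all)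

end

section \<open>Isomorphisms and functoriality of \<open>G\<close>\<close>

lemma dhh_iso_sym: "dhh_isomorphic R A C M N \<Longrightarrow> dhh_isomorphic R A C N M"
  unfolding dhh_isomorphic_def dhh_iso_map_def by blast

context dmor
begin

lemma dhh_morphism_coact:
  "dhh_morphism R A B M N f \<Longrightarrow> m \<in> carrier M \<Longrightarrow>
    coact N (f m) = sw R M B (tensor R N B) (coact M m) (\<lambda>m0 m1. tens R N B (f m0) m1)"
  by (simp add: dhh_morphism_def sw_def)

lemma dhh_morphism_linear: "dhh_morphism R A B M N f \<Longrightarrow> linear_map R M N f"
  by (simp add: dhh_morphism_def)

lemma dhh_morphism_comp:
  assumes "dhh_module R A C M" "dhh_module R A C N" "dhh_module R A C P"
    and f: "dhh_morphism R A C M N f" and g: "dhh_morphism R A C N P g"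
  shows "dhh_morphism R A C M P (\<lambda>m. g (f m))"
proof -
  interpret M: dhh R H A C M by (rule dhhI) fact
  interpret N: dhh R H A C N by (rule dhhI) fact
  interpret P: dhh R H A C P by (rule dhhI) fact
  note lin = dhh_morphism_linear[OF f] dhh_morphism_linear[OF g]
  note [simp] = linear_mapD(1)[OF lin(1)] linear_mapD(1)[OF lin(2)]
    linear_map_comp[OF _ lin(1)] linear_map_comp[OF _ lin(2)]
  have "coact P (g (f m)) = sw R M C (tensor R P C) (coact M m) (\<lambda>m0 m1. tens R P C (g (f m0)) m1)"
    if "m \<in> carrier M" for m
    using that by (simp add: dhh_morphism_coact[OF f] dhh_morphism_coact[OF g])
  then show ?thesis
    using f g linear_map_comp[OF lin] by (simp add: dhh_morphism_def sw_def)
qed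

lemma dhh_iso_trans:
  assumes "dhh_isomorphic R A C M N" "dhh_isomorphic R A C N P"
  shows "dhh_isomorphic R A C M P"
proof -
  from assms(1) obtain f f' where f: "dhh_module R A C M" "dhh_module R A C N"
    "dhh_morphism R A C M N f" "dhh_morphism R A C N M f'"
    "\<forall>m\<in>carrier M. f' (f m) = m" "\<forall>n\<in>carrier N. f (f' n) = n"
    unfolding dhh_isomorphic_def dhh_iso_map_def by blast
  from assms(2) obtain g g' where g: "dhh_module R A C P"
    "dhh_morphism R A C N P g" "dhh_morphism R A C P N g'"
    "\<forall>m\<in>carrier N. g' (g m) = m" "\<forall>n\<in>carrier P. g (g' n) = n"
    unfolding dhh_isomorphic_def dhh_iso_map_def by blast
  note cl = linear_mapD(1)[OF dhh_morphism_linear[OF f(3)]] linear_mapD(1)[OF dhh_morphism_linear[OF f(4)]]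
    linear_mapD(1)[OF dhh_morphism_linear[OF g(2)]] linear_mapD(1)[OF dhh_morphism_linear[OF g(3)]]
  have "dhh_iso_map R A C M P (\<lambda>m. g (f m))"
    unfolding dhh_iso_map_def
    using f g cl dhh_morphism_comp[OF f(1,2) g(1) f(3) g(2)] dhh_morphism_comp[OF g(1) f(2,1) g(3) f(4)]
    by (intro conjI exI[of _ "\<lambda>p. f' (g' p)"]) simp_all
  then show ?thesis unfolding dhh_isomorphic_def by blast
qed

text \<open>That \<open>G\<close> is defined at \<open>P'\<close> has to be proved along with the
  isomorphism. Both follow from the recognition criterion for \<open>E = G(P)\<close> and
  \<open>J = f \<otimes> C\<close>.\<close>

lemma G_functorial:
  assumes iso: "dhh_isomorphic R A D P P'" and G_def: "G_defined_at R A C D \<phi> P"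
  shows "G_defined_at R A C D \<phi> P'"
    and "dhh_isomorphic R A C (induced_G R A C D \<phi> P) (induced_G R A C D \<phi> P')"
proof -
  from iso obtain f f' where f: "dhh_module R A D P" "dhh_module R A D P'"
    "dhh_morphism R A D P P' f" "dhh_morphism R A D P' P f'"
    and ff' [simp]: "\<And>m. m \<in> carrier P \<Longrightarrow> f' (f m) = m" "\<And>n. n \<in> carrier P' \<Longrightarrow> f (f' n) = n"
    unfolding dhh_isomorphic_def dhh_iso_map_def by blast
  interpret P: cotensor_defined R H A C D \<phi> P
    by (intro cotensor_defined.intro cotensor_defined_axioms.intro dmor_axioms dhhI_D f G_def)
  interpret P': dhh R H A D P' by (rule dhhI_D) fact
  note lin = dhh_morphism_linear[OF f(3)] dhh_morphism_linear[OF f(4)]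
  note [simp] = linear_mapD(1)[OF lin(1)] linear_mapD(1)[OF lin(2)]
    linear_map_comp[OF _ lin(1)] linear_map_comp[OF _ lin(2)]
  have f_aut [simp]: "f (aut P p) = aut P' (f p)" and f_act [simp]: "a \<in> carrier A \<Longrightarrow> f (act P a p) = act P' a (f p)"
    if "p \<in> carrier P" for p a
    using f(3) that by (simp_all add: dhh_morphism_def)
  have f_aut_inv [simp]: "f (aut_inv P p) = aut_inv P' (f p)" if "p \<in> carrier P" for p
    using that by (intro P'.M.aut_inv_eqI[symmetric]) (simp_all flip: f_aut)
  define J where "J t = sw R P C (tensor R P' C) t (\<lambda>p c. tens R P' C (f p) c)" for t
  define J' where "J' t = sw R P' C (tensor R P C) t (\<lambda>p c. tens R P C (f' p) c)" for t
  have J_lin: "linear_map R P.Y (tensor R P' C) J" unfolding J_def by simp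
  have J'_lin: "linear_map R (tensor R P' C) P.Y J'" unfolding J'_def by simp
  note [simp] = linear_mapD(1)[OF J_lin] linear_mapD(1)[OF J'_lin]
    linear_map_comp[OF _ J_lin] linear_map_comp[OF _ J'_lin]
  have J'_J [simp]: "J' (J t) = t" if "t \<in> carrier P.Y" for t
  proof -
    have "\<forall>t\<in>carrier P.Y. J' (J t) = t"
      unfolding J_def J'_def by (rule tensor_ext[where P = P.Y]) simp_all
    then show ?thesis using that by blast
  qed
  have J_J' [simp]: "J (J' t) = t" if "t \<in> carrier (tensor R P' C)" for t
  proof -
    have "\<forall>t\<in>carrier (tensor R P' C). J (J' t) = t"
      unfolding J_def J'_def by (rule tensor_ext[where P = "tensor R P' C"]) simp_all
    then show ?thesis using that by blast
  qed
  \<comment> \<open>\<open>f3\<close> is \<open>(f \<otimes> D) \<otimes> C\<close>. It carries the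
    two maps defining the cotensor product of \<open>P\<close> to those of \<open>P'\<close>, and as
    it has a left inverse, the two equations are equivalent.\<close>
  define f3 where "f3 z = sw R (tensor R P D) C (tensor3 R P' D C) z (\<lambda>s c.
    tens R (tensor R P' D) C (sw R P D (tensor R P' D) s (\<lambda>p d. tens R P' D (f p) d)) c)" for z
  define f3' where "f3' z = sw R (tensor R P' D) C P.Z z (\<lambda>s c.
    tens R (tensor R P D) C (sw R P' D (tensor R P D) s (\<lambda>p d. tens R P D (f' p) d)) c)" for z
  have f3: "\<forall>z\<in>carrier P.Z. f3' (f3 z) = z"
    unfolding f3_def f3'_def by (rule tensor3_ext[where P = P.Z]) simp_all
  define cL where "cL y = sw R P' C (tensor3 R P' D C) y (\<lambda>p c.
    sw R P' D (tensor3 R P' D C) (coact P' p) (\<lambda>p0 p1. tens3 R P' D C p0 p1 c))" for y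
  define cR where "cR y = sw R P' C (tensor3 R P' D C) y (\<lambda>p c.
    sw R C C (tensor3 R P' D C) (comul C c) (\<lambda>c1 c2. tens3 R P' D C (aut_inv P' p) (\<phi> c1) (aut C c2)))" for y
  have cot: "cotensor R C D \<phi> P' = {y \<in> carrier (tensor R P' C). cL y = cR y}"
    unfolding cotensor_def cL_def cR_def sw_def by (rule refl)
  have cL: "\<forall>t\<in>carrier P.Y. cL (J t) = f3 (P.d1 t)"
    unfolding cL_def f3_def P.d1_def J_def
    by (rule tensor_ext[where P = "tensor3 R P' D C"]) (simp_all add: dhh_morphism_coact[OF f(3)])
  have cR: "\<forall>t\<in>carrier P.Y. cR (J t) = f3 (P.d2 t)"
    unfolding cR_def f3_def P.d2_def J_def
    by (rule tensor_ext[where P = "tensor3 R P' D C"]) simp_all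
  have iff: "J t \<in> cotensor R C D \<phi> P' \<longleftrightarrow> t \<in> carrier P.K" if t: "t \<in> carrier P.Y" for t
  proof -
    have "f3 (P.d1 t) = f3 (P.d2 t) \<longleftrightarrow> P.d1 t = P.d2 t"
      using f3 linear_mapD(1)[OF P.d1_linear t] linear_mapD(1)[OF P.d2_linear t] by metis
    moreover have "t \<in> carrier P.K \<longleftrightarrow> P.d1 t = P.d2 t" using t by (subst P.K_eq) simp
    ultimately show ?thesis using t cL cR unfolding cot by simp
  qed
  have GP_simps: "linear_map R P.GN X g = linear_map R P.K X g" "sw R P.GN X X' t h = sw R P.K X X' t h"
    "aut P.GN = P.gaut" "act P.GN = P.gact" "coact P.GN = P.gcoact"
    for X :: "('k, 'x, 'x1) module_scheme" and X' :: "('k, 'y, 'y1) module_scheme" and t g h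
    unfolding P.GN_eq dhh_make_simps by (rule refl)+
  interpret T: gtransport R H A C D \<phi> P.GN P' J
  proof (intro gtransport.intro gtransport_axioms.intro P.GN.dhh_axioms P'.dhh_axioms,
      unfold GP_simps P.GN_tensor)
    show "linear_map R P.K (tensor R P' C) J" by simp
    show "inj_on J (carrier P.K)" by (rule inj_on_inverseI[where g = J']) simp
    show "J ` carrier P.K = cotensor R C D \<phi> P'"
    proof (intro equalityI subsetI)
      fix y assume y: "y \<in> cotensor R C D \<phi> P'"
      then have "y \<in> carrier (tensor R P' C)" by (simp add: cot)
      then have "J (J' y) = y" "J' y \<in> carrier P.Y" by simp_all
      then show "y \<in> J ` carrier P.K" using iff[of "J' y"] y by (metis image_eqI)
    qed (use iff in auto)
    fix e assume e [simp]: "e \<in> carrier P.K"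
    show "J (P.gaut e) = sw R P' C (tensor R P' C) (J e) (\<lambda>n c. tens R P' C (aut P' n) (aut C c))"
      unfolding P.gaut_def J_def by simp
    show "sw R P.K C (tensor3 R P' C C) (P.gcoact e) (\<lambda>e0 e1. tens R (tensor R P' C) C (J e0) e1) =
      sw R P' C (tensor3 R P' C C) (J e) (\<lambda>n c. sw R C C (tensor3 R P' C C) (comul C c) (\<lambda>c1 c2.
        tens3 R P' C C (aut_inv P' n) c1 (aut C c2)))"
      by (subst P.sw_gcoact) (simp_all, simp_all add: J_def)
    show "J (P.gact a e) = sw R A H (tensor R P' C) (hcoact A a) (\<lambda>a0 a1.
        sw R P' C (tensor R P' C) (J e) (\<lambda>n c. tens R P' C (act P' a0 n) (hact C a1 c)))"
      if "a \<in> carrier A" for a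
      unfolding P.gact_def J_def using that by simp
  next
    show "inj_on (\<lambda>t. sw R P.K C (tensor3 R P' C C) t (\<lambda>e c. tens R (tensor R P' C) C (J e) c))
      (carrier (tensor R P.K C))" (is "inj_on ?g _")
    proof (rule inj_onI)
      \<comment> \<open>Undoing \<open>f\<close> turns \<open>J \<otimes> C\<close> into the map
        induced by the inclusion of \<open>P.K\<close>, and that one is injective because
        \<open>G\<close> is defined at \<open>P\<close>.\<close>
      define i where "i t = sw R P.K C (tensor R P.Y C) t (\<lambda>y c. tens R P.Y C y c)" for t
      have gi: "\<forall>t\<in>carrier (tensor R P.K C).
          sw R (tensor R P' C) C (tensor R P.Y C) (?g t) (\<lambda>y c. tens R P.Y C (J' y) c) = i t"
        unfolding i_def by (rule tensor_ext[where P = "tensor R P.Y C"]) simp_all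
      fix t t' assume t: "t \<in> carrier (tensor R P.K C)" "t' \<in> carrier (tensor R P.K C)"
        and "?g t = ?g t'"
      then have "i t = i t'" using gi t by metis
      then show "t = t'" using inj_onD[OF P.KC_inj _ t] unfolding i_def by blast
    qed
  qed
  show "G_defined_at R A C D \<phi> P'" by (rule T.G_defined)
  show "dhh_isomorphic R A C (induced_G R A C D \<phi> P) (induced_G R A C D \<phi> P')"
    unfolding dhh_isomorphic_def using T.G_iso by blast
qed

end

section \<open>The opposite datum and the twisted case\<close>

lemma tensor_update [simp]:
  "tensor R (X\<lparr>mult := f\<rparr>) N = tensor R X N" "tensor R N (X\<lparr>mult := f\<rparr>) = tensor R N X"
  "tens R (X\<lparr>mult := f\<rparr>) N = tens R X N" "tens R N (X\<lparr>mult := f\<rparr>) = tens R N X"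
  "tensor R (Y\<lparr>comul := g\<rparr>) N = tensor R Y N" "tensor R N (Y\<lparr>comul := g\<rparr>) = tensor R N Y"
  "tens R (Y\<lparr>comul := g\<rparr>) N = tens R Y N" "tens R N (Y\<lparr>comul := g\<rparr>) = tens R N Y"
  by (intro tensor_eqI; simp)+

lemma linear_map_update [simp]:
  "linear_map R (X\<lparr>mult := f\<rparr>) N h1 = linear_map R X N h1"
  "linear_map R N (X\<lparr>mult := f\<rparr>) h2 = linear_map R N X h2"
  "linear_map R (Y\<lparr>comul := g\<rparr>) N h3 = linear_map R Y N h3"
  "linear_map R N (Y\<lparr>comul := g\<rparr>) h4 = linear_map R N Y h4"
  by (intro linear_map_eqI; simp)+

lemma bilinear_map_update [simp]:
  "bilinear_map R (X\<lparr>mult := f\<rparr>) N P h1 = bilinear_map R X N P h1"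
  "bilinear_map R N (X\<lparr>mult := f\<rparr>) P h2 = bilinear_map R N X P h2"
  "bilinear_map R N P (X\<lparr>mult := f\<rparr>) h3 = bilinear_map R N P X h3"
  "bilinear_map R (Y\<lparr>comul := g\<rparr>) N P h4 = bilinear_map R Y N P h4"
  "bilinear_map R N (Y\<lparr>comul := g\<rparr>) P h5 = bilinear_map R N Y P h5"
  "bilinear_map R N P (Y\<lparr>comul := g\<rparr>) h6 = bilinear_map R N P Y h6"
  by (simp_all add: bilinear_map_def)

lemma module_update [simp]:
  "module R (X\<lparr>mult := f\<rparr>) = module R X" "module R (Y\<lparr>comul := g\<rparr>) = module R Y"
  by (rule iffI; erule module_eqI; simp)+

lemma sweedler_update [simp]:
  "sweedler R (X\<lparr>mult := f\<rparr>) t h1 = sweedler R X t h1"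
  "sweedler R (Y\<lparr>comul := g\<rparr>) s h2 = sweedler R Y s h2"
  by (simp_all add: sweedler_def finsum_def finprod_def Let_def cong: if_cong)

lemma aut_inv_update [simp]:
  "aut_inv (X\<lparr>mult := f\<rparr>) = aut_inv X" "aut_inv (Y\<lparr>comul := g\<rparr>) = aut_inv Y"
  by (simp_all add: aut_inv_def)

lemma hom_object_update [simp]:
  "hom_object R (X\<lparr>mult := f\<rparr>) = hom_object R X" "hom_object R (Y\<lparr>comul := g\<rparr>) = hom_object R Y"
  by (simp_all add: hom_object_def)

lemma linear_form_update [simp]:
  "linear_form R (X\<lparr>mult := f\<rparr>) e = linear_form R X e"
  by (simp add: linear_form_def)

lemma hom_coalgebra_update [simp]: "hom_coalgebra R (C\<lparr>mult := m\<rparr>) = hom_coalgebra R C"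
  by (simp add: hom_coalgebra_def)

lemma hom_comodule_update [simp]:
  "hom_right_comodule R (C\<lparr>mult := m\<rparr>) M \<rho> = hom_right_comodule R C M \<rho>"
  "hom_right_comodule R C (Y\<lparr>comul := g\<rparr>) \<rho>' = hom_right_comodule R C Y \<rho>'"
  by (simp_all add: hom_right_comodule_def)

lemma hom_left_module_update [simp]:
  "hom_left_module R (Y\<lparr>comul := g\<rparr>) M l = hom_left_module R Y M l"
  "hom_left_module R H (C\<lparr>mult := m\<rparr>) l' = hom_left_module R H C l'"
  by (simp_all add: hom_left_module_def)

lemma hom_algebra_update [simp]: "hom_algebra R (Y\<lparr>comul := g\<rparr>) = hom_algebra R Y"
  by (simp add: hom_algebra_def)

text \<open>Objects and morphisms refer neither to the multiplication of \<open>C\<close> nor to the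
  comultiplication of \<open>A\<close>. So the opposite datum has literally the same category and
  the same \<open>F\<close> and \<open>G\<close>; only the tensor product of modules
  changes.\<close>

lemma dhh_module_update [simp]:
  "dhh_module R (A\<lparr>comul := g\<rparr>) (C\<lparr>mult := m\<rparr>) M = dhh_module R A C M"
  by (simp add: dhh_module_def)

lemma dhh_morphism_update [simp]:
  "dhh_morphism R (A\<lparr>comul := g\<rparr>) (C\<lparr>mult := m\<rparr>) M N f = dhh_morphism R A C M N f"
  by (simp add: dhh_morphism_def)

lemma dhh_iso_map_update [simp]:
  "dhh_iso_map R (A\<lparr>comul := g\<rparr>) (C\<lparr>mult := m\<rparr>) M N f = dhh_iso_map R A C M N f"
  by (simp add: dhh_iso_map_def)

lemma cotensor_update [simp]:
  "cotensor R (C\<lparr>mult := m\<rparr>) (D\<lparr>mult := m'\<rparr>) \<phi> N = cotensor R C D \<phi> N"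
  "cotensor_module R (C\<lparr>mult := m\<rparr>) (D\<lparr>mult := m'\<rparr>) \<phi> N = cotensor_module R C D \<phi> N"
  by (simp_all add: cotensor_module_def cotensor_def)

lemma is_induced_coaction_update [simp]:
  "is_induced_coaction R (C\<lparr>mult := m\<rparr>) (D\<lparr>mult := m'\<rparr>) \<phi> N = is_induced_coaction R C D \<phi> N"
  by (simp add: is_induced_coaction_def fun_eq_iff)

lemma induced_update [simp]:
  "induced_F R (D\<lparr>mult := m'\<rparr>) \<phi> M = induced_F R D \<phi> M"
  "induced_G R (A\<lparr>comul := g\<rparr>) (C\<lparr>mult := m\<rparr>) (D\<lparr>mult := m'\<rparr>) \<phi> N = induced_G R A C D \<phi> N"
  "G_defined_at R (A\<lparr>comul := g\<rparr>) (C\<lparr>mult := m\<rparr>) (D\<lparr>mult := m'\<rparr>) \<phi> N = G_defined_at R A C D \<phi> N"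
  by (simp_all add: induced_F_def induced_G_def G_defined_at_def)

definition mult_op :: "('k, 'h, 'c) mod_coalg \<Rightarrow> ('k, 'h, 'c) mod_coalg"
  where "mult_op C = C\<lparr>mult := \<lambda>a b. b \<otimes>\<^bsub>C\<^esub> a\<rparr>"

definition comul_op :: "('k, 'r) ring_scheme \<Rightarrow> ('k, 'h, 'a) comod_alg \<Rightarrow> ('k, 'h, 'a) comod_alg"
  where "comul_op R A = A\<lparr>comul := \<lambda>a. sw R A A (tensor R A A) (comul A a) (\<lambda>a1 a2. tens R A A a2 a1)\<rparr>"

text \<open>Reversing the product makes the first equation for an antipode the second one for a
  twisted antipode, and conversely.\<close>

lemma twisted_antipode_op:
  "is_twisted_antipode R C S \<Longrightarrow> is_antipode R (mult_op C) S"
  by (simp add: is_twisted_antipode_def is_antipode_def mult_op_def)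

section \<open>The opposite of a monoidal datum\<close>

context datum
begin

abbreviation "copA \<equiv> \<lambda>a. sw R A A (tensor R A A) (comul A a) (\<lambda>a1 a2. tens R A A a2 a1)"

lemma bialgebra_mult_op: "hom_bialgebra R (mult_op C)"
proof -
  interpret R: cring R using C.module_M by (rule module.axioms(1))
  have "hom_algebra R (mult_op C)"
    unfolding hom_algebra_def mult_op_def
    using C.hom_object C.hom_assoc by (simp)
  moreover have "hom_coalgebra R C" by (rule C.coalgebra)
  \<comment> \<open>The comultiplication of \<open>C\<close> is kept, so reversing the product only
    exchanges the sums over \<open>a\<close> and \<open>b\<close>.\<close>
  moreover have "comul C (b \<otimes>\<^bsub>C\<^esub> a) = sw R C C (tensor R C C) (comul C a) (\<lambda>a1 a2.
      sw R C C (tensor R C C) (comul C b) (\<lambda>b1 b2. tens R C C (b1 \<otimes>\<^bsub>C\<^esub> a1) (b2 \<otimes>\<^bsub>C\<^esub> a2)))"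
    if [simp]: "a \<in> carrier C" "b \<in> carrier C" for a b
    unfolding C.comul_mult[OF that(2,1)] by (rule sw_swap) simp_all
  ultimately show ?thesis
    unfolding hom_bialgebra_def by (simp add: mult_op_def sw_def R.m_comm cong del: sw_cong)
qed

text \<open>Exchanging the legs reads coassociativity backwards and interchanges the two counit
  laws, so the axioms are preserved as a whole.\<close>

lemma bialgebra_comul_op: "hom_bialgebra R (comul_op R A)"
proof -
  have lin: "linear_map R A (tensor R A A) copA" by simp
  note [simp] = linear_map_comp[OF _ lin]
  have "hom_algebra R A" by (rule A.hom_algebra)
  moreover have "hom_coalgebra R (comul_op R A)"
  proof -
    have 1: "copA (aut A a) = sw R A A (tensor R A A) (copA a) (\<lambda>a1 a2. tens R A A (aut A a1) (aut A a2))"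
      if "a \<in> carrier A" for a
      using that by simp
    have 2: "sw R A A (tensor3 R A A A) (copA a) (\<lambda>a1 a2. sw R A A (tensor3 R A A A) (copA a2) (\<lambda>a21 a22.
        tens3 R A A A (aut_inv A a1) a21 a22)) =
      sw R A A (tensor3 R A A A) (copA a) (\<lambda>a1 a2. sw R A A (tensor3 R A A A) (copA a1) (\<lambda>a11 a12.
        tens3 R A A A a11 a12 (aut_inv A a2)))"
      if "a \<in> carrier A" for a
      using that by (simp add: A.self.sw_coassoc)
    have 3: "sw R A A A (copA a) (\<lambda>a1 a2. counit A a1 \<odot>\<^bsub>A\<^esub> a2) = aut_inv A a"
      "sw R A A A (copA a) (\<lambda>a1 a2. counit A a2 \<odot>\<^bsub>A\<^esub> a1) = aut_inv A a"
      if "a \<in> carrier A" for a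
      using that by (simp_all add: A.self.sw_counit A.counit_left)
    show ?thesis
      unfolding hom_coalgebra_def comul_op_def
      using 1 2 3 lin A.hom_object A.self.linear_counit
      by (simp add: sw_def linear_form_def cong del: sw_cong)
  qed
  moreover have "copA (a \<otimes>\<^bsub>A\<^esub> b) = sw R A A (tensor R A A) (copA a) (\<lambda>a1 a2.
      sw R A A (tensor R A A) (copA b) (\<lambda>b1 b2. tens R A A (a1 \<otimes>\<^bsub>A\<^esub> b1) (a2 \<otimes>\<^bsub>A\<^esub> b2)))"
    if "a \<in> carrier A" "b \<in> carrier A" for a b
    using that by simp
  moreover have "copA \<one>\<^bsub>A\<^esub> = tens R A A \<one>\<^bsub>A\<^esub> \<one>\<^bsub>A\<^esub>" by simp
  ultimately show ?thesis
    unfolding hom_bialgebra_def by (simp add: comul_op_def sw_def cong del: sw_cong)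
qed

text \<open>Compatibility pairs the legs \<open>a1\<close>, \<open>a2\<close> with the factors of a
  product in \<open>C\<close>. Reversing both the comultiplication of \<open>A\<close> and the
  product of \<open>C\<close> preserves this pairing; the law becomes the original one with the
  roles of \<open>c\<close> and \<open>d\<close> exchanged.\<close>

lemma datum_op: "monoidal_doi_datum R H (comul_op R A) (mult_op C)"
proof -
  have "doi_datum R H (comul_op R A) (mult_op C)"
    using datum unfolding monoidal_doi_datum_def doi_datum_def hom_comodule_algebra_def
      hom_module_coalgebra_def
    by (simp add: comul_op_def mult_op_def)
  moreover have "sw R A A (tensor3 R A A C) (copA a) (\<lambda>a1 a2.
         sw R A H (tensor3 R A A C) (hcoact A a1) (\<lambda>a10 a11.
           sw R A H (tensor3 R A A C) (hcoact A a2) (\<lambda>a20 a21.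
             tens3 R A A C a10 a20 (hact C a21 d \<otimes>\<^bsub>C\<^esub> hact C a11 c)))) =
       sw R A H (tensor3 R A A C) (hcoact A a) (\<lambda>a0 a1.
         sw R A A (tensor3 R A A C) (copA a0) (\<lambda>a01 a02.
           tens3 R A A C a01 a02 (hact C a1 (d \<otimes>\<^bsub>C\<^esub> c))))"
    (is "?l = ?r") if [simp]: "a \<in> carrier A" "c \<in> carrier C" "d \<in> carrier C" for a c d
  proof -
    have "?l =
      sw R A A (tensor3 R A A C) (comul A a) (\<lambda>a1 a2.
         sw R A H (tensor3 R A A C) (hcoact A a2) (\<lambda>a20 a21.
           sw R A H (tensor3 R A A C) (hcoact A a1) (\<lambda>a10 a11.
             tens3 R A A C a20 a10 (hact C a11 d \<otimes>\<^bsub>C\<^esub> hact C a21 c))))"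
      by simp
    \<comment> \<open>Exchanging the legs has also exchanged the two coaction sums; they are put
      back into the order in which \<open>sw_compat\<close> has them.\<close>
    also have "\<dots> = sw R A A (tensor3 R A A C) (comul A a) (\<lambda>a1 a2.
         sw R A H (tensor3 R A A C) (hcoact A a1) (\<lambda>a10 a11.
           sw R A H (tensor3 R A A C) (hcoact A a2) (\<lambda>a20 a21.
             tens3 R A A C a20 a10 (hact C a11 d \<otimes>\<^bsub>C\<^esub> hact C a21 c))))"
      by (intro sw_cong refl sw_swap) simp_all
    also have "\<dots> = sw R A H (tensor3 R A A C) (hcoact A a) (\<lambda>a0 a1.
         sw R A A (tensor3 R A A C) (comul A a0) (\<lambda>a01 a02.
           tens3 R A A C a02 a01 (hact C a1 (d \<otimes>\<^bsub>C\<^esub> c))))"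
      by (rule sw_compat[where F = "\<lambda>a b e. tens3 R A A C b a e"]) simp_all
    finally show ?thesis by simp
  qed
  moreover have "\<forall>a\<in>carrier A. counit A a \<odot>\<^bsub>C\<^esub> \<one>\<^bsub>C\<^esub> =
         sweedler R C (hcoact A a) (\<lambda>a0 a1. counit A a0 \<odot>\<^bsub>C\<^esub> hact C a1 \<one>\<^bsub>C\<^esub>)"
    using datum by (simp add: monoidal_doi_datum_def)
  ultimately show ?thesis
    unfolding monoidal_doi_datum_def using bialgebra_mult_op bialgebra_comul_op
    by (simp add: mult_op_def comul_op_def sw_def cong del: sw_cong)
qed

end

section \<open>The flip isomorphism and the two tensor isomorphisms\<close>

context dmor
begin

text \<open>A linear inverse of a morphism respects automorphism, action and coaction automatically:
  apply the corresponding law of \<open>f\<close> at \<open>f' n\<close>.\<close>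

lemma dhh_iso_mapI:
  assumes M: "dhh_module R A C M" and N: "dhh_module R A C N"
    and f: "dhh_morphism R A C M N f"
    and f': "linear_map R N M f'" "\<And>m. m \<in> carrier M \<Longrightarrow> f' (f m) = m"
      "\<And>n. n \<in> carrier N \<Longrightarrow> f (f' n) = n"
  shows "dhh_iso_map R A C M N f"
proof -
  interpret M: dhh R H A C M by (rule dhhI) fact
  interpret N: dhh R H A C N by (rule dhhI) fact
  note lin = dhh_morphism_linear[OF f] f'(1)
  note [simp] = linear_mapD(1)[OF lin(1)] linear_mapD(1)[OF lin(2)]
    linear_map_comp[OF _ lin(1)] linear_map_comp[OF _ lin(2)] f'(2,3)
  have f_aut: "f (aut M m) = aut N (f m)" and f_act: "a \<in> carrier A \<Longrightarrow> f (act M a m) = act N a (f m)"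
    if "m \<in> carrier M" for m a
    using f that by (simp_all add: dhh_morphism_def)
  have "f' (aut N n) = aut M (f' n)" if "n \<in> carrier N" for n
    using f_aut[of "f' n"] f'(2)[of "aut M (f' n)"] that by simp
  moreover have "f' (act N a n) = act M a (f' n)" if "a \<in> carrier A" "n \<in> carrier N" for a n
    using f_act[of "f' n" a] f'(2)[of "act M a (f' n)"] that by simp
  moreover have "coact M (f' n) = sw R N C (tensor R M C) (coact N n) (\<lambda>m0 m1. tens R M C (f' m0) m1)"
    if "n \<in> carrier N" for n
    using dhh_morphism_coact[OF f, of "f' n"] that by simp
  ultimately have "dhh_morphism R A C N M f'"
    using f'(1) by (simp add: dhh_morphism_def sw_def)
  then show ?thesis using M N f f'(2,3) by (auto simp: dhh_iso_map_def)
qed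

text \<open>In the opposite datum \<open>a2\<close> acts on \<open>m\<close> and \<open>a1\<close>
  on \<open>n\<close>, and the coaction multiplies \<open>n1\<close> by \<open>m1\<close>. These are
  the structure maps of \<open>N \<otimes> M\<close> read through the flip.\<close>

lemma flip_iso:
  assumes M: "dhh_module R A C M" and N: "dhh_module R A C N"
  shows "dhh_isomorphic R A C (dhh_tensor R (comul_op R A) (mult_op C) M N) (dhh_tensor R A C N M)"
proof -
  interpret M: dhh R H A C M by (rule dhhI) fact
  interpret N: dhh R H A C N by (rule dhhI) fact
  interpret NM: tpair R H A C N M ..
  let ?A = "comul_op R A" and ?C = "mult_op C"
  interpret O: datum R H ?A ?C by (rule datumI[OF C.datum_op])
  have dhh_op: "dhh R H ?A ?C X" if "dhh_module R A C X" for X :: "('k, 'a, 'c, 'x) dhh"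
    using that
    by (intro dhh.intro dhh_axioms.intro O.A.halg_axioms O.C.hcoalg_axioms O.module_H
      O.linear_hcoact O.bilinear_hact) (simp add: comul_op_def mult_op_def)
  interpret MN: tpair R H ?A ?C M N
    by (intro tpair.intro dhh_op M N O.tdatum_axioms)
  let ?T = "tensor R M N" and ?T' = "tensor R N M"
  define e where "e = dhh_tensor R ?A ?C M N"
  have e_module: "dhh_module R A C e"
    using MN.dhh_tensor_module by (simp add: e_def comul_op_def mult_op_def)
  interpret e: dhh R H A C e by (rule dhhI[OF e_module])
  interpret p: dhh R H A C "dhh_tensor R A C N M" by (rule dhhI[OF NM.dhh_tensor_module])
  have e_eq: "e = dhh_make ?T MN.tau MN.tact MN.tcoact" unfolding e_def by (rule MN.dhh_tensor_eq)
  have e_act: "MN.tact a (tens R M N m n) =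
      sw R A A ?T (comul A a) (\<lambda>a1 a2. tens R M N (act M a2 m) (act N a1 n))"
    if "a \<in> carrier A" "m \<in> carrier M" "n \<in> carrier N" for a m n
    using MN.tact_tens[of a m n] that by (simp add: comul_op_def sw_def cong del: sw_cong)
      (simp flip: sw_def[of R A A])
  have e_coact: "MN.tcoact (tens R M N m n) = sw R M C (tensor R ?T C) (coact M m) (\<lambda>m0 m1.
      sw R N C (tensor R ?T C) (coact N n) (\<lambda>n0 n1. tens R ?T C (tens R M N m0 n0) (n1 \<otimes>\<^bsub>C\<^esub> m1)))"
    if "m \<in> carrier M" "n \<in> carrier N" for m n
    using MN.tcoact_tens[of m n] that by (simp add: mult_op_def sw_def cong del: sw_cong)
  define f where "f t = sw R M N ?T' t (\<lambda>m n. tens R N M n m)" for t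
  define f' where "f' t = sw R N M ?T t (\<lambda>n m. tens R M N m n)" for t
  have lin: "linear_map R ?T ?T' f" "linear_map R ?T' ?T f'" unfolding f_def f'_def by simp_all
  have f_tens [simp]: "f (tens R M N m n) = tens R N M n m" "f' (tens R N M n m) = tens R M N m n"
    if "m \<in> carrier M" "n \<in> carrier N" for m n
    unfolding f_def f'_def using that by simp_all
  note [simp] = lin[THEN linear_map_comp[rotated]] lin[THEN linear_mapD(1)]
  have inv: "\<forall>t\<in>carrier ?T. f' (f t) = t" "\<forall>t\<in>carrier ?T'. f (f' t) = t"
    by (rule tensor_ext[where P = ?T] tensor_ext[where P = ?T']; simp)+
  have lin_coact: "linear_map R ?T (tensor R ?T C) MN.tcoact"
    using MN.linear_tcoact by (simp add: mult_op_def)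
  have lin_act: "linear_map R ?T ?T (MN.tact a)" if "a \<in> carrier A" for a
    using bilinear_mapD(1)[OF MN.bilinear_tact, of a] that by (simp add: comul_op_def)
  note [simp] = linear_map_comp[OF _ lin_coact] linear_mapD(1)[OF lin_coact]
    linear_map_comp[OF _ lin_act] linear_mapD(1)[OF lin_act]
  have 1: "\<forall>t\<in>carrier ?T. f (MN.tau t) = NM.tau (f t)"
    by (rule tensor_ext[where P = ?T']) simp_all
  have f_sw [simp]: "f (sw R X Y ?T t h) = sw R X Y ?T' t (\<lambda>a b. f (h a b))"
    if "module R X" "module R Y" "t \<in> carrier (tensor R X Y)"
      "\<And>a b. a \<in> carrier X \<Longrightarrow> b \<in> carrier Y \<Longrightarrow> h a b \<in> carrier ?T"
    for X :: "('k, 'x, 'x1) module_scheme" and Y :: "('k, 'y, 'y1) module_scheme" and t h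
    using that by (intro linear_sw lin) simp_all
  have 2: "\<forall>t\<in>carrier ?T. f (MN.tact a t) = NM.tact a (f t)" if [simp]: "a \<in> carrier A" for a
    by (rule tensor_ext[where P = ?T']) (simp_all add: e_act)
  have 3: "\<forall>t\<in>carrier ?T. NM.tcoact (f t) =
      sw R ?T C (tensor R ?T' C) (MN.tcoact t) (\<lambda>m0 m1. tens R ?T' C (f m0) m1)"
  proof (rule tensor_ext[where P = "tensor R ?T' C"])
    fix m n assume [simp]: "m \<in> carrier M" "n \<in> carrier N"
    show "NM.tcoact (f (tens R M N m n)) = sw R ?T C (tensor R ?T' C) (MN.tcoact (tens R M N m n))
        (\<lambda>m0 m1. tens R ?T' C (f m0) m1)"
      by (simp add: e_coact sw_push[where t = "coact N n"] del: MN.tcoact_tens)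
  qed simp_all
  have "dhh_morphism R A C e (dhh_tensor R A C N M) f"
    unfolding dhh_morphism_def e_eq NM.dhh_tensor_eq dhh_make_simps
    using 1 2 3 lin by (simp add: sw_def cong del: sw_cong)
  then have "dhh_iso_map R A C e (dhh_tensor R A C N M) f"
    by (rule dhh_iso_mapI[OF e_module NM.dhh_tensor_module, of f f'])
      (use inv lin in \<open>simp_all add: e_eq NM.dhh_tensor_eq\<close>)
  then show ?thesis unfolding dhh_isomorphic_def e_def by blast
qed

theorem hopf_iso:
  fixes M :: "('k, 'a, 'c, 'm) dhh" and N :: "('k, 'a, 'd, 'n) dhh"
  assumes M: "dhh_module R A C M" and N: "dhh_module R A D N"
    and flat: "flat_module TYPE(('k, 'n, 'c) tensor) R M"
      "flat_module TYPE(('k, ('k, 'n, 'd) tensor, 'c) tensor) R M"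
      "flat_module TYPE(('k, ('k, 'n, 'c) tensor, 'c) tensor) R M"
    and G: "G_defined_at R A C D \<phi> N" and S: "is_antipode R C S"
  shows "G_defined_at R A C D \<phi> (dhh_tensor R A D (induced_F R D \<phi> M) N)"
    and "dhh_isomorphic R A C (dhh_tensor R A C M (induced_G R A C D \<phi> N))
      (induced_G R A C D \<phi> (dhh_tensor R A D (induced_F R D \<phi> M) N))"
proof -
  interpret antipode_transport R H A C D \<phi> N M S
    by (intro antipode_transport.intro antipode_transport_axioms.intro cotensor_defined.intro
      cotensor_defined_axioms.intro dmor_axioms dhhI dhhI_D assms)
  show "G_defined_at R A C D \<phi> (dhh_tensor R A D (induced_F R D \<phi> M) N)"
    by (rule transport.G_defined)
  show "dhh_isomorphic R A C (dhh_tensor R A C M (induced_G R A C D \<phi> N))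
      (induced_G R A C D \<phi> (dhh_tensor R A D (induced_F R D \<phi> M) N))"
    unfolding dhh_isomorphic_def using transport.G_iso by blast
qed

lemma dmor_op: "dmor R H (comul_op R A) (mult_op C) (mult_op D) \<phi>"
proof -
  have "monoidal_doi_morphism R H (mult_op C) (mult_op D) \<phi>"
    using morphism by (simp add: monoidal_doi_morphism_def mult_op_def)
  then show ?thesis
    by (intro dmor.intro dmor_axioms.intro datumI C.datum_op D.datum_op)
qed

text \<open>The chain is \<open>G(N) \<otimes> M\<close>, flipped over \<open>C\<close> to the
  opposite tensor product of \<open>M\<close> and \<open>G(N)\<close>; then the antipode case for
  the opposite datum; then \<open>G\<close> applied to the flip of \<open>F(M)\<close> and
  \<open>N\<close> over \<open>D\<close>.\<close>

theorem twisted_iso: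
  fixes M :: "('k, 'a, 'c, 'm) dhh" and N :: "('k, 'a, 'd, 'n) dhh"
  assumes M: "dhh_module R A C M" and N: "dhh_module R A D N"
    and flat: "flat_module TYPE(('k, 'n, 'c) tensor) R M"
      "flat_module TYPE(('k, ('k, 'n, 'd) tensor, 'c) tensor) R M"
      "flat_module TYPE(('k, ('k, 'n, 'c) tensor, 'c) tensor) R M"
    and G: "G_defined_at R A C D \<phi> N" and S: "is_twisted_antipode R C S"
  shows "G_defined_at R A C D \<phi> (dhh_tensor R A D N (induced_F R D \<phi> M))"
    and "dhh_isomorphic R A C (dhh_tensor R A C (induced_G R A C D \<phi> N) M)
      (induced_G R A C D \<phi> (dhh_tensor R A D N (induced_F R D \<phi> M)))"
proof -
  let ?A = "comul_op R A" and ?C = "mult_op C" and ?D = "mult_op D"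
  let ?F = "induced_F R D \<phi> M" and ?G = "induced_G R A C D \<phi>"
  interpret O: dmor R H ?A ?C ?D \<phi> by (rule dmor_op)
  \<comment> \<open>The flip is available for the source datum of a morphism. The identity of
    \<open>D\<close> makes \<open>D\<close> a source, so that \<open>F(M)\<close> and
    \<open>N\<close> can be flipped over it.\<close>
  interpret D: dmor R H A D D "\<lambda>d. d"
    by (intro dmor.intro dmor_axioms.intro D.datum_axioms)
      (simp add: monoidal_doi_morphism_def linear_map_id flip: sw_def[of R D D])
  have op: "G_defined_at R A C D \<phi> (dhh_tensor R ?A ?D ?F N)"
    "dhh_isomorphic R A C (dhh_tensor R ?A ?C M (?G N)) (?G (dhh_tensor R ?A ?D ?F N))"
    using O.hopf_iso[of M N S] M N flat G twisted_antipode_op[OF S]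
    by (simp_all add: mult_op_def comul_op_def dhh_isomorphic_def)
  have GN: "dhh_module R A C (?G N)" using G by (simp add: G_defined_at_def)
  have flip: "dhh_isomorphic R A D (dhh_tensor R ?A ?D ?F N) (dhh_tensor R A D N ?F)"
    by (rule D.flip_iso[OF induced_F_module[OF M] N])
  show "G_defined_at R A C D \<phi> (dhh_tensor R A D N ?F)"
    by (rule G_functorial(1)[OF flip op(1)])
  show "dhh_isomorphic R A C (dhh_tensor R A C (?G N) M) (?G (dhh_tensor R A D N ?F))"
    using dhh_iso_trans[OF dhh_iso_sym[OF flip_iso[OF M GN]] op(2)] G_functorial(2)[OF flip op(1)]
    by (rule dhh_iso_trans)
qed

end

theorem theorem4p3:
  fixes R :: "('k, 'r) ring_scheme"
    and H :: "('k, 'h) hom_coalg"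
    and A :: "('k, 'h, 'a) comod_alg"
    and C :: "('k, 'h, 'c) mod_coalg"
    and C' :: "('k, 'h, 'd) mod_coalg"
    and \<phi> :: "'c \<Rightarrow> 'd"
  assumes "cring R"
    and "monoidal_doi_datum R H A C"
    and "monoidal_doi_datum R H A C'"
    and "monoidal_doi_morphism R H C C' \<phi>"
  shows "(G_defined_at R A C C' \<phi> (self_dhh R H A C') \<and>
      dhh_iso_map R A C (self_dhh R H A C) (induced_G R A C C' \<phi> (self_dhh R H A C'))
        (\<lambda>c. sweedler R (tensor R C' C) (comul C c) (\<lambda>c1 c2. tens R C' C (\<phi> c1) c2))) \<and>
    (\<forall>(M :: ('k, 'a, 'c, 'm) dhh) (N :: ('k, 'a, 'd, 'n) dhh).
      dhh_module R A C M \<longrightarrow>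
      flat_module TYPE(('k, 'n, 'c) tensor) R M \<longrightarrow>
      flat_module TYPE(('k, ('k, 'n, 'd) tensor, 'c) tensor) R M \<longrightarrow>
      flat_module TYPE(('k, ('k, 'n, 'c) tensor, 'c) tensor) R M \<longrightarrow>
      dhh_module R A C' N \<longrightarrow>
      G_defined_at R A C C' \<phi> N \<longrightarrow>
      (hom_hopf_algebra R C \<longrightarrow>
        G_defined_at R A C C' \<phi> (dhh_tensor R A C' (induced_F R C' \<phi> M) N) \<and>
        dhh_isomorphic R A C
          (dhh_tensor R A C M (induced_G R A C C' \<phi> N))
          (induced_G R A C C' \<phi> (dhh_tensor R A C' (induced_F R C' \<phi> M) N))) \<and>
      ((\<exists>S. is_twisted_antipode R C S) \<longrightarrow>
        G_defined_at R A C C' \<phi> (dhh_tensor R A C' N (induced_F R C' \<phi> M)) \<and>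
        dhh_isomorphic R A C
          (dhh_tensor R A C (induced_G R A C C' \<phi> N) M)
          (induced_G R A C C' \<phi> (dhh_tensor R A C' N (induced_F R C' \<phi> M)))))"
proof -
  interpret dmor R H A C C' \<phi>
    by (intro dmor.intro dmor_axioms.intro datumI assms)
  interpret self: gtransport R H A C C' \<phi> "self_dhh R H A C" "self_dhh R H A C'" can
    by (rule self_gtransport)
  have "can = (\<lambda>c. sweedler R (tensor R C' C) (comul C c) (\<lambda>c1 c2. tens R C' C (\<phi> c1) c2))"
    unfolding can_def[abs_def] sw_def by (rule refl)
  then show ?thesis
    using self.G_defined self.G_iso hopf_iso twisted_iso
    unfolding hom_hopf_algebra_def by simp blast
qed

end
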